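(* Let $G$ be a compact group and let $1\le p_0,p_1<\infty$. Then for every $0<\theta<1$, $$\big(\ell_{sch}^{p_0}(\widehat{G}),\ell_{sch}^{p_1}(\widehat{G})\big)_{\theta}=\ell_{sch}^{p}(\widehat{G})$$ with equal norms, where $\frac1p=\frac{1-\theta}{p_0}+\frac{\theta}{p_1}$.
   Context: $G$ is a compact topological group. $\widehat{G}$ is its unitary dual, the set of equivalence classes $[\xi]$ of strongly continuous irreducible unitary representations $\xi:G\to\mathcal{U}(\mathcal{H}_\xi)$; one representative is fixed per class. Each $\mathcal{H}_\xi$ is a finite-dimensional complex Hilbert space and $\dim(\xi):=\dim(\mathcal{H}_\xi)$. $\mathcal{M}(\widehat{G})$ is the complex vector space (pointwise operations) of all maps $H$ assigning to each $[\xi]\in\widehat{G}$ a linear operator $H(\xi)\in\mathcal{L}(\mathcal{H}_\xi)$. For $1\le p<\infty$, $\|A\|_{\mathcal{S}^p(\mathcal{H}_\xi)}=(\mathrm{Tr}(|A|^p))^{1/p}$ is the Schatten norm, and $\ell_{sch}^{p}(\widehat{G})$ is the Banach space of all $H\in\mathcal{M}(\widehat{G})$ with $$\|H\|_{\ell_{sch}^{p}(\widehat{G})}:=\Big(\sum_{[\xi]\in\widehat{G}}\dim(\xi)\,\|H(\xi)\|_{\mathcal{S}^{p}(\mathcal{H}_{\xi})}^{p}\Big)^{1/p}<\infty.$$ Complex interpolation: let $X_0,X_1$ be complex Banach spaces that are subspaces of a common vector space (here $\mathcal{M}(\widehat{G})$), and let $X_0+X_1$ carry the norm $\|x\|_{X_0+X_1}=\inf\{\|x_0\|_{X_0}+\|x_1\|_{X_1}: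 x=x_0+x_1,\ x_j\in X_j\}$. $\mathcal{F}(X_0,X_1)$ is the space of functions $f$ with values in $X_0+X_1$ that are bounded and continuous on the strip $\{0\le\mathrm{Re}\,z\le1\}$, analytic on $\{0<\mathrm{Re}\,z<1\}$, and such that for $j=0,1$ the function $t\mapsto f(j+it)$ is continuous from $\mathbb{R}$ into $X_j$ and tends to zero as $|t|\to\infty$. Its norm is $\|f\|_{\mathcal{F}}=\max\{\sup_{t}\|f(it)\|_{X_0},\sup_t\|f(1+it)\|_{X_1}\}$. For $0<\theta<1$, $(X_0,X_1)_\theta$ is the space of all $x\in X_0+X_1$ with $x=f(\theta)$ for some $f\in\mathcal{F}(X_0,X_1)$, with norm $\|x\|_{(X_0,X_1)_\theta}=\inf\{\|f\|_{\mathcal{F}}: f\in\mathcal{F}(X_0,X_1),\ f(\theta)=x\}$. *)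

theory Defs
  imports
    "HOL-Analysis.Infinite_Sum"
    "HOL-Analysis.Product_Topology"
    "Jordan_Normal_Form.Schur_Decomposition"
    "Jordan_Normal_Form.VS_Connect"
begin

section \<open>Complex interpolation\<close>

text \<open>
  A normed space lying in an ambient complex vector space is a set of points together with a
  norm; the norm is meaningful on the points only. The ambient vector space is a module record
  \<open>V\<close> over the field of complex numbers (\<open>class_ring\<close>).
\<close>

record 'v normed_sub =
  points :: "'v set"
  nrm :: "'v \<Rightarrow> real"

definition sum_space :: "(complex, 'v, 'm) module_scheme \<Rightarrow> 'v normed_sub \<Rightarrow> 'v normed_sub \<Rightarrow> 'v normed_sub"
  where "sum_space V X0 X1 =
    \<lparr>points = {x0 \<oplus>\<^bsub>V\<^esub> x1 | x0 x1. x0 \<in> points X0 \<and> x1 \<in> points X1},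
     nrm = (\<lambda>x. Inf {nrm X0 x0 + nrm X1 x1 | x0 x1.
                       x0 \<in> points X0 \<and> x1 \<in> points X1 \<and> x = x0 \<oplus>\<^bsub>V\<^esub> x1})\<rparr>"

definition norm_continuous_on ::
    "(complex, 'v, 'm) module_scheme \<Rightarrow> 'v normed_sub \<Rightarrow> 'a::topological_space set \<Rightarrow> ('a \<Rightarrow> 'v) \<Rightarrow> bool"
  where "norm_continuous_on V X S f \<longleftrightarrow>
    f ` S \<subseteq> points X \<and>
    (\<forall>z\<in>S. ((\<lambda>w. nrm X (f w \<ominus>\<^bsub>V\<^esub> f z)) \<longlongrightarrow> 0) (at z within S))"

text \<open>
  Analyticity on an open set, as complex differentiability with respect to the norm of \<open>X\<close>
  (as in the library's definition of \<open>analytic_on\<close>).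
\<close>

definition norm_analytic_on ::
    "(complex, 'v, 'm) module_scheme \<Rightarrow> 'v normed_sub \<Rightarrow> complex set \<Rightarrow> (complex \<Rightarrow> 'v) \<Rightarrow> bool"
  where "norm_analytic_on V X S f \<longleftrightarrow>
    f ` S \<subseteq> points X \<and>
    (\<forall>z\<in>S. \<exists>d\<in>points X.
       ((\<lambda>w. nrm X (((1 / (w - z)) \<odot>\<^bsub>V\<^esub> (f w \<ominus>\<^bsub>V\<^esub> f z)) \<ominus>\<^bsub>V\<^esub> d)) \<longlongrightarrow> 0) (at z))"

definition boundary_admissible ::
    "(complex, 'v, 'm) module_scheme \<Rightarrow> 'v normed_sub \<Rightarrow> (real \<Rightarrow> 'v) \<Rightarrow> bool"
  where "boundary_admissible V X g \<longleftrightarrow>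
    norm_continuous_on V X UNIV g \<and> ((\<lambda>t. nrm X (g t)) \<longlongrightarrow> 0) at_infinity"

text \<open>
  Only the values on the closed strip matter, so an element of the space of admissible functions
  is represented by any of its extensions to the plane.
\<close>

definition interp_functions ::
    "(complex, 'v, 'm) module_scheme \<Rightarrow> 'v normed_sub \<Rightarrow> 'v normed_sub \<Rightarrow> (complex \<Rightarrow> 'v) set"
  where "interp_functions V X0 X1 =
    {f. norm_continuous_on V (sum_space V X0 X1) {z. 0 \<le> Re z \<and> Re z \<le> 1} f \<and>
        (\<exists>B. \<forall>z. 0 \<le> Re z \<and> Re z \<le> 1 \<longrightarrow> nrm (sum_space V X0 X1) (f z) \<le> B) \<and>
        norm_analytic_on V (sum_space V X0 X1) {z. 0 < Re z \<and> Re z < 1} f \<and>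
        boundary_admissible V X0 (\<lambda>t. f (Complex 0 t)) \<and>
        boundary_admissible V X1 (\<lambda>t. f (Complex 1 t))}"

definition interp_functions_norm :: "'v normed_sub \<Rightarrow> 'v normed_sub \<Rightarrow> (complex \<Rightarrow> 'v) \<Rightarrow> real"
  where "interp_functions_norm X0 X1 f =
    max (SUP t. nrm X0 (f (Complex 0 t))) (SUP t. nrm X1 (f (Complex 1 t)))"

definition complex_interp ::
    "(complex, 'v, 'm) module_scheme \<Rightarrow> 'v normed_sub \<Rightarrow> 'v normed_sub \<Rightarrow> real \<Rightarrow> 'v normed_sub"
  where "complex_interp V X0 X1 \<theta> =
    \<lparr>points = {x \<in> points (sum_space V X0 X1).
                 \<exists>f\<in>interp_functions V X0 X1. f (complex_of_real \<theta>) = x},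
     nrm = (\<lambda>x. Inf {interp_functions_norm X0 X1 f | f.
                       f \<in> interp_functions V X0 X1 \<and> f (complex_of_real \<theta>) = x})\<rparr>"


section \<open>The Schatten norm\<close>

definition unitary_mat :: "nat \<Rightarrow> complex mat \<Rightarrow> bool"
  where "unitary_mat n U \<longleftrightarrow>
    U \<in> carrier_mat n n \<and> U * mat_adjoint U = 1\<^sub>m n \<and> mat_adjoint U * U = 1\<^sub>m n"

text \<open>
  Functional calculus \<open>f(A)\<close> of a self-adjoint matrix \<open>A\<close>: any unitary diagonalisation of \<open>A\<close>
  gives the same result, see \<open>mat_fun_unique\<close> below.
\<close>

definition is_mat_fun :: "(real \<Rightarrow> real) \<Rightarrow> complex mat \<Rightarrow> complex mat \<Rightarrow> bool"
  where "is_mat_fun f A B \<longleftrightarrow>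
    (\<exists>n U d. unitary_mat n U \<and>
       A = U * mat_diag n (\<lambda>i. complex_of_real (d i)) * mat_adjoint U \<and>
       B = U * mat_diag n (\<lambda>i. complex_of_real (f (d i))) * mat_adjoint U)"

definition mat_fun :: "(real \<Rightarrow> real) \<Rightarrow> complex mat \<Rightarrow> complex mat"
  where "mat_fun f A = (THE B. is_mat_fun f A B)"

definition mat_abs :: "complex mat \<Rightarrow> complex mat"
  where "mat_abs A = mat_fun sqrt (mat_adjoint A * A)"

definition mat_trace :: "complex mat \<Rightarrow> complex"
  where "mat_trace A = sum_list (diag_mat A)"

text \<open>The trace of \<open>|A|^p\<close> is a nonnegative real; \<open>0 powr p = 0\<close> is the right value for \<open>p > 0\<close>.\<close>

definition schatten_norm :: "real \<Rightarrow> complex mat \<Rightarrow> real"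
  where "schatten_norm p A = Re (mat_trace (mat_fun (\<lambda>x. x powr p) (mat_abs A))) powr (1 / p)"

lemma mat_adjoint_carrier [simp]:
  "A \<in> carrier_mat m n \<Longrightarrow> mat_adjoint A \<in> carrier_mat n m"
  unfolding mat_adjoint_def carrier_mat_def by auto

lemma mat_fun_unique:
  assumes "is_mat_fun f A B" and "is_mat_fun f A C"
  shows "B = C"
proof -
  obtain n U d where U: "unitary_mat n U"
    and A: "A = U * mat_diag n (\<lambda>i. complex_of_real (d i)) * mat_adjoint U"
    and B: "B = U * mat_diag n (\<lambda>i. complex_of_real (f (d i))) * mat_adjoint U"
    using assms(1) unfolding is_mat_fun_def by blast
  obtain m V e where V: "unitary_mat m V"
    and A': "A = V * mat_diag m (\<lambda>i. complex_of_real (e i)) * mat_adjoint V"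
    and C: "C = V * mat_diag m (\<lambda>i. complex_of_real (f (e i))) * mat_adjoint V"
    using assms(2) unfolding is_mat_fun_def by blast
  have "dim_row A = n" using U unfolding A unitary_mat_def by auto
  moreover have "dim_row A = m" using V unfolding A' unitary_mat_def by auto
  ultimately have m: "m = n" by simp
  define U' where "U' = mat_adjoint U"
  define V' where "V' = mat_adjoint V"
  have c [simp]: "U \<in> carrier_mat n n" "V \<in> carrier_mat n n"
    "U' \<in> carrier_mat n n" "V' \<in> carrier_mat n n"
    using U V m unfolding unitary_mat_def U'_def V'_def by auto
  have I: "U * U' = 1\<^sub>m n" "U' * U = 1\<^sub>m n" "V * V' = 1\<^sub>m n" "V' * V = 1\<^sub>m n"
    using U V m unfolding unitary_mat_def U'_def V'_def by auto
  define D where "D g = mat_diag n (\<lambda>i. complex_of_real (g (d i)))" for g :: "real \<Rightarrow> real"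
  define E where "E g = mat_diag n (\<lambda>i. complex_of_real (g (e i)))" for g :: "real \<Rightarrow> real"
  have cD [simp]: "D g \<in> carrier_mat n n" "E g \<in> carrier_mat n n" for g
    unfolding D_def E_def by auto
  define W where "W = V' * U"
  have W [simp]: "W \<in> carrier_mat n n" unfolding W_def by (rule mult_carrier_mat[of _ n n]) auto
  have assoc: "X * Y * Z = X * (Y * Z)"
    if "X \<in> carrier_mat n n" "Y \<in> carrier_mat n n" "Z \<in> carrier_mat n n" for X Y Z :: "complex mat"
    using that by (rule assoc_mult_mat)
  have mc: "X * Y \<in> carrier_mat n n"
    if "X \<in> carrier_mat n n" "Y \<in> carrier_mat n n" for X Y :: "complex mat"
    using that by (rule mult_carrier_mat)
  have cancel: "X * (X' * Z) = Z" if "X * X' = 1\<^sub>m n" "X \<in> carrier_mat n n" "X' \<in> carrier_mat n n"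
    "Z \<in> carrier_mat n n" for X X' Z :: "complex mat"
    using that by (metis assoc left_mult_one_mat)
  have right_one: "X * 1\<^sub>m n = X" if "X \<in> carrier_mat n n" for X :: "complex mat"
    using that by simp
  have AA: "U * D (\<lambda>x. x) * U' = V * E (\<lambda>x. x) * V'"
    using A A' m unfolding D_def E_def U'_def V'_def by simp
  have "W * D (\<lambda>x. x) = V' * (U * D (\<lambda>x. x) * U') * U"
    unfolding W_def by (simp add: assoc mc I cancel right_one)
  also have "\<dots> = E (\<lambda>x. x) * W"
    unfolding AA W_def by (simp add: assoc mc I cancel right_one)
  finally have WD: "W * D (\<lambda>x. x) = E (\<lambda>x. x) * W" .
  have ent: "W $$ (i,j) * complex_of_real (d j) = complex_of_real (e i) * W $$ (i,j)"
    if "i < n" "j < n" for i j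
    using arg_cong[OF WD, of "\<lambda>X. X $$ (i,j)"] that
    unfolding D_def E_def by (simp add: mat_diag_mult_left[OF W] mat_diag_mult_right[OF W])
  have WDf: "W * D f = E f * W"
  proof (rule eq_matI)
    fix i j assume "i < dim_row (E f * W)" "j < dim_col (E f * W)"
    hence ij: "i < n" "j < n" using mc[OF cD(2) W, of f] by auto
    have "W $$ (i,j) = 0 \<or> d j = e i"
      using ent[OF ij] by (metis mult.commute mult_cancel_left of_real_eq_iff)
    thus "(W * D f) $$ (i,j) = (E f * W) $$ (i,j)"
      using ij unfolding D_def E_def
      by (auto simp: mat_diag_mult_left[OF W] mat_diag_mult_right[OF W])
  qed (use carrier_matD[OF mc[OF cD(2) W, of f]] carrier_matD[OF mc[OF W cD(1), of f]] in metis)+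
  have "B = U * D f * U'" using B unfolding D_def U'_def .
  also have "\<dots> = V * (W * D f) * U'"
    unfolding W_def by (simp add: assoc mc I cancel right_one)
  also have "\<dots> = V * E f * V'"
    unfolding WDf unfolding W_def by (simp add: assoc mc I cancel right_one)
  also have "\<dots> = C" using C m unfolding E_def V'_def by simp
  finally show ?thesis .
qed


section \<open>Compact groups and their unitary dual\<close>

locale topological_group = group G for G :: "('g, 'm) monoid_scheme" (structure) +
  fixes T :: "'g topology"
  assumes topspace_carrier: "topspace T = carrier G"
    and continuous_mult: "continuous_map (prod_topology T T) T (\<lambda>(x, y). x \<otimes> y)"
    and continuous_inv: "continuous_map T T (\<lambda>x. inv x)"

locale compact_group = topological_group +
  assumes compact: "compact_space T"

definition unitary_group :: "nat \<Rightarrow> complex mat monoid"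
  where "unitary_group n = \<lparr>carrier = {U. unitary_mat n U}, monoid.mult = (*), one = 1\<^sub>m n\<rparr>"

text \<open>
  A finite-dimensional unitary representation, transported to the Hilbert space \<open>\<complex>\<^sup>n\<close> by an
  orthonormal basis: the dimension \<open>n\<close> together with a matrix-valued map.
\<close>

type_synonym 'g unirep = "nat \<times> ('g \<Rightarrow> complex mat)"

text \<open>
  Strong continuity: every orbit map \<open>g \<mapsto> \<xi>(g) v\<close> is continuous into \<open>\<complex>\<^sup>n\<close>, whose topology is
  that of coordinatewise convergence.
\<close>

definition unitary_rep :: "('g, 'm) monoid_scheme \<Rightarrow> 'g topology \<Rightarrow> 'g unirep \<Rightarrow> bool"
  where "unitary_rep G T = (\<lambda>(n, \<xi>).
    \<xi> \<in> hom G (unitary_group n) \<and>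
    (\<forall>v\<in>carrier_vec n. \<forall>i<n. continuous_map T euclidean (\<lambda>g. vec_index (\<xi> g *\<^sub>v v) i)))"

definition irreducible_rep :: "('g, 'm) monoid_scheme \<Rightarrow> 'g unirep \<Rightarrow> bool"
  where "irreducible_rep G = (\<lambda>(n, \<xi>).
    n > 0 \<and>
    (\<forall>W. VectorSpace.subspace class_ring W (module_vec TYPE(complex) n) \<and>
         (\<forall>g\<in>carrier G. \<forall>w\<in>W. \<xi> g *\<^sub>v w \<in> W) \<longrightarrow>
         W = {0\<^sub>v n} \<or> W = carrier_vec n))"

definition irreps :: "('g, 'm) monoid_scheme \<Rightarrow> 'g topology \<Rightarrow> 'g unirep set"
  where "irreps G T = {\<xi>. unitary_rep G T \<xi> \<and> irreducible_rep G \<xi>}"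

definition rep_equiv :: "('g, 'm) monoid_scheme \<Rightarrow> 'g topology \<Rightarrow> ('g unirep \<times> 'g unirep) set"
  where "rep_equiv G T = {((n, \<xi>), (m, \<eta>)).
    (n, \<xi>) \<in> irreps G T \<and> (m, \<eta>) \<in> irreps G T \<and> m = n \<and>
    (\<exists>U. unitary_mat n U \<and> (\<forall>g\<in>carrier G. U * \<xi> g = \<eta> g * U))}"

definition unitary_dual :: "('g, 'm) monoid_scheme \<Rightarrow> 'g topology \<Rightarrow> 'g unirep set set"
  where "unitary_dual G T = irreps G T // rep_equiv G T"

definition representatives ::
    "('g, 'm) monoid_scheme \<Rightarrow> 'g topology \<Rightarrow> ('g unirep set \<Rightarrow> 'g unirep) \<Rightarrow> bool"
  where "representatives G T r \<longleftrightarrow> (\<forall>c\<in>unitary_dual G T. r c \<in> c)"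


section \<open>Matrix-valued fields on the dual\<close>

text \<open>
  In the following \<open>r\<close> is the choice of representatives, so the class \<open>c\<close> has the dimension
  \<open>fst (r c)\<close>, and operators on its representation space are square matrices of that size.
  Fields are extensional functions, so that they form a vector space.
\<close>

definition matrix_fields ::
    "('g, 'm) monoid_scheme \<Rightarrow> 'g topology \<Rightarrow> ('g unirep set \<Rightarrow> 'g unirep) \<Rightarrow>
     (complex, 'g unirep set \<Rightarrow> complex mat) module"
  where "matrix_fields G T r =
    \<lparr>carrier = (\<Pi>\<^sub>E c\<in>unitary_dual G T. carrier_mat (fst (r c)) (fst (r c))),
     monoid.mult = (\<lambda>H K. \<lambda>c\<in>unitary_dual G T. H c * K c),
     one = (\<lambda>c\<in>unitary_dual G T. 1\<^sub>m (fst (r c))),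
     zero = (\<lambda>c\<in>unitary_dual G T. 0\<^sub>m (fst (r c)) (fst (r c))),
     add = (\<lambda>H K. \<lambda>c\<in>unitary_dual G T. H c + K c),
     module.smult = (\<lambda>a H. \<lambda>c\<in>unitary_dual G T. a \<cdot>\<^sub>m H c)\<rparr>"

lemma vectorspace_matrix_fields: "vectorspace class_ring (matrix_fields G T r)"
proof -
  note [simp] = matrix_fields_def PiE_iff
  have "abelian_group (matrix_fields G T r)"
  proof (rule abelian_groupI)
    fix x y z
    assume x: "x \<in> carrier (matrix_fields G T r)" and y: "y \<in> carrier (matrix_fields G T r)"
      and z: "z \<in> carrier (matrix_fields G T r)"
    show "x \<oplus>\<^bsub>matrix_fields G T r\<^esub> y \<in> carrier (matrix_fields G T r)"
      using x y by auto
    show "x \<oplus>\<^bsub>matrix_fields G T r\<^esub> y \<oplus>\<^bsub>matrix_fields G T r\<^esub> z =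
      x \<oplus>\<^bsub>matrix_fields G T r\<^esub> (y \<oplus>\<^bsub>matrix_fields G T r\<^esub> z)"
      using x y z by (auto intro!: restrict_ext assoc_add_mat)
    show "x \<oplus>\<^bsub>matrix_fields G T r\<^esub> y = y \<oplus>\<^bsub>matrix_fields G T r\<^esub> x"
      using x y by (auto intro!: restrict_ext comm_add_mat)
  next
    fix x assume x: "x \<in> carrier (matrix_fields G T r)"
    show "\<zero>\<^bsub>matrix_fields G T r\<^esub> \<oplus>\<^bsub>matrix_fields G T r\<^esub> x = x"
      using x by (auto intro!: extensionalityI[where A = "unitary_dual G T"] left_add_zero_mat)
    show "\<exists>y\<in>carrier (matrix_fields G T r).
      y \<oplus>\<^bsub>matrix_fields G T r\<^esub> x = \<zero>\<^bsub>matrix_fields G T r\<^esub>"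
      using x
      by (auto intro!: bexI[of _ "\<lambda>c\<in>unitary_dual G T. - x c"] restrict_ext uminus_l_inv_mat)
  qed (auto)
  moreover have "field (class_ring :: complex ring)" by (rule class_field)
  moreover have "(\<lambda>c\<in>unitary_dual G T. 1 \<cdot>\<^sub>m x c) = x"
    if "x \<in> extensional (unitary_dual G T)" for x :: "'a unirep set \<Rightarrow> complex mat"
    using that by (auto intro!: extensionalityI[where A = "unitary_dual G T"])
  ultimately show ?thesis
    unfolding vectorspace_def module_def module_axioms_def
    by (auto intro!: restrict_ext add_smult_distrib_left_mat add_smult_distrib_right_mat
        simp: class_ring_simps field_def domain_def)
qed

definition l_sch ::
    "('g, 'm) monoid_scheme \<Rightarrow> 'g topology \<Rightarrow> ('g unirep set \<Rightarrow> 'g unirep) \<Rightarrow> real \<Rightarrow>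
     ('g unirep set \<Rightarrow> complex mat) normed_sub"
  where "l_sch G T r p =
    \<lparr>points = {H \<in> carrier (matrix_fields G T r).
       (\<lambda>c. real (fst (r c)) * schatten_norm p (H c) powr p) summable_on unitary_dual G T},
     nrm = (\<lambda>H.
       (\<Sum>\<^sub>\<infinity>c\<in>unitary_dual G T. real (fst (r c)) * schatten_norm p (H c) powr p) powr (1 / p))\<rparr>"

end

theory Submission
  imports "HOL-Complex_Analysis.Conformal_Mappings" Defs "Jordan_Normal_Form.Spectral_Radius"
begin

text \<open>
  In both inclusions a field \<open>H\<close> is handled through singular value decompositions
  \<open>H(c) = U\<^sub>c diag(s\<^sub>c) V\<^sub>c\<close>, which reduce Schatten norms to weighted sums of powers of the \<open>s\<^sub>c\<close>.

  If \<open>H = f(\<theta>)\<close> for an admissible \<open>f\<close>, then \<open>f(z)\<close> is paired, on a finite set of classes, with an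
  analytic family of powers of the singular values of \<open>H\<close>, acting through the fixed unitaries. The
  pairing sees only the diagonals of \<open>U\<^sub>c\<^sup>* f(z)(c) V\<^sub>c\<^sup>*\<close>, and the \<open>p\<close>-th powers of a diagonal sum to at
  most the \<open>p\<close>-th power of the Schatten norm (\<open>sum_diag_le_schatten_norm\<close>: moduli of products of
  unitary entries are dominated by doubly stochastic weights, and Jensen's inequality applies).
  Hoelder's inequality (\<open>weighted_sum_powr_le\<close>) bounds the pairing by the norm of \<open>f\<close> on both
  boundary lines, the three lines inequality carries the bound to \<open>\<theta>\<close>, and there the pairing is
  the norm of the finite part of \<open>H\<close>. This gives \<open>interp_norm_dominates\<close>.

  Conversely, let \<open>H\<close> have norm less than \<open>M\<close>. The function
  \<open>f(z)(c) = exp (\<delta> (z\<^sup>2 - \<theta>\<^sup>2)) M U\<^sub>c diag((s\<^sub>c / M)\<^bsup>a + b z\<^esup>) V\<^sub>c\<close> with \<open>a = p / p\<^sub>0\<close> and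
  \<open>a + b = p / p\<^sub>1\<close> takes the value \<open>H\<close> at \<open>\<theta>\<close> and has norm at most \<open>M exp \<delta>\<close>. To see that it is
  continuous and analytic in the norm of the sum, the singular values are split according to the
  sign of \<open>b ln (s / M)\<close>: one part of every increment is dominated by the power \<open>a\<close>, hence small in
  the first space by dominated convergence, the other by the power \<open>a + b\<close>, hence small in the second.
  This gives \<open>interp_function_through\<close>.
\<close>

section \<open>The singular value decomposition\<close>

lemma mat_adjoint_dim [simp]:
  "dim_row (mat_adjoint A) = dim_col A" "dim_col (mat_adjoint A) = dim_row A"
  by (auto simp: mat_adjoint_def)

lemma mat_adjoint_index:
  fixes A :: "complex mat"
  assumes "A \<in> carrier_mat n m" "i < m" "j < n"
  shows "mat_adjoint A $$ (i, j) = cnj (A $$ (j, i))"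
  using assms by (auto simp: mat_adjoint_def mat_of_rows_def conjugate_complex_def)

lemma mult_mat_index:
  assumes "A \<in> carrier_mat n m" "B \<in> carrier_mat m k" "i < n" "j < k"
  shows "(A * B) $$ (i, j) = (\<Sum>l<m. A $$ (i, l) * B $$ (l, j))"
  using assms by (auto simp: scalar_prod_def lessThan_atLeast0)

lemma mat_adjoint_mult:
  fixes A B :: "complex mat"
  assumes "A \<in> carrier_mat n m" "B \<in> carrier_mat m k"
  shows "mat_adjoint (A * B) = mat_adjoint B * mat_adjoint A"
proof (rule eq_matI)
  have AB: "A * B \<in> carrier_mat n k" using assms by simp
  have BA: "mat_adjoint B * mat_adjoint A \<in> carrier_mat k n"
    using assms by (meson mat_adjoint_carrier mult_carrier_mat)
  show "dim_row (mat_adjoint (A * B)) = dim_row (mat_adjoint B * mat_adjoint A)"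
    "dim_col (mat_adjoint (A * B)) = dim_col (mat_adjoint B * mat_adjoint A)"
    using mat_adjoint_carrier[OF AB] BA by auto
  fix i j assume "i < dim_row (mat_adjoint B * mat_adjoint A)"
    "j < dim_col (mat_adjoint B * mat_adjoint A)"
  hence ij: "i < k" "j < n" using BA by auto
  have "mat_adjoint (A * B) $$ (i, j) = cnj (\<Sum>l<m. A $$ (j, l) * B $$ (l, i))"
    using mat_adjoint_index[OF AB ij] mult_mat_index[OF assms ij(2,1)] by simp
  also have "\<dots> = (\<Sum>l<m. mat_adjoint B $$ (i, l) * mat_adjoint A $$ (l, j))"
    using ij by (auto simp: mat_adjoint_index[OF assms(1)] mat_adjoint_index[OF assms(2)]
        mult.commute intro!: sum.cong)
  also have "\<dots> = (mat_adjoint B * mat_adjoint A) $$ (i, j)"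
    using mult_mat_index[OF mat_adjoint_carrier[OF assms(2)] mat_adjoint_carrier[OF assms(1)] ij]
    by simp
  finally show "mat_adjoint (A * B) $$ (i, j) = (mat_adjoint B * mat_adjoint A) $$ (i, j)" .
qed

lemma mat_adjoint_adjoint:
  fixes A :: "complex mat"
  shows "mat_adjoint (mat_adjoint A) = A"
proof -
  have A: "A \<in> carrier_mat (dim_row A) (dim_col A)" by simp
  show ?thesis
    by (rule eq_matI)
      (auto simp: mat_adjoint_index[OF mat_adjoint_carrier[OF A]] mat_adjoint_index[OF A])
qed

lemma mat_diag_dims [simp]: "dim_row (mat_diag n d) = n" "dim_col (mat_diag n d) = n"
  by (auto simp: mat_diag_def)

lemma mat_adjoint_diag:
  "mat_adjoint (mat_diag n d :: complex mat) = mat_diag n (\<lambda>i. cnj (d i))"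
proof -
  have D: "(mat_diag n d :: complex mat) \<in> carrier_mat n n" by simp
  show ?thesis
    by (rule eq_matI)
      (auto simp: mat_adjoint_index[OF D], auto simp: mat_diag_def)
qed

lemma unitary_mat_carrier: "unitary_mat n U \<Longrightarrow> U \<in> carrier_mat n n"
  by (simp add: unitary_mat_def)

lemma unitary_matI:
  assumes "U \<in> carrier_mat n n" "mat_adjoint U * U = 1\<^sub>m n"
  shows "unitary_mat n U"
  using assms mat_mult_left_right_inverse[OF mat_adjoint_carrier[OF assms(1)] assms(1)]
  by (simp add: unitary_mat_def)

lemma unitary_mat_adjoint: "unitary_mat n U \<Longrightarrow> unitary_mat n (mat_adjoint U)"
  by (simp add: unitary_mat_def mat_adjoint_adjoint)

lemma unitary_mat_mult:
  assumes "unitary_mat n U" "unitary_mat n V"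
  shows "unitary_mat n (U * V)"
proof -
  have [simp]: "U \<in> carrier_mat n n" and [simp]: "V \<in> carrier_mat n n"
    and [simp]: "mat_adjoint U \<in> carrier_mat n n" "mat_adjoint V \<in> carrier_mat n n"
    using assms by (auto simp: unitary_mat_def)
  have [simp]: "U * V \<in> carrier_mat n n" by (rule mult_carrier_mat) fact+
  have "mat_adjoint (U * V) * (U * V) = mat_adjoint V * (mat_adjoint U * (U * V))"
    by (subst mat_adjoint_mult[of U n n V n], simp, simp, rule assoc_mult_mat[of _ n n _ n _ n])
      simp_all
  also have "mat_adjoint U * (U * V) = (mat_adjoint U * U) * V"
    by (rule assoc_mult_mat[symmetric, of _ n n _ n _ n]) auto
  also have "mat_adjoint V * (mat_adjoint U * U * V) = 1\<^sub>m n"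
    using assms left_mult_one_mat[of V n n] by (simp add: unitary_mat_def)
  finally have "mat_adjoint (U * V) * (U * V) = 1\<^sub>m n" .
  thus ?thesis by (intro unitary_matI) simp
qed

lemma unitary_mat_col_orthonormal:
  assumes "unitary_mat n U" "i < n" "j < n"
  shows "(\<Sum>k<n. cnj (U $$ (k, i)) * U $$ (k, j)) = (if i = j then 1 else 0)"
proof -
  have U: "U \<in> carrier_mat n n" using assms by (simp add: unitary_mat_def)
  have "(\<Sum>k<n. cnj (U $$ (k, i)) * U $$ (k, j)) = (mat_adjoint U * U) $$ (i, j)"
    using assms(2,3) by (simp only: mult_mat_index[OF mat_adjoint_carrier[OF U] U])
      (auto simp: mat_adjoint_index[OF U] intro!: sum.cong)
  thus ?thesis using assms by (simp add: unitary_mat_def)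
qed

lemma unitary_mat_col_sum:
  assumes "unitary_mat n U" "j < n"
  shows "(\<Sum>k<n. (cmod (U $$ (k, j)))\<^sup>2) = 1"
proof -
  have "complex_of_real (\<Sum>k<n. (cmod (U $$ (k, j)))\<^sup>2) = 1"
    using unitary_mat_col_orthonormal[OF assms assms(2)]
    by (simp add: complex_norm_square mult.commute del: of_real_power)
  thus ?thesis by (metis of_real_eq_1_iff)
qed

lemma unitary_mat_row_sum:
  assumes "unitary_mat n U" "i < n"
  shows "(\<Sum>k<n. (cmod (U $$ (i, k)))\<^sup>2) = 1"
  using unitary_mat_col_sum[OF unitary_mat_adjoint[OF assms(1)] assms(2)] assms
  by (simp add: mat_adjoint_index[OF unitary_mat_carrier[OF assms(1)]])

text \<open>
  Gram-Schmidt turns a basis starting with \<open>v\<close> into orthogonal columns, which are normalised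
  afterwards; the first column is a unit vector already and remains unchanged.
\<close>

lemma unitary_mat_with_first_col:
  fixes v :: "complex vec"
  assumes v: "v \<in> carrier_vec n" and v1: "(\<Sum>i<n. (cmod (vec_index v i))\<^sup>2) = 1"
  shows "\<exists>W. unitary_mat n W \<and> (\<forall>i<n. W $$ (i, 0) = vec_index v i)"
proof -
  have n: "n \<noteq> 0" using v1 by (intro notI) simp
  have v0: "v \<noteq> 0\<^sub>v n"
  proof
    assume "v = 0\<^sub>v n"
    hence "(\<Sum>i<n. (cmod (vec_index v i))\<^sup>2) = 0" by simp
    thus False using v1 by simp
  qed
  interpret cof_vec_space n "TYPE(complex)" .
  note bc = basis_completion[OF v v0]
  define ws where "ws = gram_schmidt n (basis_completion v)"
  have ws: "set ws \<subseteq> carrier_vec n" "corthogonal ws" "length ws = n"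
    using gram_schmidt_result[OF bc(2,4,5) refl, folded ws_def] bc(6) by auto
  obtain vs where bv: "basis_completion v = v # vs"
    using bc(6,7) n by (cases "basis_completion v") auto
  have "hd ws = v"
    using gram_schmidt_hd[OF v, of vs, folded bv] unfolding ws_def .
  hence hd: "ws ! 0 = v" using ws(3) n by (metis hd_conv_nth list.size(3))
  define X where "X = mat_of_cols n ws"
  have X: "X \<in> carrier_mat n n" using ws(3) unfolding X_def by auto
  have oX: "corthogonal_mat X" unfolding X_def by (rule orthogonal_mat_of_cols[OF ws])
  have Xi: "X $$ (i, j) = vec_index (ws ! j) i" if "i < n" "j < n" for i j
    using that ws by (simp add: X_def mat_of_cols_index)
  define g where "g j = (\<Sum>k<n. (cmod (X $$ (k, j)))\<^sup>2)" for j
  have gram: "(mat_adjoint X * X) $$ (i, j) = (if i = j then complex_of_real (g j) else 0)"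
    if ij: "i < n" "j < n" for i j
  proof (cases "i = j")
    case True
    show ?thesis using ij True unfolding mult_mat_index[OF mat_adjoint_carrier[OF X] X ij] g_def
      by (simp add: mat_adjoint_index[OF X] complex_norm_square mult.commute del: of_real_power)
  next
    case False
    thus ?thesis using oX ij X mat_adjoint_carrier[OF X] 
      by (auto simp: corthogonal_mat_def diagonal_mat_def Let_def)
  qed
  have gpos: "g j > 0" if "j < n" for j
  proof -
    have "g j \<noteq> 0" using oX gram[OF that that] that X
      by (auto simp: corthogonal_mat_def Let_def)
    moreover have "g j \<ge> 0" by (simp add: g_def sum_nonneg)
    ultimately show ?thesis by simp
  qed
  define D where "D = mat_diag n (\<lambda>j. complex_of_real (1 / sqrt (g j)))"
  have D: "D \<in> carrier_mat n n" by (simp add: D_def)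
  define W where "W = X * D"
  have W: "W \<in> carrier_mat n n" using X D by (simp add: W_def)
  have Wi: "W $$ (i, j) = X $$ (i, j) * complex_of_real (1 / sqrt (g j))" if "i < n" "j < n" for i j
    using that X by (simp add: W_def D_def mat_diag_mult_right[OF X])
  have "mat_adjoint W * W = 1\<^sub>m n"
  proof (rule eq_matI)
    fix i j assume "i < dim_row (1\<^sub>m n :: complex mat)" "j < dim_col (1\<^sub>m n :: complex mat)"
    hence ij: "i < n" "j < n" by auto
    have "(mat_adjoint W * W) $$ (i, j) = (\<Sum>k<n. cnj (W $$ (k, i)) * W $$ (k, j))"
      using ij by (simp only: mult_mat_index[OF mat_adjoint_carrier[OF W] W])
        (auto simp: mat_adjoint_index[OF W])
    also have "\<dots> = (\<Sum>k<n. cnj (X $$ (k, i)) * X $$ (k, j)) *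
        complex_of_real (1 / sqrt (g i) * (1 / sqrt (g j)))"
      unfolding sum_distrib_right using ij by (intro sum.cong) (auto simp: Wi)
    also have "(\<Sum>k<n. cnj (X $$ (k, i)) * X $$ (k, j)) = (mat_adjoint X * X) $$ (i, j)"
      using ij by (simp only: mult_mat_index[OF mat_adjoint_carrier[OF X] X])
        (auto simp: mat_adjoint_index[OF X])
    also have "\<dots> * complex_of_real (1 / sqrt (g i) * (1 / sqrt (g j))) = 1\<^sub>m n $$ (i, j)"
      using ij gpos[OF ij(2)] unfolding gram[OF ij]
      by (auto simp flip: of_real_mult)
    finally show "(mat_adjoint W * W) $$ (i, j) = 1\<^sub>m n $$ (i, j)" .
  qed (use W mat_adjoint_carrier[OF W] in auto)
  hence "unitary_mat n W" by (intro unitary_matI W)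
  moreover have "W $$ (i, 0) = vec_index v i" if "i < n" for i
  proof -
    have "g 0 = 1" using v1 n by (simp add: g_def Xi hd)
    thus ?thesis using that n by (simp add: Wi Xi hd)
  qed
  ultimately show ?thesis by blast
qed

lemma diag_product_index:
  assumes "U \<in> carrier_mat n n" "V \<in> carrier_mat n n" "i < n" "j < n"
  shows "(U * mat_diag n a * V) $$ (i, j) = (\<Sum>k<n. U $$ (i, k) * a k * V $$ (k, j))"
proof -
  have "(U * mat_diag n a * V) $$ (i, j) = (\<Sum>k<n. (U * mat_diag n a) $$ (i, k) * V $$ (k, j))"
    using assms by (intro mult_mat_index) auto
  also have "\<dots> = (\<Sum>k<n. U $$ (i, k) * a k * V $$ (k, j))"
    using assms(3) by (auto simp: mat_diag_mult_right[OF assms(1)] intro!: sum.cong)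
  finally show ?thesis .
qed

lemma det_mat_adjoint:
  fixes A :: "complex mat"
  assumes A: "A \<in> carrier_mat n n"
  shows "det (mat_adjoint A) = cnj (det A)"
proof -
  interpret comm_ring_hom cnj by unfold_locales auto
  have "mat_adjoint A = map_mat cnj (transpose_mat A)"
    by (rule eq_matI) (use A in \<open>auto simp: mat_adjoint_index[OF A]\<close>)
  thus ?thesis using A by (simp add: hom_det det_transpose)
qed

lemma mult_mat_vec_index:
  assumes "A \<in> carrier_mat n m" "v \<in> carrier_vec m" "i < n"
  shows "vec_index (A *\<^sub>v v) i = (\<Sum>l<m. A $$ (i, l) * vec_index v l)"
  using assms by (auto simp: scalar_prod_def lessThan_atLeast0)

lemma vec_norm_sq_pos:
  fixes v :: "complex vec"
  assumes "v \<in> carrier_vec n" "v \<noteq> 0\<^sub>v n"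
  shows "(\<Sum>i<n. (cmod (vec_index v i))\<^sup>2) > 0"
proof (rule ccontr)
  assume "\<not> ?thesis"
  hence "(\<Sum>i<n. (cmod (vec_index v i))\<^sup>2) = 0"
    by (meson linorder_not_less order_antisym sum_nonneg zero_le_power2)
  hence "\<forall>i<n. vec_index v i = 0" by (simp add: sum_nonneg_eq_0_iff)
  thus False using assms by (auto intro: eq_vecI)
qed

lemma vec_normalise:
  fixes v :: "complex vec"
  assumes "v \<in> carrier_vec n" "v \<noteq> 0\<^sub>v n"
  shows "\<exists>c. (\<Sum>i<n. (cmod (vec_index (c \<cdot>\<^sub>v v) i))\<^sup>2) = 1"
proof -
  define q where "q = (\<Sum>i<n. (cmod (vec_index v i))\<^sup>2)"
  have q: "q > 0" using vec_norm_sq_pos[OF assms] by (simp add: q_def)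
  have "(\<Sum>i<n. (cmod (vec_index (complex_of_real (1 / sqrt q) \<cdot>\<^sub>v v) i))\<^sup>2) =
      (1 / sqrt q)\<^sup>2 * q"
    unfolding q_def sum_distrib_left using assms
    by (intro sum.cong) (auto simp: norm_mult norm_divide power_mult_distrib power_divide)
  thus ?thesis using q by (intro exI[of _ "complex_of_real (1 / sqrt q)"]) (simp add: power_divide)
qed

text \<open>
  A unit eigenvector \<open>v\<close> of \<open>A\<^sup>*A\<close> has eigenvalue \<open>\<sigma>\<^sup>2 = \<parallel>Av\<parallel>\<^sup>2\<close>, and \<open>u = Av / \<sigma>\<close> completes
  the pair. If \<open>\<sigma> = 0\<close>, then \<open>A\<close> and hence \<open>A\<^sup>*\<close> are singular, and \<open>u\<close> is taken from the
  kernel of \<open>A\<^sup>*\<close>.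
\<close>

lemma singular_pair:
  fixes A :: "complex mat"
  assumes A: "A \<in> carrier_mat n n" and n: "n > 0"
  shows "\<exists>u v \<sigma>. u \<in> carrier_vec n \<and> v \<in> carrier_vec n \<and> 0 \<le> \<sigma> \<and>
    (\<Sum>i<n. (cmod (vec_index u i))\<^sup>2) = 1 \<and> (\<Sum>i<n. (cmod (vec_index v i))\<^sup>2) = 1 \<and>
    A *\<^sub>v v = complex_of_real \<sigma> \<cdot>\<^sub>v u \<and> mat_adjoint A *\<^sub>v u = complex_of_real \<sigma> \<cdot>\<^sub>v v"
proof -
  note A' = mat_adjoint_carrier[OF A]
  have AA: "mat_adjoint A * A \<in> carrier_mat n n" by (rule mult_carrier_mat[OF A' A])
  obtain e w where w: "w \<in> carrier_vec n" "w \<noteq> 0\<^sub>v n"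
    and e: "(mat_adjoint A * A) *\<^sub>v w = e \<cdot>\<^sub>v w"
    using spectrum_non_empty[OF AA n] AA A
    by (auto simp: spectrum_def eigenvalue_def eigenvector_def)
  obtain c where c: "(\<Sum>i<n. (cmod (vec_index (c \<cdot>\<^sub>v w) i))\<^sup>2) = 1"
    using vec_normalise[OF w] by blast
  define v where "v = c \<cdot>\<^sub>v w"
  have v: "v \<in> carrier_vec n" "(\<Sum>i<n. (cmod (vec_index v i))\<^sup>2) = 1"
    using w c by (auto simp: v_def)
  have Av: "A *\<^sub>v v \<in> carrier_vec n" using A v by simp
  have "(mat_adjoint A * A) *\<^sub>v v = e \<cdot>\<^sub>v v"
    using w AA e by (simp add: v_def mult_mat_vec smult_smult_assoc mult.commute)
  hence ev: "mat_adjoint A *\<^sub>v (A *\<^sub>v v) = e \<cdot>\<^sub>v v"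
    using assoc_mult_mat_vec[OF A' A v(1)] by simp
  define q where "q = (\<Sum>i<n. (cmod (vec_index (A *\<^sub>v v) i))\<^sup>2)"
  have "complex_of_real q = (\<Sum>i<n. cnj (vec_index (A *\<^sub>v v) i) * vec_index (A *\<^sub>v v) i)"
    by (simp add: q_def complex_norm_square mult.commute del: of_real_power)
  also have "\<dots> = (\<Sum>i<n. \<Sum>j<n. cnj (vec_index (A *\<^sub>v v) i) * A $$ (i, j) * vec_index v j)"
    by (intro sum.cong refl) (simp add: mult_mat_vec_index[OF A v(1)] sum_distrib_left mult.assoc)
  also have "\<dots> = (\<Sum>j<n. \<Sum>i<n. cnj (vec_index (A *\<^sub>v v) i) * A $$ (i, j) * vec_index v j)"
    by (rule sum.swap)
  also have "\<dots> = (\<Sum>j<n. cnj (vec_index (mat_adjoint A *\<^sub>v (A *\<^sub>v v)) j) * vec_index v j)"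
    by (intro sum.cong refl)
      (simp add: mult_mat_vec_index[OF A' Av] mat_adjoint_index[OF A] sum_distrib_right
        sum_distrib_left mult.commute mult.left_commute)
  also have "\<dots> = cnj e * complex_of_real (\<Sum>j<n. (cmod (vec_index v j))\<^sup>2)"
    using v(1) by (auto simp: ev complex_norm_square sum_distrib_left mult_ac simp del: of_real_power
        intro!: sum.cong)
  finally have "cnj e = complex_of_real q" using v(2) by simp
  hence e: "e = complex_of_real q" by (metis complex_cnj_cnj complex_cnj_complex_of_real)
  have q0: "q \<ge> 0" by (simp add: q_def sum_nonneg)
  show ?thesis
  proof (cases "q = 0")
    case False
    define u where "u = complex_of_real (1 / sqrt q) \<cdot>\<^sub>v (A *\<^sub>v v)"
    have u: "u \<in> carrier_vec n" using Av by (simp add: u_def)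
    have "(\<Sum>i<n. (cmod (vec_index u i))\<^sup>2) = (1 / sqrt q)\<^sup>2 * q"
      unfolding q_def sum_distrib_left u_def using A Av
      by (intro sum.cong refl)
        (auto simp: norm_mult norm_divide power_mult_distrib power_divide simp flip: q_def)
    hence "(\<Sum>i<n. (cmod (vec_index u i))\<^sup>2) = 1" using False q0 by (simp add: power_divide)
    moreover have "A *\<^sub>v v = complex_of_real (sqrt q) \<cdot>\<^sub>v u"
      using False q0 by (simp add: u_def smult_smult_assoc flip: of_real_mult)
    moreover have "mat_adjoint A *\<^sub>v u = complex_of_real (sqrt q) \<cdot>\<^sub>v v"
    proof -
      have "mat_adjoint A *\<^sub>v u = complex_of_real (1 / sqrt q) \<cdot>\<^sub>v (e \<cdot>\<^sub>v v)"
        unfolding u_def ev[symmetric] by (rule mult_mat_vec[OF A' Av])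
      also have "\<dots> = complex_of_real (sqrt q) \<cdot>\<^sub>v v"
        unfolding smult_smult_assoc e of_real_mult[symmetric] using q0
        by (simp add: real_div_sqrt)
      finally show ?thesis .
    qed
    ultimately show ?thesis using u v q0 by (metis real_sqrt_ge_zero)
  next
    case True
    have "A *\<^sub>v v = 0\<^sub>v n" using vec_norm_sq_pos[OF Av] True unfolding q_def by force
    moreover have "v \<noteq> 0\<^sub>v n" using v by auto
    ultimately have "det A = 0" using det_0_iff_vec_prod_zero[OF A] v(1) by blast
    hence "det (mat_adjoint A) = 0" by (simp add: det_mat_adjoint[OF A])
    then obtain x where x: "x \<in> carrier_vec n" "x \<noteq> 0\<^sub>v n" "mat_adjoint A *\<^sub>v x = 0\<^sub>v n"
      using det_0_iff_vec_prod_zero[OF A'] by blast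
    obtain d where d: "(\<Sum>i<n. (cmod (vec_index (d \<cdot>\<^sub>v x) i))\<^sup>2) = 1"
      using vec_normalise[OF x(1,2)] by blast
    have "mat_adjoint A *\<^sub>v (d \<cdot>\<^sub>v x) = 0 \<cdot>\<^sub>v v" "A *\<^sub>v v = 0 \<cdot>\<^sub>v (d \<cdot>\<^sub>v x)"
      using x v mult_mat_vec[OF A' x(1)] \<open>A *\<^sub>v v = 0\<^sub>v n\<close> by (auto intro!: eq_vecI)
    thus ?thesis using d x v by (intro exI[of _ "d \<cdot>\<^sub>v x"] exI[of _ v] exI[of _ 0]) auto
  qed
qed

lemma first_col_in_adapted_basis:
  assumes B: "B \<in> carrier_mat n n" and P: "unitary_mat n P" and Q: "unitary_mat n Q"
    and q: "q \<in> carrier_vec n" and p: "p \<in> carrier_vec n"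
    and Bq: "B *\<^sub>v q = \<sigma> \<cdot>\<^sub>v p"
    and P0: "\<forall>i<n. P $$ (i, 0) = vec_index p i" and Q0: "\<forall>i<n. Q $$ (i, 0) = vec_index q i"
    and i: "i < n"
  shows "(mat_adjoint P * (B * Q)) $$ (i, 0) = (if i = 0 then \<sigma> else 0)"
proof -
  have n: "0 < n" using i by simp
  note Pc = unitary_mat_carrier[OF P] and Qc = unitary_mat_carrier[OF Q]
  have BQ: "(B * Q) $$ (k, 0) = \<sigma> * P $$ (k, 0)" if "k < n" for k
  proof -
    have "(B * Q) $$ (k, 0) = vec_index (B *\<^sub>v q) k"
      using that Q0 by (simp add: mult_mat_index[OF B Qc that n] mult_mat_vec_index[OF B q that]
          del: index_mult_mat index_mult_mat_vec)
    thus ?thesis using that P0 p unfolding Bq by simp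
  qed
  have "(mat_adjoint P * (B * Q)) $$ (i, 0) = (\<Sum>k<n. mat_adjoint P $$ (i, k) * (B * Q) $$ (k, 0))"
    using B Qc i n by (intro mult_mat_index[OF mat_adjoint_carrier[OF Pc]]) auto
  also have "\<dots> = \<sigma> * (\<Sum>k<n. cnj (P $$ (k, i)) * P $$ (k, 0))"
    unfolding sum_distrib_left using i
    by (intro sum.cong refl) (simp add: BQ mat_adjoint_index[OF Pc] del: index_mult_mat)
  finally show ?thesis using unitary_mat_col_orthonormal[OF P i n] by simp
qed

text \<open>The direct sum of the identity of size one and \<open>M\<close>.\<close>

definition block_one :: "nat \<Rightarrow> complex mat \<Rightarrow> complex mat"
  where "block_one n M = Matrix.mat (Suc n) (Suc n)
    (\<lambda>(i, j). if i = 0 \<or> j = 0 then (if i = j then 1 else 0) else M $$ (i - 1, j - 1))"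

lemma block_one_carrier [simp]: "block_one n M \<in> carrier_mat (Suc n) (Suc n)"
  by (simp add: block_one_def)

lemma unitary_block_one:
  assumes U: "unitary_mat n U"
  shows "unitary_mat (Suc n) (block_one n U)"
proof (rule unitary_matI)
  show "mat_adjoint (block_one n U) * block_one n U = 1\<^sub>m (Suc n)"
  proof (rule eq_matI)
    fix i j assume "i < dim_row (1\<^sub>m (Suc n) :: complex mat)" "j < dim_col (1\<^sub>m (Suc n) :: complex mat)"
    hence ij: "i < Suc n" "j < Suc n" by auto
    have "(mat_adjoint (block_one n U) * block_one n U) $$ (i, j) =
        (\<Sum>k<Suc n. cnj (block_one n U $$ (k, i)) * block_one n U $$ (k, j))"
      using ij by (simp only: mult_mat_index[OF mat_adjoint_carrier[OF block_one_carrier] block_one_carrier])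
        (auto simp: mat_adjoint_index[OF block_one_carrier] simp del: sum.lessThan_Suc)
    also have "\<dots> = (if i = j then 1 else 0)"
      unfolding sum.lessThan_Suc_shift using ij unitary_mat_col_orthonormal[OF U, of "i - 1" "j - 1"]
      by (cases i; cases j) (auto simp: block_one_def)
    finally show "(mat_adjoint (block_one n U) * block_one n U) $$ (i, j) = 1\<^sub>m (Suc n) $$ (i, j)"
      using ij by simp
  qed (use carrier_matD[OF block_one_carrier] in auto)
qed simp

text \<open>
  In bases starting with a singular pair the first row and column of the matrix vanish off the
  diagonal, so that the remaining block has a decomposition by induction.
\<close>

theorem singular_value_decomposition:
  fixes A :: "complex mat"
  assumes "A \<in> carrier_mat n n"
  shows "\<exists>U V s. unitary_mat n U \<and> unitary_mat n V \<and> (\<forall>i. 0 \<le> s i) \<and>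
    A = U * mat_diag n (\<lambda>i. complex_of_real (s i)) * V"
  using assms
proof (induction n arbitrary: A)
  case 0
  have "unitary_mat 0 (1\<^sub>m 0)" by (intro unitary_matI) (auto intro: eq_matI)
  moreover have "A = 1\<^sub>m 0 * mat_diag 0 (\<lambda>i. complex_of_real 0) * 1\<^sub>m 0"
    by (rule eq_matI) (use 0 in auto)
  ultimately show ?case by (intro exI[of _ "1\<^sub>m 0"] exI[of _ "\<lambda>_. 0"]) auto
next
  case (Suc n A)
  let ?N = "Suc n"
  note A = Suc.prems and A' = mat_adjoint_carrier[OF Suc.prems]
  obtain u v \<sigma> where uv: "u \<in> carrier_vec ?N" "v \<in> carrier_vec ?N" and \<sigma>: "0 \<le> \<sigma>"
    and u1: "(\<Sum>i<?N. (cmod (vec_index u i))\<^sup>2) = 1" and v1: "(\<Sum>i<?N. (cmod (vec_index v i))\<^sup>2) = 1"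
    and Av: "A *\<^sub>v v = complex_of_real \<sigma> \<cdot>\<^sub>v u"
    and Au: "mat_adjoint A *\<^sub>v u = complex_of_real \<sigma> \<cdot>\<^sub>v v"
    using singular_pair[OF A] by (metis zero_less_Suc)
  obtain P where P: "unitary_mat ?N P" and P0: "\<forall>i<?N. P $$ (i, 0) = vec_index u i"
    using unitary_mat_with_first_col[OF uv(1) u1] by blast
  obtain Q where Q: "unitary_mat ?N Q" and Q0: "\<forall>i<?N. Q $$ (i, 0) = vec_index v i"
    using unitary_mat_with_first_col[OF uv(2) v1] by blast
  have c [simp]: "P \<in> carrier_mat ?N ?N" "Q \<in> carrier_mat ?N ?N" "A \<in> carrier_mat ?N ?N"
    "mat_adjoint P \<in> carrier_mat ?N ?N" "mat_adjoint Q \<in> carrier_mat ?N ?N"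
    using P Q A by (auto simp: unitary_mat_def)
  have assoc: "X * Y * Z = X * (Y * Z)"
    if "X \<in> carrier_mat ?N ?N" "Y \<in> carrier_mat ?N ?N" "Z \<in> carrier_mat ?N ?N" for X Y Z :: "complex mat"
    using that by (rule assoc_mult_mat)
  have mc: "X * Y \<in> carrier_mat ?N ?N"
    if "X \<in> carrier_mat ?N ?N" "Y \<in> carrier_mat ?N ?N" for X Y :: "complex mat"
    using that by (rule mult_carrier_mat)
  define C where "C = mat_adjoint P * (A * Q)"
  have C: "C \<in> carrier_mat ?N ?N" by (simp add: C_def mc del: mult_carrier_mat)
  have col0: "C $$ (i, 0) = (if i = 0 then complex_of_real \<sigma> else 0)" if "i < ?N" for i
    unfolding C_def by (rule first_col_in_adapted_basis[OF A P Q uv(2,1) Av P0 Q0 that])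
  have C': "mat_adjoint C = mat_adjoint Q * (mat_adjoint A * P)"
    unfolding C_def using A' by (simp add: mat_adjoint_mult[of _ ?N ?N _ ?N] mat_adjoint_adjoint assoc mc)
  have row0: "C $$ (0, j) = (if j = 0 then complex_of_real \<sigma> else 0)" if "j < ?N" for j
  proof -
    have "cnj (C $$ (0, j)) = mat_adjoint C $$ (j, 0)"
      using that by (simp add: mat_adjoint_index[OF C])
    also have "\<dots> = (if j = 0 then complex_of_real \<sigma> else 0)"
      unfolding C' by (rule first_col_in_adapted_basis[OF A' Q P uv Au Q0 P0 that])
    finally show ?thesis by (metis complex_cnj_cnj complex_cnj_complex_of_real complex_cnj_zero)
  qed
  define R where "R = Matrix.mat n n (\<lambda>(i, j). C $$ (Suc i, Suc j))"
  obtain U V s where U: "unitary_mat n U" and V: "unitary_mat n V" and s: "\<And>i. 0 \<le> s i"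
    and R: "R = U * mat_diag n (\<lambda>i. complex_of_real (s i)) * V"
    using Suc.IH[of R] by (auto simp: R_def)
  define D where "D = mat_diag ?N (\<lambda>i. complex_of_real (case_nat \<sigma> s i))"
  have D [simp]: "D \<in> carrier_mat ?N ?N" by (simp add: D_def)
  have "C = block_one n U * D * block_one n V"
  proof (rule eq_matI)
    fix i j assume "i < dim_row (block_one n U * D * block_one n V)"
      "j < dim_col (block_one n U * D * block_one n V)"
    hence ij: "i < ?N" "j < ?N" using carrier_matD[OF block_one_carrier] by auto
    have *: "(block_one n U * D * block_one n V) $$ (i, j) =
        (\<Sum>k<?N. block_one n U $$ (i, k) * complex_of_real (case_nat \<sigma> s k) * block_one n V $$ (k, j))"
      unfolding D_def by (rule diag_product_index[OF block_one_carrier block_one_carrier ij])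
    show "C $$ (i, j) = (block_one n U * D * block_one n V) $$ (i, j)"
    proof (cases "i = 0 \<or> j = 0")
      case True
      thus ?thesis unfolding * sum.lessThan_Suc_shift
        using ij row0[OF ij(2)] col0[OF ij(1)] by (auto simp: block_one_def)
    next
      case False
      then obtain i' j' where ij': "i = Suc i'" "j = Suc j'" by (metis not0_implies_Suc)
      have "C $$ (i, j) = R $$ (i', j')" using ij ij' by (simp add: R_def)
      also have "\<dots> = (\<Sum>k<n. U $$ (i', k) * complex_of_real (s k) * V $$ (k, j'))"
        unfolding R using ij ij'
        by (intro diag_product_index[OF unitary_mat_carrier[OF U] unitary_mat_carrier[OF V]]) auto
      finally show ?thesis unfolding * sum.lessThan_Suc_shift
        using ij ij' by (simp add: block_one_def)
    qed
  qed (use C carrier_matD[OF block_one_carrier] in auto)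
  moreover have "A = P * C * mat_adjoint Q"
  proof -
    have "P * C * mat_adjoint Q = P * (mat_adjoint P * (A * (Q * mat_adjoint Q)))"
      using C by (simp add: C_def assoc mc)
    also have "Q * mat_adjoint Q = 1\<^sub>m ?N" using Q by (simp add: unitary_mat_def)
    also have "P * (mat_adjoint P * (A * 1\<^sub>m ?N)) = (P * mat_adjoint P) * A"
      by (simp add: assoc right_mult_one_mat[of A ?N ?N])
    also have "\<dots> = A" using P left_mult_one_mat[OF A] by (simp add: unitary_mat_def)
    finally show ?thesis by simp
  qed
  ultimately have "A = (P * block_one n U) * D * (block_one n V * mat_adjoint Q)"
    by (simp add: assoc mc)
  moreover have "unitary_mat ?N (P * block_one n U)" "unitary_mat ?N (block_one n V * mat_adjoint Q)"
    using P Q U V by (auto intro!: unitary_mat_mult unitary_block_one unitary_mat_adjoint)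
  moreover have "0 \<le> case_nat \<sigma> s i" for i using \<sigma> s by (cases i) auto
  ultimately show ?case unfolding D_def by blast
qed

section \<open>Schatten norms\<close>

lemma mat_fun_unitary_diag:
  assumes "unitary_mat n U"
  shows "mat_fun f (U * mat_diag n (\<lambda>i. complex_of_real (d i)) * mat_adjoint U) =
    U * mat_diag n (\<lambda>i. complex_of_real (f (d i))) * mat_adjoint U"
  unfolding mat_fun_def
proof (rule the_equality)
  show *: "is_mat_fun f (U * mat_diag n (\<lambda>i. complex_of_real (d i)) * mat_adjoint U)
      (U * mat_diag n (\<lambda>i. complex_of_real (f (d i))) * mat_adjoint U)"
    using assms unfolding is_mat_fun_def by blast
  fix B assume "is_mat_fun f (U * mat_diag n (\<lambda>i. complex_of_real (d i)) * mat_adjoint U) B"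
  thus "B = U * mat_diag n (\<lambda>i. complex_of_real (f (d i))) * mat_adjoint U"
    using * by (rule mat_fun_unique)
qed

lemma mat_trace_unitary_diag:
  assumes U: "unitary_mat n U"
  shows "mat_trace (U * mat_diag n a * mat_adjoint U) = (\<Sum>k<n. a k)"
proof -
  note Uc = unitary_mat_carrier[OF U]
  have "mat_trace (U * mat_diag n a * mat_adjoint U) =
      (\<Sum>i<n. (U * mat_diag n a * mat_adjoint U) $$ (i, i))"
    using Uc by (simp add: mat_trace_def diag_mat_def sum_list_sum_nth lessThan_atLeast0
        del: index_mult_mat(1))
  also have "\<dots> = (\<Sum>i<n. \<Sum>k<n. a k * (cnj (U $$ (i, k)) * U $$ (i, k)))"
    by (intro sum.cong refl)
      (simp add: diag_product_index[OF Uc mat_adjoint_carrier[OF Uc]] mat_adjoint_index[OF Uc]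
        mult_ac del: index_mult_mat(1))
  also have "\<dots> = (\<Sum>k<n. a k * (\<Sum>i<n. cnj (U $$ (i, k)) * U $$ (i, k)))"
    by (subst sum.swap) (simp add: sum_distrib_left)
  also have "\<dots> = (\<Sum>k<n. a k)"
    by (intro sum.cong refl) (simp add: unitary_mat_col_orthonormal[OF U])
  finally show ?thesis .
qed

text \<open>
  The diagonal may be complex: its phases are absorbed when \<open>A\<^sup>*A\<close> is formed. The extremal family
  for the interpolation norm has such diagonals.
\<close>

lemma schatten_norm_diag:
  assumes U: "unitary_mat n U" and V: "unitary_mat n V"
  shows "schatten_norm q (U * mat_diag n a * V) = (\<Sum>k<n. cmod (a k) powr q) powr (1 / q)"
proof -
  define A where "A = U * mat_diag n a * V"
  define U' V' where "U' = mat_adjoint U" and "V' = mat_adjoint V"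
  define D where "D b = (mat_diag n b :: complex mat)" for b
  have c [simp]: "U \<in> carrier_mat n n" "V \<in> carrier_mat n n"
    "U' \<in> carrier_mat n n" "V' \<in> carrier_mat n n" "D b \<in> carrier_mat n n" for b
    using U V unfolding unitary_mat_def U'_def V'_def D_def by auto
  have assoc: "X * Y * Z = X * (Y * Z)"
    if "X \<in> carrier_mat n n" "Y \<in> carrier_mat n n" "Z \<in> carrier_mat n n" for X Y Z :: "complex mat"
    using that by (rule assoc_mult_mat)
  have mc: "X * Y \<in> carrier_mat n n"
    if "X \<in> carrier_mat n n" "Y \<in> carrier_mat n n" for X Y :: "complex mat"
    using that by (rule mult_carrier_mat)
  have "mat_adjoint A = V' * (D (\<lambda>i. cnj (a i)) * U')"
    using mat_adjoint_mult[OF mc[OF c(1) c(5)] c(2), of a] mat_adjoint_mult[OF c(1) c(5), of a]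
    by (simp add: A_def U'_def V'_def D_def mat_adjoint_diag)
  hence "mat_adjoint A * A = V' * (D (\<lambda>i. cnj (a i)) * ((U' * U) * (D a * V)))"
    by (simp add: A_def assoc mc flip: D_def)
  also have "U' * U = 1\<^sub>m n" using U by (simp add: U'_def unitary_mat_def)
  also have "1\<^sub>m n * (D a * V) = D a * V" by (rule left_mult_one_mat[of _ n n]) (simp add: mc)
  also have "V' * (D (\<lambda>i. cnj (a i)) * (D a * V)) = V' * (D (\<lambda>i. cnj (a i)) * D a) * V"
    by (simp add: assoc mc)
  also have "D (\<lambda>i. cnj (a i)) * D a = mat_diag n (\<lambda>i. complex_of_real ((cmod (a i))\<^sup>2))"
    by (simp add: D_def complex_norm_square mult.commute del: of_real_power)
  also have "V = mat_adjoint V'" by (simp add: V'_def mat_adjoint_adjoint)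
  finally have AA: "mat_adjoint A * A =
    V' * mat_diag n (\<lambda>i. complex_of_real ((cmod (a i))\<^sup>2)) * mat_adjoint V'" .
  have V': "unitary_mat n V'" unfolding V'_def by (rule unitary_mat_adjoint[OF V])
  have "mat_abs A = V' * mat_diag n (\<lambda>i. complex_of_real (cmod (a i))) * mat_adjoint V'"
    unfolding mat_abs_def AA mat_fun_unitary_diag[OF V'] by simp
  hence "mat_fun (\<lambda>x. x powr q) (mat_abs A) =
      V' * mat_diag n (\<lambda>i. complex_of_real (cmod (a i) powr q)) * mat_adjoint V'"
    by (simp only: mat_fun_unitary_diag[OF V'])
  hence "mat_trace (mat_fun (\<lambda>x. x powr q) (mat_abs A)) = complex_of_real (\<Sum>k<n. cmod (a k) powr q)"
    by (simp only: mat_trace_unitary_diag[OF V'] of_real_sum)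
  thus ?thesis unfolding A_def[symmetric] schatten_norm_def by simp
qed

lemma schatten_norm_powr_diag:
  assumes "unitary_mat n U" "unitary_mat n V" "q > 0"
  shows "schatten_norm q (U * mat_diag n a * V) powr q = (\<Sum>k<n. cmod (a k) powr q)"
  using assms by (simp add: schatten_norm_diag powr_powr sum_nonneg)

lemma powr_add_le:
  fixes x y q :: real
  assumes "0 \<le> x" "0 \<le> y" "0 \<le> q"
  shows "(x + y) powr q \<le> 2 powr q * (x powr q + y powr q)"
proof -
  have "(x + y) powr q \<le> (2 * max x y) powr q" using assms by (intro powr_mono2) auto
  also have "\<dots> = 2 powr q * max x y powr q" using assms by (simp add: powr_mult)
  also have "max x y powr q \<le> x powr q + y powr q" by (simp add: max_def)
  finally show ?thesis by simp
qed

text \<open>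
  The weights may have total mass less than one, since \<open>x \<mapsto> x powr q\<close> vanishes at the origin.
\<close>

lemma Jensen_powr:
  fixes w x :: "'i \<Rightarrow> real"
  assumes fin: "finite I" and w: "\<And>i. i \<in> I \<Longrightarrow> 0 \<le> w i" and w1: "sum w I \<le> 1"
    and x: "\<And>i. i \<in> I \<Longrightarrow> 0 \<le> x i" and q: "1 \<le> q"
  shows "(\<Sum>i\<in>I. w i * x i) powr q \<le> (\<Sum>i\<in>I. w i * x i powr q)"
proof -
  define J where "J = {i \<in> I. x i > 0}"
  define W where "W = sum w J"
  have finJ: "finite J" using fin by (simp add: J_def)
  have xJ: "x i = 0" if "i \<in> I - J" for i using x[of i] that by (auto simp: J_def)
  have J1: "(\<Sum>i\<in>I. w i * x i) = (\<Sum>i\<in>J. w i * x i)"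
    using fin xJ by (intro sum.mono_neutral_right) (auto simp: J_def)
  have J2: "(\<Sum>i\<in>I. w i * x i powr q) = (\<Sum>i\<in>J. w i * x i powr q)"
    using fin xJ by (intro sum.mono_neutral_right) (auto simp: J_def)
  have W0: "0 \<le> W" unfolding W_def using w by (intro sum_nonneg) (auto simp: J_def)
  have "W \<le> sum w I" unfolding W_def using fin w by (intro sum_mono2) (auto simp: J_def)
  hence W1: "W \<le> 1" using w1 by simp
  have nonneg: "0 \<le> (\<Sum>i\<in>J. w i * x i powr q)" using w by (intro sum_nonneg) (auto simp: J_def)
  show ?thesis
  proof (cases "W = 0")
    case True
    hence "w i = 0" if "i \<in> J" for i
      using that sum_nonneg_eq_0_iff[OF finJ, of w] w by (auto simp: W_def J_def)
    thus ?thesis unfolding J1 J2 by simp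
  next
    case False
    have "(\<Sum>i\<in>J. (w i / W) *\<^sub>R x i) powr q \<le> (\<Sum>i\<in>J. (w i / W) * x i powr q)"
    proof (rule convex_on_sum[OF finJ _ powr_convex[OF q]])
      show "J \<noteq> {}" using False by (auto simp: W_def)
      show "(\<Sum>i\<in>J. w i / W) = 1" using False by (simp add: W_def flip: sum_divide_distrib)
    qed (use w W0 in \<open>auto simp: J_def\<close>)
    hence *: "((\<Sum>i\<in>J. w i * x i) / W) powr q \<le> (\<Sum>i\<in>J. w i * x i powr q) / W"
      by (simp add: sum_divide_distrib)
    have s0: "0 \<le> (\<Sum>i\<in>J. w i * x i)" using w x by (intro sum_nonneg) (auto simp: J_def)
    have "(\<Sum>i\<in>J. w i * x i) powr q = W powr q * ((\<Sum>i\<in>J. w i * x i) / W) powr q"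
      using False W0 s0 by (simp add: powr_divide)
    also have "\<dots> \<le> W powr q * ((\<Sum>i\<in>J. w i * x i powr q) / W)"
      by (intro mult_left_mono *) simp
    also have "\<dots> = W powr (q - 1) * (\<Sum>i\<in>J. w i * x i powr q)"
      using False W0 by (simp add: powr_diff)
    also have "\<dots> \<le> 1 * (\<Sum>i\<in>J. w i * x i powr q)"
      using W0 W1 q nonneg by (intro mult_right_mono) (auto intro: powr_le1)
    finally show ?thesis unfolding J1 J2 by simp
  qed
qed

text \<open>
  Jensen with the weights \<open>(\<bar>P\<^sub>i\<^sub>k\<bar>\<^sup>2 + \<bar>Q\<^sub>k\<^sub>j\<bar>\<^sup>2) / 2\<close>, which dominate \<open>\<bar>P\<^sub>i\<^sub>k Q\<^sub>k\<^sub>j\<bar>\<close> and sum to one.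
\<close>

lemma unitary_diag_entry_powr_le:
  assumes P: "unitary_mat n P" and Q: "unitary_mat n Q" and ij: "i < n" "j < n" and q: "1 \<le> q"
  shows "cmod ((P * mat_diag n a * Q) $$ (i, j)) powr q \<le>
    (\<Sum>k<n. ((cmod (P $$ (i, k)))\<^sup>2 + (cmod (Q $$ (k, j)))\<^sup>2) / 2 * cmod (a k) powr q)"
proof -
  define w where "w k = ((cmod (P $$ (i, k)))\<^sup>2 + (cmod (Q $$ (k, j)))\<^sup>2) / 2" for k
  have "cmod ((P * mat_diag n a * Q) $$ (i, j)) \<le> (\<Sum>k<n. cmod (P $$ (i, k) * a k * Q $$ (k, j)))"
    unfolding diag_product_index[OF unitary_mat_carrier[OF P] unitary_mat_carrier[OF Q] ij]
    by (rule norm_sum)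
  also have "\<dots> \<le> (\<Sum>k<n. w k * cmod (a k))"
  proof (rule sum_mono)
    fix k
    have "cmod (P $$ (i, k)) * cmod (Q $$ (k, j)) \<le> w k"
      using sum_squares_bound[of "cmod (P $$ (i, k))" "cmod (Q $$ (k, j))"] by (simp add: w_def)
    from mult_right_mono[OF this, of "cmod (a k)"]
    show "cmod (P $$ (i, k) * a k * Q $$ (k, j)) \<le> w k * cmod (a k)"
      by (simp add: norm_mult mult_ac)
  qed
  finally have "cmod ((P * mat_diag n a * Q) $$ (i, j)) powr q \<le> (\<Sum>k<n. w k * cmod (a k)) powr q"
    using q by (intro powr_mono2) auto
  also have "\<dots> \<le> (\<Sum>k<n. w k * cmod (a k) powr q)"
  proof (rule Jensen_powr[OF _ _ _ _ q])
    have "(\<Sum>k<n. w k) = ((\<Sum>k<n. (cmod (P $$ (i, k)))\<^sup>2) + (\<Sum>k<n. (cmod (Q $$ (k, j)))\<^sup>2)) / 2"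
      by (simp add: w_def sum.distrib flip: sum_divide_distrib)
    thus "(\<Sum>k<n. w k) \<le> 1"
      using unitary_mat_row_sum[OF P ij(1)] unitary_mat_col_sum[OF Q ij(2)] by simp
  qed (auto simp: w_def)
  finally show ?thesis by (simp add: w_def)
qed

lemma cmod_entry_le_schatten_norm:
  assumes A: "A \<in> carrier_mat n n" and ij: "i < n" "j < n" and q: "1 \<le> q"
  shows "cmod (A $$ (i, j)) powr q \<le> schatten_norm q A powr q"
proof -
  obtain P Q s where P: "unitary_mat n P" and Q: "unitary_mat n Q"
    and A: "A = P * mat_diag n (\<lambda>i. complex_of_real (s i)) * Q"
    using singular_value_decomposition[OF A] by blast
  have P1: "(cmod (P $$ (i, k)))\<^sup>2 \<le> 1" if "k < n" for k
    using member_le_sum[of k "{..<n}" "\<lambda>k. (cmod (P $$ (i, k)))\<^sup>2"] unitary_mat_row_sum[OF P ij(1)] that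
    by simp
  have Q1: "(cmod (Q $$ (k, j)))\<^sup>2 \<le> 1" if "k < n" for k
    using member_le_sum[of k "{..<n}" "\<lambda>k. (cmod (Q $$ (k, j)))\<^sup>2"] unitary_mat_col_sum[OF Q ij(2)] that
    by simp
  have "cmod (A $$ (i, j)) powr q \<le>
      (\<Sum>k<n. ((cmod (P $$ (i, k)))\<^sup>2 + (cmod (Q $$ (k, j)))\<^sup>2) / 2 * cmod (complex_of_real (s k)) powr q)"
    unfolding A by (rule unitary_diag_entry_powr_le[OF P Q ij q])
  also have "\<dots> \<le> (\<Sum>k<n. 1 * cmod (complex_of_real (s k)) powr q)"
  proof (intro sum_mono mult_right_mono)
    fix k assume "k \<in> {..<n}"
    thus "((cmod (P $$ (i, k)))\<^sup>2 + (cmod (Q $$ (k, j)))\<^sup>2) / 2 \<le> 1"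
      using P1[of k] Q1[of k] by simp
  qed simp
  also have "\<dots> = schatten_norm q A powr q"
    unfolding A using schatten_norm_powr_diag[OF P Q, of q] q by simp
  finally show ?thesis .
qed

text \<open>
  The matrix of the weights from Jensen's inequality is doubly stochastic, so that summation over
  the diagonal restores the sum of all powers of the singular values.
\<close>

lemma sum_diag_le_schatten_norm:
  assumes A: "A \<in> carrier_mat n n" and R: "unitary_mat n R" and T: "unitary_mat n T" and q: "1 \<le> q"
  shows "(\<Sum>j<n. cmod ((R * A * T) $$ (j, j)) powr q) \<le> schatten_norm q A powr q"
proof -
  obtain P Q s where P: "unitary_mat n P" and Q: "unitary_mat n Q"
    and A: "A = P * mat_diag n (\<lambda>i. complex_of_real (s i)) * Q"
    using singular_value_decomposition[OF A] by blast
  define a where "a i = complex_of_real (s i)" for i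
  have c [simp]: "P \<in> carrier_mat n n" "Q \<in> carrier_mat n n" "R \<in> carrier_mat n n" "T \<in> carrier_mat n n"
    using P Q R T by (auto simp: unitary_mat_def)
  have assoc: "X * Y * Z = X * (Y * Z)"
    if "X \<in> carrier_mat n n" "Y \<in> carrier_mat n n" "Z \<in> carrier_mat n n" for X Y Z :: "complex mat"
    using that by (rule assoc_mult_mat)
  have mc: "X * Y \<in> carrier_mat n n"
    if "X \<in> carrier_mat n n" "Y \<in> carrier_mat n n" for X Y :: "complex mat"
    using that by (rule mult_carrier_mat)
  have RAT: "R * A * T = (R * P) * mat_diag n a * (Q * T)"
    by (simp add: A assoc mc a_def[abs_def])
  have RP: "unitary_mat n (R * P)" and QT: "unitary_mat n (Q * T)"
    using P Q R T by (auto intro: unitary_mat_mult)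
  define X Y where "X i k = (cmod ((R * P) $$ (i, k)))\<^sup>2" and "Y k j = (cmod ((Q * T) $$ (k, j)))\<^sup>2"
    for i j k
  have "(\<Sum>j<n. cmod ((R * A * T) $$ (j, j)) powr q) \<le>
      (\<Sum>j<n. \<Sum>k<n. (X j k + Y k j) / 2 * cmod (a k) powr q)"
    unfolding RAT X_def Y_def
    by (intro sum_mono unitary_diag_entry_powr_le[OF RP QT _ _ q]) auto
  also have "\<dots> = (\<Sum>k<n. \<Sum>j<n. (X j k + Y k j) / 2 * cmod (a k) powr q)" by (rule sum.swap)
  also have "\<dots> = (\<Sum>k<n. ((\<Sum>j<n. X j k) + (\<Sum>j<n. Y k j)) / 2 * cmod (a k) powr q)"
    by (simp add: sum.distrib flip: sum_distrib_right sum_divide_distrib)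
  also have "\<dots> = (\<Sum>k<n. cmod (a k) powr q)"
    unfolding X_def Y_def
    by (intro sum.cong refl)
      (simp add: unitary_mat_col_sum[OF RP] unitary_mat_row_sum[OF QT] del: index_mult_mat(1))
  also have "\<dots> = schatten_norm q A powr q"
    unfolding A a_def[symmetric] using schatten_norm_powr_diag[OF P Q, of q] q by simp
  finally show ?thesis .
qed

text \<open>
  In bases that diagonalise \<open>A + B\<close>, the singular values of the sum are bounded by the diagonals of
  the two summands, and the diagonal estimate applies to each of them.
\<close>

lemma schatten_norm_add_powr_le:
  assumes A: "A \<in> carrier_mat n n" and B: "B \<in> carrier_mat n n" and q: "1 \<le> q"
  shows "schatten_norm q (A + B) powr q \<le>
    2 powr q * (schatten_norm q A powr q + schatten_norm q B powr q)"
proof -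
  obtain P Q s where P: "unitary_mat n P" and Q: "unitary_mat n Q" and s: "\<And>i. 0 \<le> s i"
    and AB: "A + B = P * mat_diag n (\<lambda>i. complex_of_real (s i)) * Q"
    using singular_value_decomposition[of "A + B" n] A B by (metis add_carrier_mat)
  define P' Q' where "P' = mat_adjoint P" and "Q' = mat_adjoint Q"
  have P': "unitary_mat n P'" and Q': "unitary_mat n Q'"
    unfolding P'_def Q'_def by (auto intro: unitary_mat_adjoint P Q)
  have c [simp]: "P \<in> carrier_mat n n" "Q \<in> carrier_mat n n"
    "P' \<in> carrier_mat n n" "Q' \<in> carrier_mat n n"
    using P Q P' Q' by (auto simp: unitary_mat_def)
  define D where "D = mat_diag n (\<lambda>i. complex_of_real (s i))"
  have D [simp]: "D \<in> carrier_mat n n" by (simp add: D_def)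
  have assoc: "X * Y * Z = X * (Y * Z)"
    if "X \<in> carrier_mat n n" "Y \<in> carrier_mat n n" "Z \<in> carrier_mat n n" for X Y Z :: "complex mat"
    using that by (rule assoc_mult_mat)
  have mc: "X * Y \<in> carrier_mat n n"
    if "X \<in> carrier_mat n n" "Y \<in> carrier_mat n n" for X Y :: "complex mat"
    using that by (rule mult_carrier_mat)
  have "P' * (A + B) * Q' = (P' * P) * (D * (Q * Q'))"
    unfolding AB D_def[symmetric] by (simp add: assoc mc)
  also have "\<dots> = D" using P Q
    by (simp add: P'_def Q'_def unitary_mat_def left_mult_one_mat[of _ n n] right_mult_one_mat[of _ n n])
  finally have "D = P' * A * Q' + P' * B * Q'"
    using mult_add_distrib_mat[OF c(3) A B] add_mult_distrib_mat[OF mc[OF c(3) A] mc[OF c(3) B] c(4)]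
    by simp
  hence sj: "complex_of_real (s j) = (P' * A * Q') $$ (j, j) + (P' * B * Q') $$ (j, j)" if "j < n" for j
  proof -
    have "D $$ (j, j) = complex_of_real (s j)" using that by (simp add: D_def mat_diag_def)
    moreover have "(P' * A * Q' + P' * B * Q') $$ (j, j) =
        (P' * A * Q') $$ (j, j) + (P' * B * Q') $$ (j, j)"
      using that carrier_matD[OF mc[OF mc[OF c(3) B] c(4)]] by (intro index_add_mat(1)) auto
    ultimately show ?thesis using \<open>D = P' * A * Q' + P' * B * Q'\<close> by metis
  qed
  have "schatten_norm q (A + B) powr q = (\<Sum>j<n. s j powr q)"
    unfolding AB using schatten_norm_powr_diag[OF P Q, of q] q s by simp
  also have "\<dots> \<le> (\<Sum>j<n. 2 powr q * (cmod ((P' * A * Q') $$ (j, j)) powr q +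
      cmod ((P' * B * Q') $$ (j, j)) powr q))"
  proof (rule sum_mono)
    fix j assume "j \<in> {..<n}"
    hence "s j \<le> cmod ((P' * A * Q') $$ (j, j)) + cmod ((P' * B * Q') $$ (j, j))"
      using sj[of j] s[of j] norm_triangle_ineq[of "(P' * A * Q') $$ (j, j)" "(P' * B * Q') $$ (j, j)"]
      by (metis abs_of_nonneg lessThan_iff norm_of_real)
    hence "s j powr q \<le> (cmod ((P' * A * Q') $$ (j, j)) + cmod ((P' * B * Q') $$ (j, j))) powr q"
      using s[of j] q by (intro powr_mono2) auto
    also have "\<dots> \<le> 2 powr q * (cmod ((P' * A * Q') $$ (j, j)) powr q +
      cmod ((P' * B * Q') $$ (j, j)) powr q)"
      using q by (intro powr_add_le) auto
    finally show "s j powr q \<le> 2 powr q * (cmod ((P' * A * Q') $$ (j, j)) powr q +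
      cmod ((P' * B * Q') $$ (j, j)) powr q)" .
  qed
  also have "\<dots> = 2 powr q * ((\<Sum>j<n. cmod ((P' * A * Q') $$ (j, j)) powr q) +
      (\<Sum>j<n. cmod ((P' * B * Q') $$ (j, j)) powr q))"
    by (simp add: sum.distrib flip: sum_distrib_left)
  also have "\<dots> \<le> 2 powr q * (schatten_norm q A powr q + schatten_norm q B powr q)"
    by (intro mult_left_mono add_mono sum_diag_le_schatten_norm A B P' Q' q) auto
  finally show ?thesis .
qed

text \<open>
  Jensen's inequality for the weights \<open>w \<kappa>\<close> and the function \<open>\<kappa> powr (- 1 / q) * b\<close>. This is Hoelder's
  inequality in a form that includes \<open>q = 1\<close> without an infinite conjugate exponent.
\<close>

lemma weighted_sum_powr_le:
  fixes w \<kappa> b :: "'i \<Rightarrow> real"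
  assumes fin: "finite I" and w: "\<And>i. i \<in> I \<Longrightarrow> 0 \<le> w i" and \<kappa>: "\<And>i. i \<in> I \<Longrightarrow> 0 < \<kappa> i"
    and w1: "(\<Sum>i\<in>I. w i * \<kappa> i) \<le> 1"
    and b: "\<And>i. i \<in> I \<Longrightarrow> 0 \<le> b i" and q: "1 \<le> q"
  shows "(\<Sum>i\<in>I. w i * \<kappa> i powr (1 - 1 / q) * b i) \<le> (\<Sum>i\<in>I. w i * b i powr q) powr (1 / q)"
proof -
  define S where "S = (\<Sum>i\<in>I. w i * \<kappa> i powr (1 - 1 / q) * b i)"
  have S: "S = (\<Sum>i\<in>I. (w i * \<kappa> i) * (\<kappa> i powr (- 1 / q) * b i))"
    unfolding S_def
  proof (intro sum.cong refl)
    fix i assume "i \<in> I"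
    hence "\<kappa> i powr (1 - 1 / q) = \<kappa> i * \<kappa> i powr (- 1 / q)"
      using \<kappa>[of i] powr_add[of "\<kappa> i" 1 "- 1 / q"] by simp
    thus "w i * \<kappa> i powr (1 - 1 / q) * b i = (w i * \<kappa> i) * (\<kappa> i powr (- 1 / q) * b i)" by simp
  qed
  have S0: "0 \<le> S" unfolding S_def using w b by (intro sum_nonneg) auto
  have "S powr q \<le> (\<Sum>i\<in>I. (w i * \<kappa> i) * (\<kappa> i powr (- 1 / q) * b i) powr q)"
    unfolding S using w \<kappa> b by (intro Jensen_powr[OF fin _ w1 _ q]) (auto simp: less_imp_le)
  also have "\<dots> = (\<Sum>i\<in>I. w i * b i powr q)"
  proof (intro sum.cong refl)
    fix i assume i: "i \<in> I"
    have "(\<kappa> i powr (- 1 / q) * b i) powr q = \<kappa> i powr (- 1) * b i powr q"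
      using b[OF i] q by (simp add: powr_mult powr_powr)
    thus "(w i * \<kappa> i) * (\<kappa> i powr (- 1 / q) * b i) powr q = w i * b i powr q"
      using \<kappa>[OF i] by (simp add: powr_minus field_simps)
  qed
  finally have "(S powr q) powr (1 / q) \<le> (\<Sum>i\<in>I. w i * b i powr q) powr (1 / q)"
    using q by (intro powr_mono2) auto
  thus ?thesis using S0 q by (simp add: powr_powr S_def)
qed

lemma schatten_norm_smult_powr:
  assumes A: "A \<in> carrier_mat n n" and q: "1 \<le> q"
  shows "schatten_norm q (a \<cdot>\<^sub>m A) powr q = cmod a powr q * schatten_norm q A powr q"
proof -
  obtain P Q s where P: "unitary_mat n P" and Q: "unitary_mat n Q"
    and A_eq: "A = P * mat_diag n (\<lambda>i. complex_of_real (s i)) * Q"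
    using singular_value_decomposition[OF A] by blast
  note c = unitary_mat_carrier[OF P] unitary_mat_carrier[OF Q]
  have "a \<cdot>\<^sub>m A = P * mat_diag n (\<lambda>i. a * complex_of_real (s i)) * Q"
  proof (rule eq_matI)
    fix i j assume "i < dim_row (P * mat_diag n (\<lambda>i. a * complex_of_real (s i)) * Q)"
      "j < dim_col (P * mat_diag n (\<lambda>i. a * complex_of_real (s i)) * Q)"
    hence ij: "i < n" "j < n" using c by auto
    have "(a \<cdot>\<^sub>m A) $$ (i, j) = a * A $$ (i, j)" using ij A by simp
    also have "\<dots> = (P * mat_diag n (\<lambda>i. a * complex_of_real (s i)) * Q) $$ (i, j)"
      unfolding A_eq diag_product_index[OF c ij] by (simp add: sum_distrib_left mult_ac)
    finally show "(a \<cdot>\<^sub>m A) $$ (i, j) =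
      (P * mat_diag n (\<lambda>i. a * complex_of_real (s i)) * Q) $$ (i, j)" .
  qed (use A c in auto)
  hence "schatten_norm q (a \<cdot>\<^sub>m A) powr q = (\<Sum>k<n. cmod (a * complex_of_real (s k)) powr q)"
    using schatten_norm_powr_diag[OF P Q] q by simp
  also have "\<dots> = cmod a powr q * (\<Sum>k<n. cmod (complex_of_real (s k)) powr q)"
    by (simp add: norm_mult powr_mult sum_distrib_left)
  also have "\<dots> = cmod a powr q * schatten_norm q A powr q"
    unfolding A_eq using schatten_norm_powr_diag[OF P Q] q by simp
  finally show ?thesis .
qed

section \<open>The three lines inequality\<close>

text \<open>
  The factor \<open>exp (\<epsilon> (z\<^sup>2 - 1))\<close> has modulus at most one on the strip and decays as
  \<open>\<bar>Im z\<bar>\<close> grows, so that the maximum principle applies to a large rectangle; then \<open>\<epsilon> \<rightarrow> 0\<close>.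
\<close>

lemma three_lines_inequality:
  fixes F :: "complex \<Rightarrow> complex"
  assumes cont: "continuous_on {z. 0 \<le> Re z \<and> Re z \<le> 1} F"
    and hol: "F holomorphic_on {z. 0 < Re z \<and> Re z < 1}"
    and bdd: "\<And>z. 0 \<le> Re z \<Longrightarrow> Re z \<le> 1 \<Longrightarrow> cmod (F z) \<le> B"
    and left: "\<And>t. cmod (F (Complex 0 t)) \<le> M" and right: "\<And>t. cmod (F (Complex 1 t)) \<le> M"
    and \<theta>: "0 < \<theta>" "\<theta> < 1"
  shows "cmod (F (complex_of_real \<theta>)) \<le> M"
proof -
  have damped: "cmod (F (complex_of_real \<theta>)) * exp (\<epsilon> * (\<theta>\<^sup>2 - 1)) \<le> M'"
    if \<epsilon>: "\<epsilon> > 0" and M': "M' > M" for \<epsilon> M'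
  proof -
    have M0: "0 \<le> M" using order_trans[OF norm_ge_zero left] .
    define E where "E z = exp (complex_of_real \<epsilon> * (z\<^sup>2 - 1))" for z
    have E: "cmod (E z) = exp (\<epsilon> * ((Re z)\<^sup>2 - (Im z)\<^sup>2 - 1))" for z
      by (simp add: E_def power2_eq_square)
    have E_le: "cmod (E z) \<le> exp (- (\<epsilon> * (Im z)\<^sup>2))" if "0 \<le> Re z" "Re z \<le> 1" for z
    proof -
      have "(Re z)\<^sup>2 \<le> 1" using that by (simp add: power_le_one)
      hence "\<epsilon> * ((Re z)\<^sup>2 - (Im z)\<^sup>2 - 1) \<le> \<epsilon> * (- (Im z)\<^sup>2)"
        using \<epsilon> by (intro mult_left_mono) auto
      thus ?thesis by (simp add: E)
    qed
    have E_le1: "cmod (E z) \<le> 1" if "0 \<le> Re z" "Re z \<le> 1" for z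
      by (rule order_trans[OF E_le[OF that]]) (use \<epsilon> in simp)
    \<comment> \<open>the half-height \<open>R\<close> of the rectangle makes the damping beat the bound \<open>B\<close> on the horizontal sides\<close>
    define y where "y = (\<bar>B\<bar> + 1) / M'"
    define R where "R = sqrt (y / \<epsilon>)"
    have y: "y > 0" using M' M0 by (simp add: y_def add_nonneg_pos)
    have R0: "R > 0" and R2: "\<epsilon> * R\<^sup>2 = y" using y \<epsilon> by (simp_all add: R_def)
    have "\<bar>B\<bar> < M' * y" using M' M0 by (simp add: y_def)
    also have "\<dots> \<le> M' * exp y"
      using exp_ge_add_one_self[of y] M' M0 by (intro mult_left_mono) linarith+
    finally have R: "\<bar>B\<bar> * exp (- (\<epsilon> * R\<^sup>2)) < M'"
      unfolding R2 by (simp add: exp_minus divide_simps)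
    define S where "S = cbox (Complex 0 (- R)) (Complex 1 R)"
    have "cmod (F (complex_of_real \<theta>) * E (complex_of_real \<theta>)) \<le> M'"
    proof (rule maximum_modulus_frontier[where S = S and f = "\<lambda>z. F z * E z"])
      have "interior S \<subseteq> {z. 0 < Re z \<and> Re z < 1}"
        by (auto simp: S_def in_box_complex_iff interior_cbox)
      thus "(\<lambda>z. F z * E z) holomorphic_on interior S"
        unfolding E_def by (intro holomorphic_intros holomorphic_on_subset[OF hol])
      have "closure S \<subseteq> {z. 0 \<le> Re z \<and> Re z \<le> 1}"
        by (auto simp: S_def in_cbox_complex_iff)
      thus "continuous_on (closure S) (\<lambda>z. F z * E z)"
        unfolding E_def by (intro continuous_intros continuous_on_subset[OF cont])
      show "bounded S" by (simp add: S_def)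
      show "complex_of_real \<theta> \<in> S" using \<theta> R0 by (simp add: S_def in_cbox_complex_iff)
      fix z assume "z \<in> frontier S"
      hence z: "z \<in> S" "z \<notin> box (Complex 0 (- R)) (Complex 1 R)"
        by (auto simp: frontier_def S_def)
      have strip: "0 \<le> Re z" "Re z \<le> 1" using z(1) by (auto simp: S_def in_cbox_complex_iff)
      consider "Re z = 0" | "Re z = 1" | "\<bar>Im z\<bar> = R"
        using z R0 by (auto simp: S_def in_cbox_complex_iff in_box_complex_iff)
      thus "cmod (F z * E z) \<le> M'"
      proof cases
        case 1
        hence "cmod (F z) \<le> M" using left[of "Im z"] by (metis complex_surj)
        thus ?thesis using mult_mono[OF _ E_le1[OF strip], of "cmod (F z)" M] M0 M'
          by (simp add: norm_mult)
      next
        case 2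
        hence "cmod (F z) \<le> M" using right[of "Im z"] by (metis complex_surj)
        thus ?thesis using mult_mono[OF _ E_le1[OF strip], of "cmod (F z)" M] M0 M'
          by (simp add: norm_mult)
      next
        case 3
        hence "(Im z)\<^sup>2 = R\<^sup>2" by (metis power2_abs)
        moreover have "cmod (F z * E z) \<le> \<bar>B\<bar> * exp (- (\<epsilon> * (Im z)\<^sup>2))"
          unfolding norm_mult using bdd[OF strip] E_le[OF strip] by (intro mult_mono) auto
        ultimately show ?thesis using R by simp
      qed
    qed
    thus ?thesis by (simp add: norm_mult E)
  qed
  have "cmod (F (complex_of_real \<theta>)) \<le> M'" if M': "M' > M" for M'
  proof (rule tendsto_upperbound)
    have "((\<lambda>\<epsilon>. cmod (F (complex_of_real \<theta>)) * exp (\<epsilon> * (\<theta>\<^sup>2 - 1))) \<longlongrightarrow>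
      cmod (F (complex_of_real \<theta>)) * exp (0 * (\<theta>\<^sup>2 - 1))) (at_right 0)"
      by (intro tendsto_intros)
    hence "((\<lambda>\<epsilon>. cmod (F (complex_of_real \<theta>)) * exp (\<epsilon> * (\<theta>\<^sup>2 - 1))) \<longlongrightarrow>
      cmod (F (complex_of_real \<theta>))) (at_right 0)" by simp
    thus "((\<lambda>\<epsilon>. cmod (F (complex_of_real \<theta>)) * exp (\<epsilon> * (\<theta>\<^sup>2 - 1))) \<longlongrightarrow>
      cmod (F (complex_of_real \<theta>))) (at_right 0)" .
    show "\<forall>\<^sub>F \<epsilon> in at_right 0. cmod (F (complex_of_real \<theta>)) * exp (\<epsilon> * (\<theta>\<^sup>2 - 1)) \<le> M'"
      using eventually_at_right_less[of 0] by eventually_elim (rule damped[OF _ M'])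
  qed auto
  thus ?thesis by (rule dense_ge)
qed

section \<open>The spaces of matrix fields\<close>

locale dual_fields =
  fixes G :: "('g, 'm) monoid_scheme" and T :: "'g topology" and r :: "'g unirep set \<Rightarrow> 'g unirep"
  assumes reps: "representatives G T r"
begin

abbreviation dual where "dual \<equiv> unitary_dual G T"
abbreviation dim_at where "dim_at c \<equiv> fst (r c)"
abbreviation fields where "fields \<equiv> matrix_fields G T r"
abbreviation ell where "ell q \<equiv> l_sch G T r q"

definition mass :: "real \<Rightarrow> ('g unirep set \<Rightarrow> complex mat) \<Rightarrow> 'g unirep set \<Rightarrow> real"
  where "mass q H c = real (dim_at c) * schatten_norm q (H c) powr q"

lemma mass_nonneg: "0 \<le> mass q H c"
  by (simp add: mass_def)

lemma dim_pos:
  assumes "c \<in> dual"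
  shows "0 < dim_at c"
proof -
  have "r c \<in> c" using reps assms by (simp add: representatives_def)
  moreover obtain x where "c = rep_equiv G T `` {x}"
    using assms by (auto simp: unitary_dual_def quotient_def)
  ultimately have "(x, r c) \<in> rep_equiv G T" by auto
  hence "r c \<in> irreps G T" by (cases "r c") (auto simp: rep_equiv_def)
  thus ?thesis by (cases "r c") (auto simp: irreps_def irreducible_rep_def)
qed

lemma fields_carrier_iff:
  "H \<in> carrier fields \<longleftrightarrow>
    H \<in> extensional dual \<and> (\<forall>c\<in>dual. H c \<in> carrier_mat (dim_at c) (dim_at c))"
  by (auto simp: matrix_fields_def PiE_iff)

lemma fields_carrierD: "H \<in> carrier fields \<Longrightarrow> c \<in> dual \<Longrightarrow> H c \<in> carrier_mat (dim_at c) (dim_at c)"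
  by (simp add: fields_carrier_iff)

lemma fields_add: "H \<oplus>\<^bsub>fields\<^esub> K = (\<lambda>c\<in>dual. H c + K c)"
  by (simp add: matrix_fields_def)

lemma fields_smult: "a \<odot>\<^bsub>fields\<^esub> H = (\<lambda>c\<in>dual. a \<cdot>\<^sub>m H c)"
  by (simp add: matrix_fields_def)

sublocale fields: vectorspace class_ring fields
  by (rule vectorspace_matrix_fields)

lemma fields_minus:
  assumes "H \<in> carrier fields" "K \<in> carrier fields"
  shows "H \<ominus>\<^bsub>fields\<^esub> K = (\<lambda>c\<in>dual. H c - K c)"
proof -
  define K' where "K' = (\<lambda>c\<in>dual. - K c)"
  have K': "K' \<in> carrier fields" using assms by (simp add: fields_carrier_iff K'_def)
  have "K' \<oplus>\<^bsub>fields\<^esub> K = \<zero>\<^bsub>fields\<^esub>"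
    using assms by (auto simp: K'_def matrix_fields_def PiE_iff intro!: restrict_ext uminus_l_inv_mat)
  hence "\<ominus>\<^bsub>fields\<^esub> K = K'" using fields.minus_equality K' assms by blast
  hence "H \<ominus>\<^bsub>fields\<^esub> K = (\<lambda>c\<in>dual. H c + K' c)" by (simp add: a_minus_def fields_add)
  also have "\<dots> = (\<lambda>c\<in>dual. H c - K c)"
    using assms by (intro restrict_ext) (auto simp: K'_def fields_carrier_iff minus_add_uminus_mat)
  finally show ?thesis .
qed

lemma ell_points_iff:
  "H \<in> points (ell q) \<longleftrightarrow> H \<in> carrier fields \<and> mass q H summable_on dual"
  by (simp add: l_sch_def mass_def[abs_def])

lemma ell_nrm: "nrm (ell q) H = infsum (mass q H) dual powr (1 / q)"
  by (simp add: l_sch_def mass_def[abs_def])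

lemma ell_nrm_nonneg: "0 \<le> nrm (ell q) H"
  by (simp add: ell_nrm)

lemma ell_pointsI:
  assumes q: "1 \<le> q" and H: "H \<in> carrier fields" and M: "0 \<le> M"
    and le: "\<And>A. finite A \<Longrightarrow> A \<subseteq> dual \<Longrightarrow> sum (mass q H) A \<le> M powr q"
  shows "H \<in> points (ell q)" and "nrm (ell q) H \<le> M"
proof -
  have summ: "mass q H summable_on dual"
    using le by (intro nonneg_bdd_above_summable_on bdd_aboveI2 mass_nonneg) auto
  thus "H \<in> points (ell q)" using H by (simp add: ell_points_iff)
  have "infsum (mass q H) dual \<le> M powr q"
    using summ le by (intro infsum_le_finite_sums) auto
  hence "infsum (mass q H) dual powr (1 / q) \<le> (M powr q) powr (1 / q)"
    using q by (intro powr_mono2) (auto intro: infsum_nonneg mass_nonneg)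
  thus "nrm (ell q) H \<le> M" using q M by (simp add: ell_nrm powr_powr)
qed

lemma ell_sum_le:
  assumes q: "1 \<le> q" and H: "H \<in> points (ell q)" and A: "finite A" "A \<subseteq> dual"
  shows "sum (mass q H) A \<le> nrm (ell q) H powr q"
proof -
  have "sum (mass q H) A \<le> infsum (mass q H) dual"
    using H A by (intro finite_sum_le_infsum) (auto simp: ell_points_iff mass_nonneg)
  also have "\<dots> = nrm (ell q) H powr q"
    using q by (simp add: ell_nrm powr_powr infsum_nonneg mass_nonneg)
  finally show ?thesis .
qed

text \<open>
  Matrix entries are bounded functionals, because the weights \<open>dim_at c\<close> are at least one. This is
  how scalar function theory applies to fields.
\<close>

lemma ell_entry_le:
  assumes q: "1 \<le> q" and H: "H \<in> points (ell q)" and c: "c \<in> dual"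
    and ij: "i < dim_at c" "j < dim_at c"
  shows "cmod (H c $$ (i, j)) \<le> nrm (ell q) H"
proof -
  have "cmod (H c $$ (i, j)) powr q \<le> schatten_norm q (H c) powr q"
    using H c by (intro cmod_entry_le_schatten_norm[OF _ ij q]) (simp add: ell_points_iff fields_carrierD)
  also have "\<dots> \<le> mass q H c"
    using dim_pos[OF c] mult_right_mono[of 1 "real (dim_at c)" "schatten_norm q (H c) powr q"]
    by (simp add: mass_def)
  also have "\<dots> \<le> nrm (ell q) H powr q" using ell_sum_le[OF q H, of "{c}"] c by simp
  finally have "\<not> nrm (ell q) H < cmod (H c $$ (i, j))"
    using q powr_less_mono2[of q "nrm (ell q) H" "cmod (H c $$ (i, j))"] ell_nrm_nonneg[of q H]
    by auto
  thus ?thesis by simp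
qed

lemma mass_add_le:
  assumes "1 \<le> q" "H \<in> carrier fields" "K \<in> carrier fields" "c \<in> dual"
  shows "mass q (H \<oplus>\<^bsub>fields\<^esub> K) c \<le> 2 powr q * (mass q H c + mass q K c)"
  using mult_left_mono[OF schatten_norm_add_powr_le[OF assms(2,3)[THEN fields_carrierD[OF _ assms(4)]] assms(1)],
      of "real (dim_at c)"] assms(4)
  by (simp add: mass_def fields_add algebra_simps)

lemma mass_smult:
  assumes "1 \<le> q" "H \<in> carrier fields" "c \<in> dual"
  shows "mass q (a \<odot>\<^bsub>fields\<^esub> H) c = cmod a powr q * mass q H c"
  using schatten_norm_smult_powr[OF fields_carrierD[OF assms(2,3)] assms(1)] assms(3)
  by (simp add: mass_def fields_smult)

text \<open>
  Used for closure under addition and to keep norms bounded near a point of continuity. Both are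
  questions of finiteness only, so that the factor \<open>4\<close> does no harm.
\<close>

lemma ell_add:
  assumes q: "1 \<le> q" and H: "H \<in> points (ell q)" and K: "K \<in> points (ell q)"
  shows "H \<oplus>\<^bsub>fields\<^esub> K \<in> points (ell q)"
    and "nrm (ell q) (H \<oplus>\<^bsub>fields\<^esub> K) \<le> 4 * (nrm (ell q) H + nrm (ell q) K)"
proof -
  have c: "H \<in> carrier fields" "K \<in> carrier fields" using H K by (auto simp: ell_points_iff)
  let ?M = "nrm (ell q) H + nrm (ell q) K"
  have M: "0 \<le> nrm (ell q) H" "0 \<le> nrm (ell q) K" by (simp_all add: ell_nrm_nonneg)
  have le: "sum (mass q (H \<oplus>\<^bsub>fields\<^esub> K)) A \<le> (4 * ?M) powr q" if A: "finite A" "A \<subseteq> dual" for A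
  proof -
    have "sum (mass q (H \<oplus>\<^bsub>fields\<^esub> K)) A \<le> (\<Sum>c\<in>A. 2 powr q * (mass q H c + mass q K c))"
      using A c q by (intro sum_mono mass_add_le) auto
    also have "\<dots> = 2 powr q * (sum (mass q H) A + sum (mass q K) A)"
      by (simp add: sum.distrib flip: sum_distrib_left)
    also have "\<dots> \<le> 2 powr q * (?M powr q + ?M powr q)"
      using M q
      by (intro mult_left_mono add_mono order_trans[OF ell_sum_le[OF q _ A]] powr_mono2 H K) auto
    also have "\<dots> \<le> 2 powr q * (2 powr q * ?M powr q)"
      using M powr_mono[of 1 q 2] q by (intro mult_left_mono) (auto simp: mult_right_mono)
    also have "\<dots> = (4 * ?M) powr q"
      using M powr_mult[of 2 2 q] powr_mult[of 4 ?M q] by (simp del: distrib_left_numeral)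
    finally show ?thesis .
  qed
  have "H \<oplus>\<^bsub>fields\<^esub> K \<in> carrier fields" using c by simp
  from ell_pointsI[OF q this _ le] M
  show "H \<oplus>\<^bsub>fields\<^esub> K \<in> points (ell q)" "nrm (ell q) (H \<oplus>\<^bsub>fields\<^esub> K) \<le> 4 * ?M" by auto
qed

lemma ell_smult:
  assumes q: "1 \<le> q" and H: "H \<in> points (ell q)"
  shows "a \<odot>\<^bsub>fields\<^esub> H \<in> points (ell q)"
proof (rule ell_pointsI(1)[OF q, where M = "cmod a * nrm (ell q) H"])
  have c: "H \<in> carrier fields" using H by (auto simp: ell_points_iff)
  show "a \<odot>\<^bsub>fields\<^esub> H \<in> carrier fields" using c by (simp add: fields_carrier_iff fields_smult)
  show "0 \<le> cmod a * nrm (ell q) H" by (simp add: ell_nrm_nonneg)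
  fix A assume A: "finite A" "A \<subseteq> dual"
  have "sum (mass q (a \<odot>\<^bsub>fields\<^esub> H)) A = cmod a powr q * sum (mass q H) A"
    unfolding sum_distrib_left using A mass_smult[OF q c] by (intro sum.cong) auto
  also have "\<dots> \<le> cmod a powr q * nrm (ell q) H powr q"
    by (intro mult_left_mono ell_sum_le[OF q H A]) auto
  finally show "sum (mass q (a \<odot>\<^bsub>fields\<^esub> H)) A \<le> (cmod a * nrm (ell q) H) powr q"
    by (simp add: powr_mult ell_nrm_nonneg)
qed

lemma minus_eq_add_smult:
  assumes "H \<in> carrier fields" "K \<in> carrier fields"
  shows "H \<ominus>\<^bsub>fields\<^esub> K = H \<oplus>\<^bsub>fields\<^esub> ((- 1) \<odot>\<^bsub>fields\<^esub> K)"
  unfolding fields_minus[OF assms] fields_add fields_smult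
  using assms by (intro restrict_ext) (auto intro!: eq_matI simp: fields_carrier_iff)

lemma ell_minus:
  assumes q: "1 \<le> q" and H: "H \<in> points (ell q)" and K: "K \<in> points (ell q)"
  shows "H \<ominus>\<^bsub>fields\<^esub> K \<in> points (ell q)"
  using ell_add(1)[OF q H ell_smult[OF q K]] minus_eq_add_smult[of H K] H K
  by (simp add: ell_points_iff)

lemma ell_nrm_le_diff:
  assumes q: "1 \<le> q" and H: "H \<in> points (ell q)" and K: "K \<in> points (ell q)"
  shows "nrm (ell q) H \<le> 4 * (nrm (ell q) (H \<ominus>\<^bsub>fields\<^esub> K) + nrm (ell q) K)"
proof -
  have c: "H \<in> carrier fields" "K \<in> carrier fields" using H K by (auto simp: ell_points_iff)
  have "(H \<ominus>\<^bsub>fields\<^esub> K) \<oplus>\<^bsub>fields\<^esub> K = H"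
    unfolding fields_minus[OF c] fields_add
  proof (rule extensionalityI[where A = dual])
    fix x assume x: "x \<in> dual"
    note Hx = fields_carrierD[OF c(1) x] and Kx = fields_carrierD[OF c(2) x]
    have "H x - K x + K x = H x" by (rule eq_matI) (use Hx Kx in auto)
    thus "(\<lambda>y\<in>dual. (\<lambda>z\<in>dual. H z - K z) y + K y) x = H x" using x by simp
  qed (use c in \<open>auto simp: fields_carrier_iff\<close>)
  thus ?thesis using ell_add(2)[OF q ell_minus[OF q H K] K] by simp
qed

abbreviation ell_sum where "ell_sum q q' \<equiv> sum_space fields (ell q) (ell q')"

lemma ell_sum_points_iff:
  "H \<in> points (ell_sum q q') \<longleftrightarrow>
    (\<exists>H0 H1. H0 \<in> points (ell q) \<and> H1 \<in> points (ell q') \<and> H = H0 \<oplus>\<^bsub>fields\<^esub> H1)"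
  by (auto simp: sum_space_def)

lemma ell_sum_carrier: "H \<in> points (ell_sum q q') \<Longrightarrow> H \<in> carrier fields"
  by (auto simp: ell_sum_points_iff ell_points_iff)

lemma ell_sum_smult:
  assumes "1 \<le> q" "1 \<le> q'" "H \<in> points (ell_sum q q')"
  shows "a \<odot>\<^bsub>fields\<^esub> H \<in> points (ell_sum q q')"
proof -
  obtain H0 H1 where H: "H0 \<in> points (ell q)" "H1 \<in> points (ell q')" "H = H0 \<oplus>\<^bsub>fields\<^esub> H1"
    using assms by (auto simp: ell_sum_points_iff)
  have "a \<odot>\<^bsub>fields\<^esub> H = (a \<odot>\<^bsub>fields\<^esub> H0) \<oplus>\<^bsub>fields\<^esub> (a \<odot>\<^bsub>fields\<^esub> H1)"
    unfolding H(3) fields_add fields_smult using H(1,2)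
    by (intro restrict_ext) (auto intro!: add_smult_distrib_left_mat simp: ell_points_iff fields_carrier_iff)
  thus ?thesis using ell_smult assms(1,2) H(1,2) unfolding ell_sum_points_iff by blast
qed

lemma ell_sum_minus:
  assumes "1 \<le> q" "1 \<le> q'" "H \<in> points (ell_sum q q')" "K \<in> points (ell_sum q q')"
  shows "H \<ominus>\<^bsub>fields\<^esub> K \<in> points (ell_sum q q')"
proof -
  obtain H0 H1 where H: "H0 \<in> points (ell q)" "H1 \<in> points (ell q')" "H = H0 \<oplus>\<^bsub>fields\<^esub> H1"
    using assms by (auto simp: ell_sum_points_iff)
  obtain K0 K1 where K: "K0 \<in> points (ell q)" "K1 \<in> points (ell q')"
    "(- 1) \<odot>\<^bsub>fields\<^esub> K = K0 \<oplus>\<^bsub>fields\<^esub> K1"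
    using ell_sum_smult[OF assms(1,2,4), of "- 1"] by (auto simp: ell_sum_points_iff)
  have c: "H0 \<in> carrier fields" "H1 \<in> carrier fields" "K0 \<in> carrier fields" "K1 \<in> carrier fields"
    using H K by (auto simp: ell_points_iff)
  have "H \<ominus>\<^bsub>fields\<^esub> K = (H0 \<oplus>\<^bsub>fields\<^esub> H1) \<oplus>\<^bsub>fields\<^esub> (K0 \<oplus>\<^bsub>fields\<^esub> K1)"
    using minus_eq_add_smult[OF assms(3,4)[THEN ell_sum_carrier]] H(3) K(3) by simp
  also have "\<dots> = (H0 \<oplus>\<^bsub>fields\<^esub> K0) \<oplus>\<^bsub>fields\<^esub> (H1 \<oplus>\<^bsub>fields\<^esub> K1)"
    using c by (simp add: fields.a_ac)
  finally show ?thesis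
    unfolding ell_sum_points_iff using ell_add(1) assms(1,2) H(1,2) K(1,2) by blast
qed

lemma ell_sum_nrm_le:
  assumes "H0 \<in> points (ell q)" "H1 \<in> points (ell q')"
  shows "nrm (ell_sum q q') (H0 \<oplus>\<^bsub>fields\<^esub> H1) \<le> nrm (ell q) H0 + nrm (ell q') H1"
  unfolding sum_space_def normed_sub.simps using assms
  by (intro cInf_lower bdd_belowI[of _ 0]) (auto intro!: add_nonneg_nonneg ell_nrm_nonneg)

lemma ell_sum_nrm_nonneg:
  assumes "H \<in> points (ell_sum q q')"
  shows "0 \<le> nrm (ell_sum q q') H"
  using assms unfolding sum_space_def normed_sub.simps
  by (intro cInf_greatest) (auto intro!: add_nonneg_nonneg ell_nrm_nonneg)

lemma ell_sum_entry_le: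
  assumes q: "1 \<le> q" "1 \<le> q'" and H: "H \<in> points (ell_sum q q')" and c: "c \<in> dual"
    and ij: "i < dim_at c" "j < dim_at c"
  shows "cmod (H c $$ (i, j)) \<le> nrm (ell_sum q q') H"
proof -
  have "cmod (H c $$ (i, j)) \<le> nrm (ell q) H0 + nrm (ell q') H1"
    if H01: "H0 \<in> points (ell q)" "H1 \<in> points (ell q')" "H = H0 \<oplus>\<^bsub>fields\<^esub> H1" for H0 H1
  proof -
    have "H c $$ (i, j) = H0 c $$ (i, j) + H1 c $$ (i, j)"
      using H01 c ij fields_carrierD[of H1 c] by (simp add: fields_add ell_points_iff)
    thus ?thesis
      using ell_entry_le[OF q(1) H01(1) c ij] ell_entry_le[OF q(2) H01(2) c ij]
        norm_triangle_ineq[of "H0 c $$ (i, j)" "H1 c $$ (i, j)"] by simp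
  qed
  thus ?thesis using H unfolding sum_space_def normed_sub.simps by (intro cInf_greatest) auto
qed

end

section \<open>The interpolation norm dominates the Schatten norm\<close>

lemma interpolated_exponent_ge_1:
  fixes p0 p1 p \<theta> :: real
  assumes "1 \<le> p0" "1 \<le> p1" "0 < \<theta>" "\<theta> < 1" "1 / p = (1 - \<theta>) / p0 + \<theta> / p1"
  shows "1 \<le> p"
proof -
  have "(1 - \<theta>) / p0 + \<theta> / p1 \<le> (1 - \<theta>) / 1 + \<theta> / 1"
    using assms by (intro add_mono divide_left_mono) auto
  hence le: "1 / p \<le> 1" using assms(5) by simp
  have "0 < (1 - \<theta>) / p0 + \<theta> / p1"
    using assms by (intro add_pos_pos divide_pos_pos) auto
  hence "0 < p" using assms(5) by (metis zero_less_divide_1_iff)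
  thus ?thesis using le by simp
qed

context dual_fields
begin

text \<open>
  Boundedness follows from the decay at infinity and, on the remaining compact interval, from
  continuity. It ensures that the supremum in the interpolation norm is an upper bound.
\<close>

lemma boundary_admissible_bdd:
  assumes q: "1 \<le> q" and g: "boundary_admissible fields (ell q) g"
  shows "bdd_above (range (\<lambda>t. nrm (ell q) (g t)))"
proof -
  have gp: "g t \<in> points (ell q)" for t
    using g by (auto simp: boundary_admissible_def norm_continuous_on_def)
  have "\<exists>U. open U \<and> t \<in> U \<and> (\<forall>s\<in>U. nrm (ell q) (g s) \<le> 4 * (1 + nrm (ell q) (g t)))" for t
  proof -
    have "((\<lambda>s. nrm (ell q) (g s \<ominus>\<^bsub>fields\<^esub> g t)) \<longlongrightarrow> 0) (at t)"
      using g by (simp add: boundary_admissible_def norm_continuous_on_def)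
    hence "\<forall>\<^sub>F s in at t. nrm (ell q) (g s \<ominus>\<^bsub>fields\<^esub> g t) < 1"
      by (rule order_tendstoD) simp
    then obtain U where U: "open U" "t \<in> U"
      and lt: "\<And>s. s \<in> U \<Longrightarrow> s \<noteq> t \<Longrightarrow> nrm (ell q) (g s \<ominus>\<^bsub>fields\<^esub> g t) < 1"
      by (auto simp: eventually_at_topological)
    have "nrm (ell q) (g s) \<le> 4 * (1 + nrm (ell q) (g t))" if "s \<in> U" for s
    proof (cases "s = t")
      case True
      thus ?thesis using ell_nrm_nonneg[of q "g t"] by simp
    next
      case False
      thus ?thesis using lt[OF that False] ell_nrm_le_diff[OF q gp[of s] gp[of t]] by simp
    qed
    thus ?thesis using U by blast
  qed
  then obtain U where U: "\<And>t. open (U t)" "\<And>t. t \<in> U t"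
    and Ub: "\<And>t s. s \<in> U t \<Longrightarrow> nrm (ell q) (g s) \<le> 4 * (1 + nrm (ell q) (g t))"
    by metis
  have "((\<lambda>t. nrm (ell q) (g t)) \<longlongrightarrow> 0) at_infinity"
    using g by (simp add: boundary_admissible_def)
  hence "\<forall>\<^sub>F t in at_infinity. nrm (ell q) (g t) < 1" by (rule order_tendstoD) simp
  then obtain R where R: "\<And>t. R \<le> \<bar>t\<bar> \<Longrightarrow> nrm (ell q) (g t) < 1"
    by (auto simp: eventually_at_infinity)
  have cover: "{-R..R} \<subseteq> (\<Union>t\<in>UNIV. U t)" using U(2) by blast
  obtain C where C: "finite C" "{-R..R} \<subseteq> (\<Union>t\<in>C. U t)"
    by (rule compactE_image[OF compact_Icc _ cover]) (use U(1) in auto)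
  define K where "K = 1 + (\<Sum>t\<in>C. 4 * (1 + nrm (ell q) (g t)))"
  have K: "4 * (1 + nrm (ell q) (g t)) \<le> K" if "t \<in> C" for t
    using member_le_sum[OF that, of "\<lambda>t. 4 * (1 + nrm (ell q) (g t))"] C(1) ell_nrm_nonneg
    by (simp add: K_def add_nonneg_nonneg)
  have K1: "1 \<le> K" by (simp add: K_def sum_nonneg add_nonneg_nonneg ell_nrm_nonneg)
  have "nrm (ell q) (g s) \<le> K" for s
  proof (cases "R \<le> \<bar>s\<bar>")
    case True
    thus ?thesis using R[OF True] K1 by simp
  next
    case False
    hence "s \<in> {-R..R}" by auto
    then obtain t where "t \<in> C" "s \<in> U t" using C(2) by blast
    thus ?thesis using Ub K order_trans by blast
  qed
  thus ?thesis by (intro bdd_aboveI2)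
qed

lemma continuous_on_entry:
  assumes q: "1 \<le> q" "1 \<le> q'" and f: "norm_continuous_on fields (ell_sum q q') S f"
    and c: "c \<in> dual" and ij: "i < dim_at c" "j < dim_at c"
  shows "continuous_on S (\<lambda>z. f z c $$ (i, j))"
  unfolding continuous_on_def
proof
  fix z assume z: "z \<in> S"
  have fS: "f w \<in> points (ell_sum q q')" if "w \<in> S" for w
    using f that by (auto simp: norm_continuous_on_def)
  have lim: "((\<lambda>w. nrm (ell_sum q q') (f w \<ominus>\<^bsub>fields\<^esub> f z)) \<longlongrightarrow> 0) (at z within S)"
    using f z by (simp add: norm_continuous_on_def)
  have "((\<lambda>w. f w c $$ (i, j) - f z c $$ (i, j)) \<longlongrightarrow> 0) (at z within S)"
  proof (rule Lim_null_comparison[OF _ lim])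
    have "cmod (f w c $$ (i, j) - f z c $$ (i, j)) \<le> nrm (ell_sum q q') (f w \<ominus>\<^bsub>fields\<^esub> f z)"
      if w: "w \<in> S" for w
    proof -
      have "(f w \<ominus>\<^bsub>fields\<^esub> f z) c $$ (i, j) = f w c $$ (i, j) - f z c $$ (i, j)"
        using c ij fields_carrierD[OF ell_sum_carrier[OF fS[OF z]] c]
        by (simp add: fields_minus[OF fS[OF w, THEN ell_sum_carrier] fS[OF z, THEN ell_sum_carrier]])
      thus ?thesis using ell_sum_entry_le[OF q ell_sum_minus[OF q fS[OF w] fS[OF z]] c ij] by simp
    qed
    thus "\<forall>\<^sub>F w in at z within S. cmod (f w c $$ (i, j) - f z c $$ (i, j)) \<le>
        nrm (ell_sum q q') (f w \<ominus>\<^bsub>fields\<^esub> f z)"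
      by (auto simp: eventually_at_filter)
  qed
  thus "((\<lambda>w. f w c $$ (i, j)) \<longlongrightarrow> f z c $$ (i, j)) (at z within S)"
    by (simp add: Lim_null[symmetric])
qed

lemma holomorphic_on_entry:
  assumes q: "1 \<le> q" "1 \<le> q'" and S: "open S" and f: "norm_analytic_on fields (ell_sum q q') S f"
    and c: "c \<in> dual" and ij: "i < dim_at c" "j < dim_at c"
  shows "(\<lambda>z. f z c $$ (i, j)) holomorphic_on S"
  unfolding holomorphic_on_open[OF S]
proof
  fix z assume z: "z \<in> S"
  have fS: "f w \<in> points (ell_sum q q')" if "w \<in> S" for w
    using f that by (auto simp: norm_analytic_on_def)
  obtain d where d: "d \<in> points (ell_sum q q')"
    and lim: "((\<lambda>w. nrm (ell_sum q q')
      (((1 / (w - z)) \<odot>\<^bsub>fields\<^esub> (f w \<ominus>\<^bsub>fields\<^esub> f z)) \<ominus>\<^bsub>fields\<^esub> d)) \<longlongrightarrow> 0) (at z)"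
    using f z by (auto simp: norm_analytic_on_def)
  have "((\<lambda>w. (f w c $$ (i, j) - f z c $$ (i, j)) / (w - z) - d c $$ (i, j)) \<longlongrightarrow> 0) (at z)"
  proof (rule Lim_null_comparison[OF _ lim])
    have "cmod ((f w c $$ (i, j) - f z c $$ (i, j)) / (w - z) - d c $$ (i, j)) \<le>
        nrm (ell_sum q q') (((1 / (w - z)) \<odot>\<^bsub>fields\<^esub> (f w \<ominus>\<^bsub>fields\<^esub> f z)) \<ominus>\<^bsub>fields\<^esub> d)"
      if w: "w \<in> S" for w
    proof -
      let ?m = "f w \<ominus>\<^bsub>fields\<^esub> f z"
      have m: "?m \<in> points (ell_sum q q')" by (rule ell_sum_minus[OF q fS[OF w] fS[OF z]])
      have sm: "(1 / (w - z)) \<odot>\<^bsub>fields\<^esub> ?m \<in> points (ell_sum q q')"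
        by (rule ell_sum_smult[OF q m])
      have "?m c $$ (i, j) = f w c $$ (i, j) - f z c $$ (i, j)"
        using c ij fields_carrierD[OF ell_sum_carrier[OF fS[OF z]] c]
        by (simp add: fields_minus[OF fS[OF w, THEN ell_sum_carrier] fS[OF z, THEN ell_sum_carrier]])
      hence "((1 / (w - z)) \<odot>\<^bsub>fields\<^esub> ?m) c $$ (i, j) = (f w c $$ (i, j) - f z c $$ (i, j)) / (w - z)"
        using c ij fields_carrierD[OF ell_sum_carrier[OF m] c] by (simp add: fields_smult)
      hence "(((1 / (w - z)) \<odot>\<^bsub>fields\<^esub> ?m) \<ominus>\<^bsub>fields\<^esub> d) c $$ (i, j) =
          (f w c $$ (i, j) - f z c $$ (i, j)) / (w - z) - d c $$ (i, j)"
        using c ij fields_carrierD[OF ell_sum_carrier[OF d] c]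
        by (simp add: fields_minus[OF ell_sum_carrier[OF sm] ell_sum_carrier[OF d]])
      thus ?thesis using ell_sum_entry_le[OF q ell_sum_minus[OF q sm d] c ij] by simp
    qed
    thus "\<forall>\<^sub>F w in at z. cmod ((f w c $$ (i, j) - f z c $$ (i, j)) / (w - z) - d c $$ (i, j)) \<le>
        nrm (ell_sum q q') (((1 / (w - z)) \<odot>\<^bsub>fields\<^esub> (f w \<ominus>\<^bsub>fields\<^esub> f z)) \<ominus>\<^bsub>fields\<^esub> d)"
      using eventually_at_in_open'[OF S z] by (auto elim: eventually_mono)
  qed
  hence "((\<lambda>w. (f w c $$ (i, j) - f z c $$ (i, j)) / (w - z)) \<longlongrightarrow> d c $$ (i, j)) (at z)"
    by (simp add: Lim_null[symmetric])
  thus "\<exists>f'. ((\<lambda>z. f z c $$ (i, j)) has_field_derivative f') (at z)"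
    by (auto simp: has_field_derivative_iff)
qed

lemma field_singular_values:
  assumes H: "H \<in> carrier fields"
  shows "\<exists>U V s. (\<forall>c\<in>dual. unitary_mat (dim_at c) (U c) \<and> unitary_mat (dim_at c) (V c) \<and>
      H c = U c * mat_diag (dim_at c) (\<lambda>j. complex_of_real (s c j)) * V c) \<and>
    (\<forall>c j. 0 \<le> (s c j :: real))"
proof -
  define P where "P c x = (case x of (U, V, s) \<Rightarrow>
      (c \<in> dual \<longrightarrow> unitary_mat (dim_at c) U \<and> unitary_mat (dim_at c) V \<and>
        H c = U * mat_diag (dim_at c) (\<lambda>j. complex_of_real (s j)) * V) \<and> (\<forall>j. 0 \<le> (s j :: real)))"
    for c x
  have "\<exists>x. P c x" for c
  proof (cases "c \<in> dual")
    case True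
    then obtain U V s where "P c (U, V, s)"
      using singular_value_decomposition[OF fields_carrierD[OF H True]] by (auto simp: P_def)
    thus ?thesis by blast
  next
    case False
    hence "P c (undefined, undefined, \<lambda>_. 0)" by (simp add: P_def)
    thus ?thesis by blast
  qed
  then obtain x where x: "\<And>c. P c (x c)" by metis
  show ?thesis
    by (intro exI[of _ "\<lambda>c. fst (x c)"] exI[of _ "\<lambda>c. fst (snd (x c))"] exI[of _ "\<lambda>c. snd (snd (x c))"])
      (use x in \<open>auto simp: P_def case_prod_unfold\<close>)
qed

text \<open>
  Let \<open>s\<close> be the singular values of \<open>f \<theta>\<close>. Pairing \<open>f z\<close> with an analytic family built from the
  powers of \<open>s\<close> gives a scalar function on the strip. By Hoelder's inequality it is bounded by the
  norm of \<open>f\<close> on both boundary lines, while its value at \<open>\<theta>\<close> is the norm of a finite part of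
  \<open>f \<theta>\<close>. The powers are normalised to the total mass one, so that no conjugate exponents appear.
\<close>

lemma interp_norm_dominates:
  fixes p0 p1 p \<theta> :: real
  assumes p0: "1 \<le> p0" and p1: "1 \<le> p1" and \<theta>: "0 < \<theta>" "\<theta> < 1"
    and p: "1 / p = (1 - \<theta>) / p0 + \<theta> / p1"
    and f: "f \<in> interp_functions fields (ell p0) (ell p1)"
  shows "f (complex_of_real \<theta>) \<in> points (ell p)"
    and "nrm (ell p) (f (complex_of_real \<theta>)) \<le> interp_functions_norm (ell p0) (ell p1) f"
proof -
  define H where "H = f (complex_of_real \<theta>)"
  define L where "L = interp_functions_norm (ell p0) (ell p1) f"
  note p_ge = interpolated_exponent_ge_1[OF p0 p1 \<theta> p]
  have cont: "norm_continuous_on fields (ell_sum p0 p1) {z. 0 \<le> Re z \<and> Re z \<le> 1} f"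
    and ana: "norm_analytic_on fields (ell_sum p0 p1) {z. 0 < Re z \<and> Re z < 1} f"
    and left: "boundary_admissible fields (ell p0) (\<lambda>t. f (Complex 0 t))"
    and right: "boundary_admissible fields (ell p1) (\<lambda>t. f (Complex 1 t))"
    using f by (auto simp: interp_functions_def)
  obtain B where B: "\<And>z. 0 \<le> Re z \<Longrightarrow> Re z \<le> 1 \<Longrightarrow> nrm (ell_sum p0 p1) (f z) \<le> B"
    using f by (auto simp: interp_functions_def)
  have strip: "f z \<in> points (ell_sum p0 p1)" if "0 \<le> Re z" "Re z \<le> 1" for z
    using cont that by (auto simp: norm_continuous_on_def)
  have left_pt: "f (Complex 0 t) \<in> points (ell p0)" and right_pt: "f (Complex 1 t) \<in> points (ell p1)" for t
    using left right by (auto simp: boundary_admissible_def norm_continuous_on_def)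
  have left_L: "nrm (ell p0) (f (Complex 0 t)) \<le> L" for t
    unfolding L_def interp_functions_norm_def
    by (intro max.coboundedI1 cSUP_upper boundary_admissible_bdd[OF p0 left]) simp
  have right_L: "nrm (ell p1) (f (Complex 1 t)) \<le> L" for t
    unfolding L_def interp_functions_norm_def
    by (intro max.coboundedI2 cSUP_upper boundary_admissible_bdd[OF p1 right]) simp
  have L0: "0 \<le> L" using order_trans[OF ell_nrm_nonneg left_L] .
  have H: "H \<in> carrier fields" using strip[of "complex_of_real \<theta>"] \<theta> ell_sum_carrier by (auto simp: H_def)
  obtain U V s where UV: "\<And>c. c \<in> dual \<Longrightarrow> unitary_mat (dim_at c) (U c)"
    "\<And>c. c \<in> dual \<Longrightarrow> unitary_mat (dim_at c) (V c)" and s: "\<And>c j. 0 \<le> s c j"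
    and svd: "\<And>c. c \<in> dual \<Longrightarrow> H c = U c * mat_diag (dim_at c) (\<lambda>j. complex_of_real (s c j)) * V c"
    using field_singular_values[OF H] by metis
  define U' V' where "U' c = mat_adjoint (U c)" and "V' c = mat_adjoint (V c)" for c
  have UV': "unitary_mat (dim_at c) (U' c)" "unitary_mat (dim_at c) (V' c)" if "c \<in> dual" for c
    using UV[OF that] by (auto simp: U'_def V'_def intro: unitary_mat_adjoint)
  define g where "g c j z = (\<Sum>k<dim_at c. (\<Sum>l<dim_at c. U' c $$ (j, l) * f z c $$ (l, k)) * V' c $$ (k, j))"
    for c j z
  have g: "g c j z = (U' c * f z c * V' c) $$ (j, j)"
    if c: "c \<in> dual" and j: "j < dim_at c" and z: "0 \<le> Re z" "Re z \<le> 1" for c j z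
  proof -
    note car = unitary_mat_carrier[OF UV'(1)[OF c]] unitary_mat_carrier[OF UV'(2)[OF c]]
      fields_carrierD[OF ell_sum_carrier[OF strip[OF z]] c]
    show ?thesis
      unfolding mult_mat_index[OF mult_carrier_mat[OF car(1,3)] car(2) j j] g_def
      by (intro sum.cong refl) (simp add: mult_mat_index[OF car(1,3) j] del: index_mult_mat(1))
  qed
  have g\<theta>: "g c j (complex_of_real \<theta>) = complex_of_real (s c j)"
    if c: "c \<in> dual" and j: "j < dim_at c" for c j
  proof -
    define D where "D = mat_diag (dim_at c) (\<lambda>j. complex_of_real (s c j))"
    have car: "U c \<in> carrier_mat (dim_at c) (dim_at c)" "V c \<in> carrier_mat (dim_at c) (dim_at c)"
      "U' c \<in> carrier_mat (dim_at c) (dim_at c)" "V' c \<in> carrier_mat (dim_at c) (dim_at c)"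
      "D \<in> carrier_mat (dim_at c) (dim_at c)"
      using UV[OF c] UV'[OF c] by (auto simp: unitary_mat_def D_def)
    have assoc: "X * Y * Z = X * (Y * Z)"
      if "X \<in> carrier_mat (dim_at c) (dim_at c)" "Y \<in> carrier_mat (dim_at c) (dim_at c)"
        "Z \<in> carrier_mat (dim_at c) (dim_at c)" for X Y Z :: "complex mat"
      using that by (rule assoc_mult_mat)
    have mc: "X * Y \<in> carrier_mat (dim_at c) (dim_at c)"
      if "X \<in> carrier_mat (dim_at c) (dim_at c)" "Y \<in> carrier_mat (dim_at c) (dim_at c)"
      for X Y :: "complex mat"
      using that by (rule mult_carrier_mat)
    have "U' c * (U c * D * V c) * V' c = (U' c * U c) * (D * (V c * V' c))"
      using car by (simp add: assoc mc)
    also have "\<dots> = D"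
      using UV[OF c] left_mult_one_mat[OF car(5)] right_mult_one_mat[OF car(5)]
      by (simp add: unitary_mat_def U'_def V'_def)
    finally show ?thesis
      using g[OF c j, of "complex_of_real \<theta>"] \<theta> svd[OF c] j
      by (simp add: H_def[symmetric] D_def[symmetric]) (simp add: D_def mat_diag_def)
  qed
  have main: "sum (mass p H) A \<le> L powr p" if A: "finite A" "A \<subseteq> dual" for A
  proof -
    \<comment> \<open>only the positive singular values have logarithms; the others contribute nothing to the mass\<close>
    define I where "I = (SIGMA c:A. {j. j < dim_at c \<and> 0 < s c j})"
    define w where "w i = real (dim_at (fst i))" for i :: "'g unirep set \<times> nat"
    define N where "N = sum (mass p H) A"
    have finI: "finite I" using A by (auto simp: I_def)
    have I: "c \<in> dual" "j < dim_at c" "0 < s c j" if "(c, j) \<in> I" for c j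
      using that A by (auto simp: I_def)
    have w0: "0 \<le> w i" for i by (simp add: w_def)
    have sum_I_le: "(\<Sum>i\<in>I. w i * b (fst i) (snd i)) \<le> (\<Sum>c\<in>A. real (dim_at c) * (\<Sum>j<dim_at c. b c j))"
      if "\<And>c j. 0 \<le> b c j" for b
    proof -
      have "(\<Sum>i\<in>I. w i * b (fst i) (snd i)) = (\<Sum>c\<in>A. \<Sum>j\<in>{j. j < dim_at c \<and> 0 < s c j}. real (dim_at c) * b c j)"
        unfolding I_def w_def using A by (subst sum.Sigma) (auto simp: case_prod_unfold)
      also have "\<dots> \<le> (\<Sum>c\<in>A. \<Sum>j<dim_at c. real (dim_at c) * b c j)"
        using that by (intro sum_mono sum_mono2) auto
      finally show ?thesis by (simp add: sum_distrib_left)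
    qed
    have N: "N = (\<Sum>i\<in>I. w i * s (fst i) (snd i) powr p)"
    proof -
      have "N = (\<Sum>c\<in>A. \<Sum>j<dim_at c. real (dim_at c) * s c j powr p)"
        unfolding N_def
      proof (intro sum.cong refl)
        fix c assume "c \<in> A"
        hence c: "c \<in> dual" using A by auto
        show "mass p H c = (\<Sum>j<dim_at c. real (dim_at c) * s c j powr p)"
          unfolding mass_def svd[OF c] using schatten_norm_powr_diag[OF UV[OF c], of p] p_ge s
          by (simp add: sum_distrib_left)
      qed
      also have "\<dots> = (\<Sum>c\<in>A. \<Sum>j\<in>{j. j < dim_at c \<and> 0 < s c j}. real (dim_at c) * s c j powr p)"
      proof (rule sum.cong[OF refl], rule sum.mono_neutral_right)
        fix c
        show "\<forall>j\<in>{..<dim_at c} - {j. j < dim_at c \<and> 0 < s c j}. real (dim_at c) * s c j powr p = 0"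
          using s[of c] by (auto simp: less_le)
      qed auto
      also have "\<dots> = (\<Sum>i\<in>I. w i * s (fst i) (snd i) powr p)"
        unfolding I_def w_def using A by (subst sum.Sigma) (auto simp: case_prod_unfold)
      finally show ?thesis .
    qed
    show ?thesis
    proof (cases "N = 0")
      case True
      thus ?thesis by (simp add: N_def)
    next
      case False
      have "0 \<le> N" by (simp add: N_def sum_nonneg mass_nonneg)
      hence Npos: "0 < N" using False by simp
      define \<kappa> where "\<kappa> i = s (fst i) (snd i) powr p / N" for i
      have \<kappa>: "0 < \<kappa> i" if "i \<in> I" for i
        using I[of "fst i" "snd i"] that Npos by (simp add: \<kappa>_def)
      have \<kappa>1: "(\<Sum>i\<in>I. w i * \<kappa> i) = 1"
        using False N by (simp add: \<kappa>_def flip: sum_divide_distrib)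
      \<comment> \<open>\<open>Re \<beta>\<close> is \<open>1 / p0\<close> on the left line and \<open>1 / p1\<close> on the right one, and \<open>\<beta>\<close> is \<open>1 / p\<close> at \<open>\<theta>\<close>\<close>
      define \<beta> where "\<beta> z = (1 - z) / complex_of_real p0 + z / complex_of_real p1" for z
      have Re\<beta>: "Re (\<beta> z) = (1 - Re z) / p0 + Re z / p1" for z
        by (simp add: \<beta>_def)
      define \<Phi> where "\<Phi> z = (\<Sum>i\<in>I. complex_of_real (w i) *
          exp ((1 - \<beta> z) * complex_of_real (ln (\<kappa> i))) * g (fst i) (snd i) z)" for z
      have expo: "cmod (exp ((1 - \<beta> z) * complex_of_real (ln (\<kappa> i)))) = \<kappa> i powr (1 - Re (\<beta> z))"
        if "i \<in> I" for i z
        using \<kappa>[OF that] by (simp add: powr_def)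
      have \<Phi>_le: "cmod (\<Phi> z) \<le> (\<Sum>i\<in>I. w i * \<kappa> i powr (1 - Re (\<beta> z)) * cmod (g (fst i) (snd i) z))" for z
        unfolding \<Phi>_def by (rule sum_norm_le) (simp add: norm_mult expo w0 del: norm_exp_eq_Re)
      have line: "cmod (\<Phi> z) \<le> nrm (ell q) (f z)"
        if z: "0 \<le> Re z" "Re z \<le> 1" and q: "1 \<le> q" "Re (\<beta> z) = 1 / q" and fz: "f z \<in> points (ell q)" for z q
      proof -
        have "cmod (\<Phi> z) \<le> (\<Sum>i\<in>I. w i * \<kappa> i powr (1 - 1 / q) * cmod (g (fst i) (snd i) z))"
          using \<Phi>_le[of z] by (simp add: q(2))
        also have "\<dots> \<le> (\<Sum>i\<in>I. w i * cmod (g (fst i) (snd i) z) powr q) powr (1 / q)"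
          using \<kappa>1 by (intro weighted_sum_powr_le finI w0 \<kappa> q(1)) auto
        also have "\<dots> \<le> (nrm (ell q) (f z) powr q) powr (1 / q)"
        proof (rule powr_mono2)
          have "(\<Sum>i\<in>I. w i * cmod (g (fst i) (snd i) z) powr q) \<le>
              (\<Sum>c\<in>A. real (dim_at c) * (\<Sum>j<dim_at c. cmod (g c j z) powr q))"
            by (rule sum_I_le) simp
          also have "\<dots> \<le> sum (mass q (f z)) A"
          proof (rule sum_mono)
            fix c assume "c \<in> A"
            hence c: "c \<in> dual" using A by auto
            have "(\<Sum>j<dim_at c. cmod (g c j z) powr q) =
                (\<Sum>j<dim_at c. cmod ((U' c * f z c * V' c) $$ (j, j)) powr q)"
              by (intro sum.cong refl) (simp add: g[OF c _ z] del: index_mult_mat(1))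
            also have "\<dots> \<le> schatten_norm q (f z c) powr q"
              by (rule sum_diag_le_schatten_norm[OF fields_carrierD[OF ell_sum_carrier[OF strip[OF z]] c]
                    UV'[OF c] q(1)])
            finally show "real (dim_at c) * (\<Sum>j<dim_at c. cmod (g c j z) powr q) \<le> mass q (f z) c"
              unfolding mass_def by (rule mult_left_mono) simp
          qed
          also have "\<dots> \<le> nrm (ell q) (f z) powr q" by (rule ell_sum_le[OF q(1) fz A])
          finally show "(\<Sum>i\<in>I. w i * cmod (g (fst i) (snd i) z) powr q) \<le> nrm (ell q) (f z) powr q" .
        qed (use q w0 in \<open>auto intro!: sum_nonneg\<close>)
        also have "\<dots> = nrm (ell q) (f z)" using q(1) by (simp add: powr_powr ell_nrm_nonneg)
        finally show ?thesis .
      qed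
      have "cmod (\<Phi> (complex_of_real \<theta>)) \<le> L"
      proof (rule three_lines_inequality[OF _ _ _ _ _ \<theta>])
        have entry: "continuous_on {z. 0 \<le> Re z \<and> Re z \<le> 1} (\<lambda>z. f z c $$ (l, k))"
          "(\<lambda>z. f z c $$ (l, k)) holomorphic_on {z. 0 < Re z \<and> Re z < 1}"
          if "c \<in> dual" "l < dim_at c" "k < dim_at c" for c l k
        proof -
          show "continuous_on {z. 0 \<le> Re z \<and> Re z \<le> 1} (\<lambda>z. f z c $$ (l, k))"
            by (rule continuous_on_entry[OF p0 p1 cont that])
          have "open {z. 0 < Re z \<and> Re z < 1}"
            by (intro open_Collect_conj open_Collect_less continuous_intros)
          thus "(\<lambda>z. f z c $$ (l, k)) holomorphic_on {z. 0 < Re z \<and> Re z < 1}"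
            by (rule holomorphic_on_entry[OF p0 p1 _ ana that])
        qed
        show "continuous_on {z. 0 \<le> Re z \<and> Re z \<le> 1} \<Phi>"
          unfolding \<Phi>_def \<beta>_def g_def using p0 p1 I
          by (intro continuous_intros entry) (auto simp: prod_eq_iff)
        show "\<Phi> holomorphic_on {z. 0 < Re z \<and> Re z < 1}"
          unfolding \<Phi>_def \<beta>_def g_def using p0 p1 I
          by (intro holomorphic_intros entry) (auto simp: prod_eq_iff)
        show "cmod (\<Phi> (Complex 0 t)) \<le> L" for t
          using line[of "Complex 0 t" p0] left_pt[of t] left_L[of t] p0 by (simp add: Re\<beta>)
        show "cmod (\<Phi> (Complex 1 t)) \<le> L" for t
          using line[of "Complex 1 t" p1] right_pt[of t] right_L[of t] p1 by (simp add: Re\<beta>)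
        fix z :: complex assume z: "0 \<le> Re z" "Re z \<le> 1"
        define b where "b i = (\<Sum>k<dim_at (fst i). (\<Sum>l<dim_at (fst i).
            cmod (U' (fst i) $$ (snd i, l)) * B) * cmod (V' (fst i) $$ (k, snd i)))"
          for i :: "'g unirep set \<times> nat"
        have "cmod (\<Phi> z) \<le> (\<Sum>i\<in>I. w i * \<kappa> i powr (1 - Re (\<beta> z)) * cmod (g (fst i) (snd i) z))"
          by (rule \<Phi>_le)
        also have "\<dots> \<le> (\<Sum>i\<in>I. w i * (\<kappa> i + 1) * b i)"
        proof (intro sum_mono mult_mono)
          fix i assume i: "i \<in> I"
          obtain c j where ij: "i = (c, j)" by (cases i)
          note I = I[OF i[unfolded ij]]
          have "0 \<le> Re (\<beta> z)" "Re (\<beta> z) \<le> (1 - Re z) / 1 + Re z / 1"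
            unfolding Re\<beta> using z p0 p1
            by (auto intro!: add_nonneg_nonneg add_mono divide_left_mono divide_nonneg_nonneg
                simp del: div_by_1)
          hence e: "0 \<le> 1 - Re (\<beta> z)" "1 - Re (\<beta> z) \<le> 1" by auto
          have "\<kappa> i powr (1 - Re (\<beta> z)) \<le> (\<kappa> i + 1) powr (1 - Re (\<beta> z))"
            using e \<kappa>[OF i] by (intro powr_mono2) auto
          also have "\<dots> \<le> (\<kappa> i + 1) powr 1" using e \<kappa>[OF i] by (intro powr_mono) auto
          finally show "\<kappa> i powr (1 - Re (\<beta> z)) \<le> \<kappa> i + 1" using \<kappa>[OF i] by simp
          show "cmod (g (fst i) (snd i) z) \<le> b i"
            unfolding g_def b_def ij fst_conv snd_conv using I z
            by (intro sum_norm_le order_trans[OF norm_mult_ineq] mult_right_mono mult_left_mono norm_ge_zero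
                order_trans[OF ell_sum_entry_le[OF p0 p1 strip] B]) auto
          show "0 \<le> w i * (\<kappa> i + 1)" using w0[of i] \<kappa>[OF i] by simp
        qed (use w0 in auto)
        finally show "cmod (\<Phi> z) \<le> (\<Sum>i\<in>I. w i * (\<kappa> i + 1) * b i)" .
      qed
      moreover have "\<Phi> (complex_of_real \<theta>) = complex_of_real (N powr (1 / p))"
      proof -
        have \<beta>\<theta>: "1 - \<beta> (complex_of_real \<theta>) = complex_of_real (1 - 1 / p)"
          by (simp add: p \<beta>_def)
        have "\<Phi> (complex_of_real \<theta>) = (\<Sum>i\<in>I. complex_of_real (N powr (1 / p)) * complex_of_real (w i * \<kappa> i))"
          unfolding \<Phi>_def
        proof (intro sum.cong refl)
          fix i assume i: "i \<in> I"
          obtain c j where ij: "i = (c, j)" by (cases i)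
          note I = I[OF i[unfolded ij]]
          have "\<kappa> i powr (1 / p) = s c j / N powr (1 / p)"
            using I(3) Npos p_ge by (simp add: \<kappa>_def ij powr_divide powr_powr)
          hence "\<kappa> i powr (1 - 1 / p) * s c j = N powr (1 / p) * \<kappa> i"
            using \<kappa>[OF i] I(3) Npos by (simp add: powr_diff field_simps)
          moreover have "exp ((1 - \<beta> (complex_of_real \<theta>)) * complex_of_real (ln (\<kappa> i))) =
              complex_of_real (\<kappa> i powr (1 - 1 / p))"
            unfolding \<beta>\<theta> of_real_mult[symmetric] exp_of_real using \<kappa>[OF i] by (simp add: powr_def)
          ultimately show "complex_of_real (w i) * exp ((1 - \<beta> (complex_of_real \<theta>)) * complex_of_real (ln (\<kappa> i))) *
              g (fst i) (snd i) (complex_of_real \<theta>) =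
              complex_of_real (N powr (1 / p)) * complex_of_real (w i * \<kappa> i)"
            unfolding ij fst_conv snd_conv g\<theta>[OF I(1,2)]
            by (simp add: mult_ac flip: of_real_mult)
        qed
        also have "\<dots> = complex_of_real (N powr (1 / p)) * complex_of_real (\<Sum>i\<in>I. w i * \<kappa> i)"
          by (simp add: sum_distrib_left)
        finally show ?thesis using \<kappa>1 by simp
      qed
      ultimately have "N powr (1 / p) \<le> L" by simp
      hence "(N powr (1 / p)) powr p \<le> L powr p" using p_ge by (intro powr_mono2) auto
      thus ?thesis using Npos p_ge by (simp add: powr_powr N_def)
    qed
  qed
  show "f (complex_of_real \<theta>) \<in> points (ell p)"
    "nrm (ell p) (f (complex_of_real \<theta>)) \<le> interp_functions_norm (ell p0) (ell p1) f"
    using ell_pointsI[OF p_ge H L0 main] by (auto simp: H_def L_def)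
qed

end

section \<open>An extremal family of power functions\<close>

text \<open>
  The damped power \<open>exp (\<delta> (z\<^sup>2 - \<theta>\<^sup>2)) M x\<^bsup>a + b z\<^esup>\<close>, to be applied to the singular values \<open>x\<close> of a
  normalised field. The damping enforces decay along vertical lines and is trivial at \<open>\<theta>\<close>, where
  \<open>a + b \<theta> = 1\<close> makes the power linear in \<open>x\<close>.
\<close>

definition power_family :: "real \<Rightarrow> real \<Rightarrow> real \<Rightarrow> real \<Rightarrow> real \<Rightarrow> complex \<Rightarrow> real \<Rightarrow> complex"
  where "power_family a b M \<delta> \<theta> z x = (if x = 0 then 0 else
    complex_of_real M * exp (complex_of_real \<delta> * (z\<^sup>2 - complex_of_real (\<theta>\<^sup>2))) *
    exp ((complex_of_real a + complex_of_real b * z) * complex_of_real (ln x)))"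

text \<open>
  Where \<open>b ln x \<le> 0\<close>, the modulus of \<open>x\<^bsup>a + b z\<^esup>\<close> on the strip is at most its value on the line
  \<open>Re z = 0\<close>, elsewhere at most its value on the line \<open>Re z = 1\<close>.
\<close>

definition strip_envelope :: "real \<Rightarrow> real \<Rightarrow> real \<Rightarrow> real"
  where "strip_envelope a b x = x powr (if b * ln x \<le> 0 then a else a + b)"

lemma power_family_decay:
  assumes x: "0 \<le> x" and M: "0 \<le> M" and \<delta>: "0 < \<delta>" and \<rho>: "0 \<le> \<rho>" "\<rho> \<le> Re z" "Re z \<le> 1 - \<rho>"
  shows "cmod (power_family a b M \<delta> \<theta> z x) \<le>
    M * exp \<delta> * exp (- (\<delta> * (Im z)\<^sup>2)) * strip_envelope a b x * exp (- (\<rho> * \<bar>b * ln x\<bar>))"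
proof (cases "x = 0")
  case True
  thus ?thesis by (simp add: power_family_def strip_envelope_def)
next
  case False
  hence x: "x > 0" using x by simp
  have "(Re z)\<^sup>2 \<le> 1" using \<rho> by (intro power_le_one) auto
  hence "(Re z)\<^sup>2 - (Im z)\<^sup>2 - \<theta>\<^sup>2 \<le> 1 - (Im z)\<^sup>2" using zero_le_power2[of \<theta>] by linarith
  from mult_left_mono[OF this, of \<delta>]
  have damp: "\<delta> * ((Re z)\<^sup>2 - (Im z)\<^sup>2 - \<theta>\<^sup>2) \<le> \<delta> + - (\<delta> * (Im z)\<^sup>2)"
    using \<delta> by (simp add: algebra_simps)
  have env: "a * ln x + Re z * (b * ln x) \<le>
      (if b * ln x \<le> 0 then a else a + b) * ln x + - (\<rho> * \<bar>b * ln x\<bar>)"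
  proof (cases "b * ln x \<le> 0")
    case True
    have "Re z * (b * ln x) \<le> \<rho> * (b * ln x)" using \<rho>(2) True by (rule mult_right_mono_neg)
    thus ?thesis using True by simp
  next
    case False
    have "Re z * (b * ln x) \<le> (1 - \<rho>) * (b * ln x)" using \<rho>(3) False by (intro mult_right_mono) auto
    thus ?thesis using False by (simp add: algebra_simps)
  qed
  have "cmod (power_family a b M \<delta> \<theta> z x) =
      M * exp (\<delta> * ((Re z)\<^sup>2 - (Im z)\<^sup>2 - \<theta>\<^sup>2)) * exp (a * ln x + Re z * (b * ln x))"
    using x M by (simp add: power_family_def norm_mult power2_eq_square algebra_simps)
  also have "\<dots> \<le> M * exp (\<delta> + - (\<delta> * (Im z)\<^sup>2)) *
      exp ((if b * ln x \<le> 0 then a else a + b) * ln x + - (\<rho> * \<bar>b * ln x\<bar>))"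
    using damp env M by (intro mult_mono mult_left_mono) auto
  also have "\<dots> = M * exp \<delta> * exp (- (\<delta> * (Im z)\<^sup>2)) * strip_envelope a b x * exp (- (\<rho> * \<bar>b * ln x\<bar>))"
    using x unfolding exp_add strip_envelope_def by (simp add: powr_def)
  finally show ?thesis .
qed

lemma power_family_le:
  assumes "0 \<le> x" "0 \<le> M" "0 < \<delta>" "0 \<le> Re z" "Re z \<le> 1"
  shows "cmod (power_family a b M \<delta> \<theta> z x) \<le> M * exp \<delta> * strip_envelope a b x"
proof -
  have "cmod (power_family a b M \<delta> \<theta> z x) \<le>
      M * exp \<delta> * exp (- (\<delta> * (Im z)\<^sup>2)) * strip_envelope a b x * exp (- (0 * \<bar>b * ln x\<bar>))"
    by (rule power_family_decay) (use assms in auto)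
  also have "\<dots> \<le> M * exp \<delta> * 1 * strip_envelope a b x * 1"
    using assms by (intro mult_mono) (auto simp: strip_envelope_def)
  finally show ?thesis by simp
qed

definition power_family_deriv where
  "power_family_deriv a b M \<delta> \<theta> z x =
    (complex_of_real (2 * \<delta>) * z + complex_of_real (b * ln x)) * power_family a b M \<delta> \<theta> z x"

lemma has_field_derivative_power_family:
  "((\<lambda>z. power_family a b M \<delta> \<theta> z x) has_field_derivative power_family_deriv a b M \<delta> \<theta> z x) (at z within S)"
proof (cases "x = 0")
  case True
  thus ?thesis by (simp add: power_family_def power_family_deriv_def)
next
  case False
  thus ?thesis unfolding power_family_def power_family_deriv_def
    by (auto intro!: derivative_eq_intros simp: algebra_simps)
qed

text \<open>
  The logarithm in the derivative is absorbed by the factor \<open>exp (- \<rho> \<bar>b ln x\<bar>)\<close>, which is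
  available at distance \<open>\<rho>\<close> from the boundary of the strip.
\<close>

lemma power_family_deriv_le:
  assumes x: "0 \<le> x" and M: "0 \<le> M" and \<delta>: "0 < \<delta>" and \<rho>: "0 < \<rho>" "\<rho> \<le> Re z" "Re z \<le> 1 - \<rho>"
  shows "cmod (power_family_deriv a b M \<delta> \<theta> z x) \<le>
    (2 * \<delta> * cmod z + 1 / \<rho>) * (M * exp \<delta> * strip_envelope a b x)"
proof -
  define u where "u = \<bar>b * ln x\<bar>"
  define K where "K = M * exp \<delta> * strip_envelope a b x"
  have K: "0 \<le> K" using M by (simp add: K_def strip_envelope_def)
  have "cmod (power_family a b M \<delta> \<theta> z x) \<le>
      M * exp \<delta> * exp (- (\<delta> * (Im z)\<^sup>2)) * strip_envelope a b x * exp (- (\<rho> * u))"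
    unfolding u_def by (rule power_family_decay) (use assms in auto)
  also have "\<dots> \<le> M * exp \<delta> * 1 * strip_envelope a b x * exp (- (\<rho> * u))"
    using M \<delta> by (intro mult_mono) (auto simp: strip_envelope_def)
  finally have pf: "cmod (power_family a b M \<delta> \<theta> z x) \<le> K * exp (- (\<rho> * u))" by (simp add: K_def)
  have "\<rho> * u \<le> exp (\<rho> * u)" using exp_ge_add_one_self[of "\<rho> * u"] by linarith
  hence "u * exp (- (\<rho> * u)) \<le> 1 / \<rho>"
    using \<rho>(1) by (simp add: exp_minus field_simps)
  moreover have "exp (- (\<rho> * u)) \<le> 1" using \<rho>(1) by (simp add: u_def)
  hence "2 * \<delta> * cmod z * exp (- (\<rho> * u)) \<le> 2 * \<delta> * cmod z * 1"
    using \<delta> by (intro mult_left_mono) auto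
  ultimately have e: "(2 * \<delta> * cmod z + u) * exp (- (\<rho> * u)) \<le> 2 * \<delta> * cmod z + 1 / \<rho>"
    by (simp add: algebra_simps)
  have "cmod (complex_of_real (2 * \<delta>) * z + complex_of_real (b * ln x)) \<le> 2 * \<delta> * cmod z + u"
    unfolding u_def using \<delta> by (intro order_trans[OF norm_triangle_ineq] add_mono) (auto simp: norm_mult abs_mult)
  hence "cmod (power_family_deriv a b M \<delta> \<theta> z x) \<le> (2 * \<delta> * cmod z + u) * (K * exp (- (\<rho> * u)))"
    unfolding power_family_deriv_def norm_mult using pf \<delta> by (intro mult_mono) (auto simp: u_def)
  also have "\<dots> = (2 * \<delta> * cmod z + u) * exp (- (\<rho> * u)) * K" by simp
  also have "\<dots> \<le> (2 * \<delta> * cmod z + 1 / \<rho>) * K" by (rule mult_right_mono[OF e K])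
  finally show ?thesis by (simp add: K_def)
qed

text \<open>The lower part is estimated in the first space, the upper part in the second one.\<close>

definition lower_part :: "real \<Rightarrow> (real \<Rightarrow> complex) \<Rightarrow> real \<Rightarrow> complex"
  where "lower_part b \<phi> x = (if b * ln x \<le> 0 then \<phi> x else 0)"

definition upper_part :: "real \<Rightarrow> (real \<Rightarrow> complex) \<Rightarrow> real \<Rightarrow> complex"
  where "upper_part b \<phi> x = (if b * ln x \<le> 0 then 0 else \<phi> x)"

lemma lower_part_le:
  "0 \<le> C \<Longrightarrow> cmod (\<phi> x) \<le> C * strip_envelope a b x \<Longrightarrow> cmod (lower_part b \<phi> x) \<le> C * x powr a"
  by (auto simp: lower_part_def strip_envelope_def)

lemma upper_part_le:
  "0 \<le> C \<Longrightarrow> cmod (\<phi> x) \<le> C * strip_envelope a b x \<Longrightarrow>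
    cmod (upper_part b \<phi> x) \<le> C * x powr (a + b)"
  by (auto simp: upper_part_def strip_envelope_def)

lemma tendsto_parts:
  assumes "((\<lambda>w. \<phi> w x) \<longlongrightarrow> 0) F"
  shows "((\<lambda>w. lower_part b (\<phi> w) x) \<longlongrightarrow> 0) F" "((\<lambda>w. upper_part b (\<phi> w) x) \<longlongrightarrow> 0) F"
  using assms by (cases "b * ln x \<le> 0"; simp add: lower_part_def upper_part_def)+

section \<open>Functional calculus on the singular values of a field\<close>

text \<open>
  The setting for the construction of admissible functions: singular vectors \<open>U\<close>, \<open>V\<close> of a fixed
  field and its singular values \<open>\<sigma>\<close>, scaled so that the field has norm at most one. Every field
  in this section arises from it by applying a scalar function to the singular values.
\<close>

locale singular_fields = dual_fields G T r
  for G :: "('g, 'm) monoid_scheme" and T :: "'g topology" and r +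
  fixes U V :: "'g unirep set \<Rightarrow> complex mat" and \<sigma> :: "'g unirep set \<Rightarrow> nat \<Rightarrow> real" and p :: real
  assumes U: "c \<in> dual \<Longrightarrow> unitary_mat (dim_at c) (U c)"
    and V: "c \<in> dual \<Longrightarrow> unitary_mat (dim_at c) (V c)"
    and \<sigma>: "0 \<le> \<sigma> c j"
    and p: "1 \<le> p"
    and total: "finite A \<Longrightarrow> A \<subseteq> dual \<Longrightarrow>
      (\<Sum>c\<in>A. real (dim_at c) * (\<Sum>j<dim_at c. \<sigma> c j powr p)) \<le> 1"
begin

definition calc :: "(real \<Rightarrow> complex) \<Rightarrow> 'g unirep set \<Rightarrow> complex mat"
  where "calc \<phi> = (\<lambda>c\<in>dual. U c * mat_diag (dim_at c) (\<lambda>j. \<phi> (\<sigma> c j)) * V c)"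

lemma calc_carrier [simp]: "calc \<phi> \<in> carrier fields"
  using U V by (auto simp: fields_carrier_iff calc_def unitary_mat_def intro!: mult_carrier_mat)

lemma calc_index:
  assumes "c \<in> dual" "i < dim_at c" "j < dim_at c"
  shows "calc \<phi> c $$ (i, j) = (\<Sum>k<dim_at c. U c $$ (i, k) * \<phi> (\<sigma> c k) * V c $$ (k, j))"
  using assms diag_product_index[OF unitary_mat_carrier[OF U] unitary_mat_carrier[OF V]]
  by (simp add: calc_def)

lemma calc_eqI:
  assumes "K \<in> carrier fields"
    and "\<And>c i j. c \<in> dual \<Longrightarrow> i < dim_at c \<Longrightarrow> j < dim_at c \<Longrightarrow> K c $$ (i, j) = calc \<phi> c $$ (i, j)"
  shows "K = calc \<phi>"
proof (rule extensionalityI[where A = dual])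
  fix c assume c: "c \<in> dual"
  note Kc = fields_carrierD[OF assms(1) c] and cc = fields_carrierD[OF calc_carrier c]
  show "K c = calc \<phi> c"
    by (rule eq_matI) (use Kc cc[of \<phi>] assms(2)[OF c] in auto)
qed (use assms(1) calc_carrier in \<open>auto simp: fields_carrier_iff\<close>)

lemma calc_minus: "calc \<phi> \<ominus>\<^bsub>fields\<^esub> calc \<psi> = calc (\<lambda>x. \<phi> x - \<psi> x)"
proof (rule calc_eqI)
  fix c i j assume c: "c \<in> dual" "i < dim_at c" "j < dim_at c"
  show "(calc \<phi> \<ominus>\<^bsub>fields\<^esub> calc \<psi>) c $$ (i, j) = calc (\<lambda>x. \<phi> x - \<psi> x) c $$ (i, j)"
    using c fields_carrierD[OF calc_carrier[of \<psi>] c(1)]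
    by (simp add: fields_minus calc_index left_diff_distrib right_diff_distrib sum_subtractf)
qed simp

lemma calc_smult: "a \<odot>\<^bsub>fields\<^esub> calc \<phi> = calc (\<lambda>x. a * \<phi> x)"
proof (rule calc_eqI)
  show "a \<odot>\<^bsub>fields\<^esub> calc \<phi> \<in> carrier fields"
    using calc_carrier[of \<phi>] by (simp add: fields_carrier_iff fields_smult)
  fix c i j assume c: "c \<in> dual" "i < dim_at c" "j < dim_at c"
  show "(a \<odot>\<^bsub>fields\<^esub> calc \<phi>) c $$ (i, j) = calc (\<lambda>x. a * \<phi> x) c $$ (i, j)"
    using c fields_carrierD[OF calc_carrier[of \<phi>] c(1)]
    by (simp add: fields_smult calc_index sum_distrib_left mult_ac)
qed

lemma calc_add: "calc \<phi> \<oplus>\<^bsub>fields\<^esub> calc \<psi> = calc (\<lambda>x. \<phi> x + \<psi> x)"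
proof (rule calc_eqI)
  fix c i j assume c: "c \<in> dual" "i < dim_at c" "j < dim_at c"
  show "(calc \<phi> \<oplus>\<^bsub>fields\<^esub> calc \<psi>) c $$ (i, j) = calc (\<lambda>x. \<phi> x + \<psi> x) c $$ (i, j)"
    using c fields_carrierD[OF calc_carrier[of \<psi>] c(1)]
    by (simp add: fields_add calc_index distrib_left distrib_right sum.distrib)
qed simp

lemma mass_calc:
  assumes "1 \<le> q" "c \<in> dual"
  shows "mass q (calc \<phi>) c = real (dim_at c) * (\<Sum>j<dim_at c. cmod (\<phi> (\<sigma> c j)) powr q)"
  using assms schatten_norm_powr_diag[OF U[OF assms(2)] V[OF assms(2)], of q] by (simp add: mass_def calc_def)

lemma mass_calc_le:
  assumes q: "1 \<le> q" and C: "0 \<le> C" and c: "c \<in> dual"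
    and le: "\<And>x. 0 \<le> x \<Longrightarrow> cmod (\<phi> x) \<le> C * x powr (p / q)"
  shows "mass q (calc \<phi>) c \<le> C powr q * (real (dim_at c) * (\<Sum>j<dim_at c. \<sigma> c j powr p))"
proof -
  have "cmod (\<phi> (\<sigma> c j)) powr q \<le> C powr q * \<sigma> c j powr p" for j
  proof -
    have "cmod (\<phi> (\<sigma> c j)) powr q \<le> (C * \<sigma> c j powr (p / q)) powr q"
      using le[OF \<sigma>] q by (intro powr_mono2) auto
    also have "\<dots> = C powr q * \<sigma> c j powr p" using q C by (simp add: powr_mult powr_powr)
    finally show ?thesis .
  qed
  hence "(\<Sum>j<dim_at c. cmod (\<phi> (\<sigma> c j)) powr q) \<le> C powr q * (\<Sum>j<dim_at c. \<sigma> c j powr p)"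
    unfolding sum_distrib_left by (intro sum_mono)
  from mult_left_mono[OF this, of "real (dim_at c)"]
  show ?thesis by (simp add: mass_calc[OF q c] mult_ac)
qed

lemma calc_bound:
  assumes q: "1 \<le> q" and C: "0 \<le> C"
    and le: "\<And>x. 0 \<le> x \<Longrightarrow> cmod (\<phi> x) \<le> C * x powr (p / q)"
  shows "calc \<phi> \<in> points (ell q)" and "nrm (ell q) (calc \<phi>) \<le> C"
proof -
  have "sum (mass q (calc \<phi>)) A \<le> C powr q" if A: "finite A" "A \<subseteq> dual" for A
  proof -
    have "sum (mass q (calc \<phi>)) A \<le>
        (\<Sum>c\<in>A. C powr q * (real (dim_at c) * (\<Sum>j<dim_at c. \<sigma> c j powr p)))"
      using A by (intro sum_mono mass_calc_le[OF q C _ le]) auto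
    also have "\<dots> \<le> C powr q * 1"
      unfolding sum_distrib_left[symmetric] by (intro mult_left_mono total[OF A]) simp
    finally show ?thesis by simp
  qed
  from ell_pointsI[OF q calc_carrier C this]
  show "calc \<phi> \<in> points (ell q)" "nrm (ell q) (calc \<phi>) \<le> C" by auto
qed

lemma small_tail:
  assumes \<eta>: "0 < \<eta>"
  shows "\<exists>A0. finite A0 \<and> A0 \<subseteq> dual \<and> (\<forall>A. finite A \<and> A \<subseteq> dual - A0 \<longrightarrow>
    (\<Sum>c\<in>A. real (dim_at c) * (\<Sum>j<dim_at c. \<sigma> c j powr p)) \<le> \<eta>)"
proof -
  define m where "m c = real (dim_at c) * (\<Sum>j<dim_at c. \<sigma> c j powr p)" for c
  define X where "X = {sum m A | A. finite A \<and> A \<subseteq> dual}"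
  have X: "bdd_above X" "X \<noteq> {}"
    using total by (auto simp: X_def m_def intro!: bdd_aboveI[of _ 1])
  have "Sup X - \<eta> < Sup X" using \<eta> by simp
  then obtain x where "x \<in> X" "Sup X - \<eta> < x" using less_cSup_iff[OF X(2,1)] by blast
  then obtain A0 where A0: "finite A0" "A0 \<subseteq> dual" "Sup X - \<eta> < sum m A0"
    unfolding X_def by blast
  have "sum m A \<le> \<eta>" if A: "finite A" "A \<subseteq> dual - A0" for A
  proof -
    have "sum m (A \<union> A0) \<le> Sup X"
      using A A0 by (intro cSup_upper X(1)) (auto simp: X_def)
    moreover have "sum m (A \<union> A0) = sum m A + sum m A0"
      using A A0 by (intro sum.union_disjoint) auto
    ultimately show ?thesis using A0(3) by simp
  qed
  thus ?thesis using A0 unfolding m_def by blast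
qed

text \<open>Dominated convergence: outside a finite set of classes the dominating masses are small.\<close>

lemma calc_dominated_convergence:
  assumes q: "1 \<le> q" and C: "0 \<le> C"
    and dom: "\<forall>\<^sub>F w in F. \<forall>x\<ge>0. cmod (\<phi> w x) \<le> C * x powr (p / q)"
    and lim: "\<And>x. 0 \<le> x \<Longrightarrow> ((\<lambda>w. \<phi> w x) \<longlongrightarrow> 0) F"
  shows "((\<lambda>w. nrm (ell q) (calc (\<phi> w))) \<longlongrightarrow> 0) F"
proof (rule tendstoI)
  fix e :: real assume e: "0 < e"
  define \<epsilon> where "\<epsilon> = (e / 2) powr q / 2"
  have \<epsilon>: "0 < \<epsilon>" using e by (simp add: \<epsilon>_def)
  define \<eta> where "\<eta> = \<epsilon> / (C powr q + 1)"
  have C1: "0 < C powr q + 1" by (simp add: add_nonneg_pos)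
  have \<eta>: "0 < \<eta>" using \<epsilon> C1 by (simp add: \<eta>_def)
  from small_tail[OF \<eta>] obtain A0 where A0: "finite A0" "A0 \<subseteq> dual"
    and tail: "\<forall>A. finite A \<and> A \<subseteq> dual - A0 \<longrightarrow>
      (\<Sum>c\<in>A. real (dim_at c) * (\<Sum>j<dim_at c. \<sigma> c j powr p)) \<le> \<eta>"
    by (elim exE conjE)
  have "((\<lambda>w. \<Sum>c\<in>A0. real (dim_at c) * (\<Sum>j<dim_at c. cmod (\<phi> w (\<sigma> c j)) powr q)) \<longlongrightarrow>
      (\<Sum>c\<in>A0. real (dim_at c) * (\<Sum>j<dim_at c. 0))) F"
  proof (rule tendsto_sum, rule tendsto_mult[OF tendsto_const], rule tendsto_sum)
    fix c j
    show "((\<lambda>w. cmod (\<phi> w (\<sigma> c j)) powr q) \<longlongrightarrow> 0) F"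
      by (rule tendsto_zero_powrI[OF tendsto_norm_zero[OF lim[OF \<sigma>]] tendsto_const]) (use q in simp_all)
  qed
  hence "\<forall>\<^sub>F w in F. (\<Sum>c\<in>A0. real (dim_at c) * (\<Sum>j<dim_at c. cmod (\<phi> w (\<sigma> c j)) powr q)) < \<epsilon>"
    by (rule order_tendstoD(2)) (use \<epsilon> in simp)
  thus "\<forall>\<^sub>F w in F. dist (nrm (ell q) (calc (\<phi> w))) 0 < e"
    using dom
  proof eventually_elim
    case (elim w)
    have "nrm (ell q) (calc (\<phi> w)) \<le> e / 2"
    proof (rule ell_pointsI(2)[OF q calc_carrier])
      fix A assume A: "finite A" "A \<subseteq> dual"
      have "sum (mass q (calc (\<phi> w))) (A - A0) \<le>
          (\<Sum>c\<in>A - A0. C powr q * (real (dim_at c) * (\<Sum>j<dim_at c. \<sigma> c j powr p)))"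
        using A elim(2) by (intro sum_mono mass_calc_le[OF q C]) auto
      also have "\<dots> \<le> C powr q * \<eta>"
        unfolding sum_distrib_left[symmetric] using A by (intro mult_left_mono tail[rule_format]) auto
      also have "\<dots> \<le> (C powr q + 1) * \<eta>" using \<eta> by simp
      also have "\<dots> = \<epsilon>" using C1 by (simp add: \<eta>_def)
      finally have 1: "sum (mass q (calc (\<phi> w))) (A - A0) \<le> \<epsilon>" .
      have "sum (mass q (calc (\<phi> w))) (A \<inter> A0) \<le> sum (mass q (calc (\<phi> w))) A0"
        using A0(1) by (intro sum_mono2) (auto simp: mass_nonneg)
      also have "\<dots> = (\<Sum>c\<in>A0. real (dim_at c) * (\<Sum>j<dim_at c. cmod (\<phi> w (\<sigma> c j)) powr q))"
        using A0(2) by (intro sum.cong refl mass_calc[OF q]) auto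
      finally have 2: "sum (mass q (calc (\<phi> w))) (A \<inter> A0) \<le> \<epsilon>" using elim(1) by simp
      have "sum (mass q (calc (\<phi> w))) A \<le> \<epsilon> + \<epsilon>"
        using 1 2 sum.Int_Diff[OF A(1), of "mass q (calc (\<phi> w))" A0] by simp
      thus "sum (mass q (calc (\<phi> w))) A \<le> (e / 2) powr q" by (simp add: \<epsilon>_def)
    qed (use e in simp)
    thus ?case using e ell_nrm_nonneg[of q "calc (\<phi> w)"] by (simp add: dist_real_def)
  qed
qed

context
  fixes p0 p1 a b :: real
  assumes p0: "1 \<le> p0" and p1: "1 \<le> p1" and a: "a = p / p0" and b: "b = p / p1 - p / p0"
begin

lemma calc_split: "calc \<phi> = calc (lower_part b \<phi>) \<oplus>\<^bsub>fields\<^esub> calc (upper_part b \<phi>)"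
  unfolding calc_add by (intro arg_cong[of _ _ calc]) (auto simp: lower_part_def upper_part_def)

lemma parts_le:
  assumes "0 \<le> C" "cmod (\<phi> x) \<le> C * strip_envelope a b x"
  shows "cmod (lower_part b \<phi> x) \<le> C * x powr (p / p0)" "cmod (upper_part b \<phi> x) \<le> C * x powr (p / p1)"
  using lower_part_le[of C \<phi> x a b] upper_part_le[of C \<phi> x a b] assms by (simp_all add: a b)

lemma calc_sum_bound:
  assumes C: "0 \<le> C" and le: "\<And>x. 0 \<le> x \<Longrightarrow> cmod (\<phi> x) \<le> C * strip_envelope a b x"
  shows "calc \<phi> \<in> points (ell_sum p0 p1)" and "nrm (ell_sum p0 p1) (calc \<phi>) \<le> 2 * C"
proof -
  note 0 = calc_bound[OF p0 C, of "lower_part b \<phi>", OF parts_le(1)[OF C le]]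
    and 1 = calc_bound[OF p1 C, of "upper_part b \<phi>", OF parts_le(2)[OF C le]]
  show "calc \<phi> \<in> points (ell_sum p0 p1)"
    unfolding ell_sum_points_iff
    by (intro exI[of _ "calc (lower_part b \<phi>)"] exI[of _ "calc (upper_part b \<phi>)"] conjI 0 1 calc_split)
  have "nrm (ell_sum p0 p1) (calc \<phi>) \<le> nrm (ell p0) (calc (lower_part b \<phi>)) + nrm (ell p1) (calc (upper_part b \<phi>))"
    unfolding calc_split[of \<phi>] using 0 1 by (intro ell_sum_nrm_le) auto
  thus "nrm (ell_sum p0 p1) (calc \<phi>) \<le> 2 * C" using 0 1 by linarith
qed

lemma calc_sum_dominated_convergence:
  assumes C: "0 \<le> C"
    and dom: "\<forall>\<^sub>F w in F. \<forall>x\<ge>0. cmod (\<phi> w x) \<le> C * strip_envelope a b x"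
    and lim: "\<And>x. 0 \<le> x \<Longrightarrow> ((\<lambda>w. \<phi> w x) \<longlongrightarrow> 0) F"
  shows "((\<lambda>w. nrm (ell_sum p0 p1) (calc (\<phi> w))) \<longlongrightarrow> 0) F"
proof (rule tendsto_sandwich[OF _ _ tendsto_const])
  have l0: "((\<lambda>w. lower_part b (\<phi> w) x) \<longlongrightarrow> 0) F" "((\<lambda>w. upper_part b (\<phi> w) x) \<longlongrightarrow> 0) F" if "0 \<le> x" for x
    by (intro tendsto_parts lim[OF that])+
  have d0: "\<forall>\<^sub>F w in F. \<forall>x\<ge>0. cmod (lower_part b (\<phi> w) x) \<le> C * x powr (p / p0)"
    "\<forall>\<^sub>F w in F. \<forall>x\<ge>0. cmod (upper_part b (\<phi> w) x) \<le> C * x powr (p / p1)"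
    by (use dom in \<open>eventually_elim; intro allI impI parts_le[OF C]; blast\<close>)+
  have "((\<lambda>w. nrm (ell p0) (calc (lower_part b (\<phi> w))) + nrm (ell p1) (calc (upper_part b (\<phi> w)))) \<longlongrightarrow> 0 + 0) F"
    by (intro tendsto_add calc_dominated_convergence[OF p0 C d0(1) l0(1)]
        calc_dominated_convergence[OF p1 C d0(2) l0(2)])
  thus "((\<lambda>w. nrm (ell p0) (calc (lower_part b (\<phi> w))) + nrm (ell p1) (calc (upper_part b (\<phi> w)))) \<longlongrightarrow> 0) F"
    by simp
  show "\<forall>\<^sub>F w in F. nrm (ell_sum p0 p1) (calc (\<phi> w)) \<le>
      nrm (ell p0) (calc (lower_part b (\<phi> w))) + nrm (ell p1) (calc (upper_part b (\<phi> w)))"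
    using d0
  proof eventually_elim
    case (elim w)
    have "calc (lower_part b (\<phi> w)) \<in> points (ell p0)"
      by (rule calc_bound(1)[OF p0 C]) (use elim in auto)
    moreover have "calc (upper_part b (\<phi> w)) \<in> points (ell p1)"
      by (rule calc_bound(1)[OF p1 C]) (use elim in auto)
    ultimately show ?case unfolding calc_split[of "\<phi> w"] by (rule ell_sum_nrm_le)
  qed
  show "\<forall>\<^sub>F w in F. 0 \<le> nrm (ell_sum p0 p1) (calc (\<phi> w))"
    using dom by eventually_elim (intro ell_sum_nrm_nonneg calc_sum_bound(1)[OF C], auto)
qed

lemma calc_boundary_admissible:
  fixes h :: "real \<Rightarrow> real \<Rightarrow> complex"
  assumes q: "1 \<le> q" and \<delta>: "0 < \<delta>" and M: "0 \<le> M"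
    and le: "\<And>t x. 0 \<le> x \<Longrightarrow> cmod (h t x) \<le> M * exp (- (\<delta> * t\<^sup>2)) * x powr (p / q)"
    and cont: "\<And>x. continuous_on UNIV (\<lambda>t. h t x)"
  shows "boundary_admissible fields (ell q) (\<lambda>t. calc (h t))"
    and "nrm (ell q) (calc (h t)) \<le> M"
proof -
  have le_M: "cmod (h t x) \<le> M * x powr (p / q)" if "0 \<le> x" for t x
  proof -
    have "M * exp (- (\<delta> * t\<^sup>2)) * x powr (p / q) \<le> M * 1 * x powr (p / q)"
      using M \<delta> by (intro mult_right_mono mult_left_mono) auto
    thus ?thesis using le[OF that, of t] by simp
  qed
  show "nrm (ell q) (calc (h t)) \<le> M" by (rule calc_bound(2)[OF q M le_M])
  have pts: "calc (h t) \<in> points (ell q)" for t by (rule calc_bound(1)[OF q M le_M])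
  have nrm_le: "nrm (ell q) (calc (h t)) \<le> M * exp (- (\<delta> * t\<^sup>2))" for t
    using M by (intro calc_bound(2)[OF q] le) auto
  have "((\<lambda>w. nrm (ell q) (calc (h w) \<ominus>\<^bsub>fields\<^esub> calc (h t))) \<longlongrightarrow> 0) (at t)" for t
    unfolding calc_minus
  proof (rule calc_dominated_convergence[OF q])
    show "0 \<le> 2 * M" using M by simp
    have "cmod (h w x - h t x) \<le> 2 * M * x powr (p / q)" if "0 \<le> x" for w x
      using norm_triangle_ineq4[of "h w x" "h t x"] le_M[OF that, of w] le_M[OF that, of t] by simp
    thus "\<forall>\<^sub>F w in at t. \<forall>x\<ge>0. cmod (h w x - h t x) \<le> 2 * M * x powr (p / q)" by simp
    fix x :: real
    have "((\<lambda>w. h w x) \<longlongrightarrow> h t x) (at t)" using cont[of x] by (simp add: continuous_on_def)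
    thus "((\<lambda>w. h w x - h t x) \<longlongrightarrow> 0) (at t)" by (simp add: LIM_zero)
  qed
  moreover have "((\<lambda>t. nrm (ell q) (calc (h t))) \<longlongrightarrow> 0) at_infinity"
  proof (rule tendsto_sandwich[OF _ _ tendsto_const])
    have "((\<lambda>t. M / \<delta> * (inverse t)\<^sup>2) \<longlongrightarrow> M / \<delta> * 0\<^sup>2) (at_infinity :: real filter)"
      by (intro tendsto_intros tendsto_inverse_0)
    thus "((\<lambda>t. M / \<delta> * (inverse t)\<^sup>2) \<longlongrightarrow> 0) (at_infinity :: real filter)" by simp
    show "\<forall>\<^sub>F t in at_infinity. nrm (ell q) (calc (h t)) \<le> M / \<delta> * (inverse t)\<^sup>2"
      using eventually_not_equal_at_infinity[of 0]
    proof eventually_elim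
      case (elim t)
      have "\<delta> * t\<^sup>2 \<le> exp (\<delta> * t\<^sup>2)" using exp_ge_add_one_self[of "\<delta> * t\<^sup>2"] by linarith
      hence "exp (- (\<delta> * t\<^sup>2)) \<le> 1 / (\<delta> * t\<^sup>2)" using elim \<delta> by (simp add: exp_minus field_simps)
      from mult_left_mono[OF this M] show ?case using nrm_le[of t] by (simp add: field_simps)
    qed
  qed (simp add: ell_nrm_nonneg)
  ultimately show "boundary_admissible fields (ell q) (\<lambda>t. calc (h t))"
    using pts by (auto simp: boundary_admissible_def norm_continuous_on_def)
qed

lemma calc_power_family_interp:
  assumes M: "0 \<le> M" and \<delta>: "0 < \<delta>"
  shows "(\<lambda>z. calc (power_family a b M \<delta> \<theta> z)) \<in> interp_functions fields (ell p0) (ell p1)"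
    and "interp_functions_norm (ell p0) (ell p1) (\<lambda>z. calc (power_family a b M \<delta> \<theta> z)) \<le> M * exp \<delta>"
proof -
  define \<phi> where "\<phi> = power_family a b M \<delta> \<theta>"
  define \<phi>' where "\<phi>' = power_family_deriv a b M \<delta> \<theta>"
  define f where "f z = calc (\<phi> z)" for z
  define C where "C = M * exp \<delta>"
  have C: "0 \<le> C" using M by (simp add: C_def)
  have le: "cmod (\<phi> z x) \<le> C * strip_envelope a b x" if "0 \<le> x" "0 \<le> Re z" "Re z \<le> 1" for z x
    unfolding \<phi>_def C_def by (rule power_family_le[OF that(1) M \<delta> that(2,3)])
  have deriv: "((\<lambda>z. \<phi> z x) has_field_derivative \<phi>' z x) (at z within S)" for x z S
    unfolding \<phi>_def \<phi>'_def by (rule has_field_derivative_power_family)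
  have cont: "continuous_on S (\<lambda>z. \<phi> z x)" for x S
    using deriv by (rule DERIV_continuous_on)
  have pts: "f z \<in> points (ell_sum p0 p1)" and bdd: "nrm (ell_sum p0 p1) (f z) \<le> 2 * C"
    if "0 \<le> Re z" "Re z \<le> 1" for z
    unfolding f_def using calc_sum_bound[OF C, of "\<phi> z"] le[OF _ that] by auto
  have "norm_continuous_on fields (ell_sum p0 p1) {z. 0 \<le> Re z \<and> Re z \<le> 1} f"
    unfolding norm_continuous_on_def
  proof (intro conjI ballI)
    show "f ` {z. 0 \<le> Re z \<and> Re z \<le> 1} \<subseteq> points (ell_sum p0 p1)" using pts by auto
    fix z assume z: "z \<in> {z. 0 \<le> Re z \<and> Re z \<le> 1}"
    show "((\<lambda>w. nrm (ell_sum p0 p1) (f w \<ominus>\<^bsub>fields\<^esub> f z)) \<longlongrightarrow> 0)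
        (at z within {z. 0 \<le> Re z \<and> Re z \<le> 1})"
      unfolding f_def calc_minus
    proof (rule calc_sum_dominated_convergence)
      show "0 \<le> 2 * C" using C by simp
      have "cmod (\<phi> w x - \<phi> z x) \<le> 2 * C * strip_envelope a b x"
        if "0 \<le> x" "w \<in> {z. 0 \<le> Re z \<and> Re z \<le> 1}" for w x
        using norm_triangle_ineq4[of "\<phi> w x" "\<phi> z x"] le[of x w] le[of x z] that z by simp
      thus "\<forall>\<^sub>F w in at z within {z. 0 \<le> Re z \<and> Re z \<le> 1}.
          \<forall>x\<ge>0. cmod (\<phi> w x - \<phi> z x) \<le> 2 * C * strip_envelope a b x"
        by (simp add: eventually_at_filter)
      fix x :: real
      show "((\<lambda>w. \<phi> w x - \<phi> z x) \<longlongrightarrow> 0) (at z within {z. 0 \<le> Re z \<and> Re z \<le> 1})"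
        using cont[of "{z. 0 \<le> Re z \<and> Re z \<le> 1}" x] z by (simp add: continuous_on_def LIM_zero)
    qed
  qed
  moreover have "norm_analytic_on fields (ell_sum p0 p1) {z. 0 < Re z \<and> Re z < 1} f"
    unfolding norm_analytic_on_def
  proof (intro conjI ballI)
    show "f ` {z. 0 < Re z \<and> Re z < 1} \<subseteq> points (ell_sum p0 p1)" using pts by auto
    fix z assume z: "z \<in> {z. 0 < Re z \<and> Re z < 1}"
    \<comment> \<open>half the distance to the boundary, so that the whole ball keeps the distance \<open>\<rho>\<close> from it\<close>
    define \<rho> where "\<rho> = min (Re z) (1 - Re z) / 2"
    have \<rho>: "0 < \<rho>" "2 * \<rho> \<le> Re z" "Re z \<le> 1 - 2 * \<rho>" "\<rho> \<le> 1"
      using z by (auto simp: \<rho>_def min_def)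
    define K where "K = (2 * \<delta> * (cmod z + 1) + 1 / \<rho>) * C"
    have K: "0 \<le> K" using \<delta> C \<rho>(1) by (simp add: K_def)
    have near: "\<rho> \<le> Re w \<and> Re w \<le> 1 - \<rho> \<and> cmod w \<le> cmod z + 1" if "w \<in> ball z \<rho>" for w
    proof -
      have d: "cmod (w - z) < \<rho>" using that by (simp add: dist_norm norm_minus_commute)
      have "\<bar>Re w - Re z\<bar> < \<rho>" using abs_Re_le_cmod[of "w - z"] d by simp
      moreover have "cmod w \<le> cmod z + cmod (w - z)" using norm_triangle_ineq[of z "w - z"] by simp
      ultimately show ?thesis using \<rho> d by linarith
    qed
    have dle: "cmod (\<phi>' w x) \<le> K * strip_envelope a b x" if x: "0 \<le> x" and w: "w \<in> ball z \<rho>" for w x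
    proof -
      have "cmod (\<phi>' w x) \<le> (2 * \<delta> * cmod w + 1 / \<rho>) * (M * exp \<delta> * strip_envelope a b x)"
        unfolding \<phi>'_def using near[OF w] by (intro power_family_deriv_le[OF x M \<delta> \<rho>(1)]) auto
      also have "\<dots> \<le> (2 * \<delta> * (cmod z + 1) + 1 / \<rho>) * (M * exp \<delta> * strip_envelope a b x)"
        using near[OF w] M \<delta>
        by (intro mult_right_mono add_right_mono mult_left_mono) (auto simp: strip_envelope_def)
      finally show ?thesis by (simp add: K_def C_def mult_ac)
    qed
    have z_ball: "z \<in> ball z \<rho>" using \<rho>(1) by simp
    show "\<exists>d\<in>points (ell_sum p0 p1). ((\<lambda>w. nrm (ell_sum p0 p1)
        (((1 / (w - z)) \<odot>\<^bsub>fields\<^esub> (f w \<ominus>\<^bsub>fields\<^esub> f z)) \<ominus>\<^bsub>fields\<^esub> d)) \<longlongrightarrow> 0) (at z)"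
    proof (rule bexI)
      show "calc (\<phi>' z) \<in> points (ell_sum p0 p1)"
        by (rule calc_sum_bound(1)[OF K dle[OF _ z_ball]])
      show "((\<lambda>w. nrm (ell_sum p0 p1)
        (((1 / (w - z)) \<odot>\<^bsub>fields\<^esub> (f w \<ominus>\<^bsub>fields\<^esub> f z)) \<ominus>\<^bsub>fields\<^esub> calc (\<phi>' z))) \<longlongrightarrow> 0) (at z)"
        unfolding f_def calc_minus calc_smult
      proof (rule calc_sum_dominated_convergence)
        show "0 \<le> 2 * K" using K by simp
        have "cmod (1 / (w - z) * (\<phi> w x - \<phi> z x) - \<phi>' z x) \<le> 2 * K * strip_envelope a b x"
          if x: "0 \<le> x" and w: "w \<in> ball z \<rho>" "w \<noteq> z" for w x
        proof -
          \<comment> \<open>mean value inequality: the bound on the derivative passes to difference quotients\<close>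
          have "cmod (\<phi> w x - \<phi> z x) \<le> K * strip_envelope a b x * cmod (w - z)"
            by (rule field_differentiable_bound[OF convex_ball deriv dle[OF x] w(1) z_ball])
          hence "cmod (1 / (w - z) * (\<phi> w x - \<phi> z x)) \<le> K * strip_envelope a b x"
            using w(2) by (simp add: norm_divide norm_mult field_simps)
          thus ?thesis
            using norm_triangle_ineq4[of "1 / (w - z) * (\<phi> w x - \<phi> z x)" "\<phi>' z x"] dle[OF x z_ball] by simp
        qed
        moreover have "\<forall>\<^sub>F w in at z. w \<in> ball z \<rho> \<and> w \<noteq> z"
          using eventually_at_in_open[OF open_ball z_ball] by (auto elim: eventually_mono)
        ultimately show "\<forall>\<^sub>F w in at z. \<forall>x\<ge>0. cmod (1 / (w - z) * (\<phi> w x - \<phi> z x) - \<phi>' z x) \<le>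
            2 * K * strip_envelope a b x"
          by (auto elim!: eventually_mono)
        fix x :: real
        have "((\<lambda>w. (\<phi> w x - \<phi> z x) / (w - z)) \<longlongrightarrow> \<phi>' z x) (at z)"
          using deriv[of x z UNIV] by (simp add: has_field_derivative_iff)
        thus "((\<lambda>w. 1 / (w - z) * (\<phi> w x - \<phi> z x) - \<phi>' z x) \<longlongrightarrow> 0) (at z)"
          by (simp add: LIM_zero)
      qed
    qed
  qed
  moreover have line: "boundary_admissible fields (ell q) (\<lambda>t. f (Complex y t))"
    "nrm (ell q) (f (Complex y t)) \<le> C"
    if q: "1 \<le> q" and y: "y = 0 \<and> q = p0 \<or> y = 1 \<and> q = p1" for q y t
  proof -
    have "cmod (\<phi> (Complex y t) x) \<le> C * exp (- (\<delta> * t\<^sup>2)) * x powr (p / q)" if x: "0 \<le> x" for t x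
    proof (cases "x = 0")
      case True
      thus ?thesis by (simp add: \<phi>_def power_family_def)
    next
      case False
      hence x: "x > 0" using x by simp
      have "y\<^sup>2 \<le> 1" using y by auto
      hence "y\<^sup>2 - t\<^sup>2 - \<theta>\<^sup>2 \<le> 1 - t\<^sup>2" using zero_le_power2[of \<theta>] by linarith
      hence "\<delta> * (y\<^sup>2 - t\<^sup>2 - \<theta>\<^sup>2) \<le> \<delta> * (1 - t\<^sup>2)" using \<delta> by (intro mult_left_mono) auto
      hence e: "exp (\<delta> * (y\<^sup>2 - t\<^sup>2 - \<theta>\<^sup>2)) \<le> exp \<delta> * exp (- (\<delta> * t\<^sup>2))"
        by (simp add: algebra_simps flip: exp_add)
      have "cmod (\<phi> (Complex y t) x) = M * exp (\<delta> * (y\<^sup>2 - t\<^sup>2 - \<theta>\<^sup>2)) * exp ((a + b * y) * ln x)"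
        using x M by (simp add: \<phi>_def power_family_def norm_mult power2_eq_square)
      also have "\<dots> \<le> M * (exp \<delta> * exp (- (\<delta> * t\<^sup>2))) * exp ((a + b * y) * ln x)"
        using e M by (intro mult_right_mono mult_left_mono) auto
      also have "a + b * y = p / q" using y by (auto simp: a b)
      finally show ?thesis using x by (simp add: C_def powr_def)
    qed
    moreover have "continuous_on UNIV (\<lambda>t. \<phi> (Complex y t) x)" for x
      by (rule continuous_on_compose2[OF cont[of UNIV]]) (auto intro!: continuous_intros)
    ultimately show "boundary_admissible fields (ell q) (\<lambda>t. f (Complex y t))"
      "nrm (ell q) (f (Complex y t)) \<le> C"
      unfolding f_def
      using calc_boundary_admissible[OF q \<delta> C, of "\<lambda>t. \<phi> (Complex y t)"] by blast+
  qed
  ultimately show "(\<lambda>z. calc (power_family a b M \<delta> \<theta> z)) \<in> interp_functions fields (ell p0) (ell p1)"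
    using bdd line(1)[OF p0, of 0] line(1)[OF p1, of 1]
    unfolding interp_functions_def f_def[abs_def] \<phi>_def
    by (intro CollectI conjI exI[of _ "2 * C"] allI impI) auto
  show "interp_functions_norm (ell p0) (ell p1) (\<lambda>z. calc (power_family a b M \<delta> \<theta> z)) \<le> M * exp \<delta>"
    using line(2)[OF p0, of 0] line(2)[OF p1, of 1]
    unfolding interp_functions_norm_def f_def \<phi>_def C_def by (auto intro!: cSUP_least)
qed

end

end

section \<open>The interpolation theorem\<close>

text \<open>
  Dividing the singular values by a number \<open>M\<close> above the norm of \<open>H\<close>, rather than by the norm itself,
  covers the zero field as well. Choosing \<open>M < K\<close> leaves room for the factor \<open>exp \<delta>\<close> that the damping costs.
\<close>

lemma (in dual_fields) interp_function_through:
  fixes p0 p1 p \<theta> :: real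
  assumes p0: "1 \<le> p0" and p1: "1 \<le> p1" and \<theta>: "0 < \<theta>" "\<theta> < 1"
    and p: "1 / p = (1 - \<theta>) / p0 + \<theta> / p1"
    and H: "H \<in> points (ell p)" and K: "nrm (ell p) H < K"
  shows "\<exists>f\<in>interp_functions fields (ell p0) (ell p1). f (complex_of_real \<theta>) = H \<and>
    interp_functions_norm (ell p0) (ell p1) f \<le> K"
proof -
  note p_ge = interpolated_exponent_ge_1[OF p0 p1 \<theta> p]
  define M where "M = (nrm (ell p) H + K) / 2"
  have M: "nrm (ell p) H < M" "M < K" using K by (simp_all add: M_def)
  have M0: "0 < M" using M ell_nrm_nonneg[of p H] by simp
  define \<delta> where "\<delta> = ln (K / M)"
  have \<delta>: "0 < \<delta>" using M M0 by (simp add: \<delta>_def)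
  have K_eq: "M * exp \<delta> = K" using M M0 by (simp add: \<delta>_def)
  have Hc: "H \<in> carrier fields" using H by (simp add: ell_points_iff)
  obtain U V s where UV: "\<And>c. c \<in> dual \<Longrightarrow> unitary_mat (dim_at c) (U c)"
    "\<And>c. c \<in> dual \<Longrightarrow> unitary_mat (dim_at c) (V c)" and s: "\<And>c j. 0 \<le> s c j"
    and svd: "\<And>c. c \<in> dual \<Longrightarrow> H c = U c * mat_diag (dim_at c) (\<lambda>j. complex_of_real (s c j)) * V c"
    using field_singular_values[OF Hc] by metis
  define \<sigma> where "\<sigma> c j = s c j / M" for c j
  interpret S: singular_fields G T r U V \<sigma> p
  proof
    fix A assume A: "finite A" "A \<subseteq> dual"
    have "(\<Sum>c\<in>A. real (dim_at c) * (\<Sum>j<dim_at c. \<sigma> c j powr p)) = (\<Sum>c\<in>A. mass p H c / M powr p)"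
    proof (intro sum.cong refl)
      fix c assume "c \<in> A"
      hence c: "c \<in> dual" using A by auto
      show "real (dim_at c) * (\<Sum>j<dim_at c. \<sigma> c j powr p) = mass p H c / M powr p"
        unfolding mass_def svd[OF c] using schatten_norm_powr_diag[OF UV[OF c], of p] p_ge s M0
        by (simp add: \<sigma>_def powr_divide flip: sum_divide_distrib)
    qed
    also have "\<dots> = sum (mass p H) A / M powr p" by (simp add: sum_divide_distrib)
    also have "\<dots> \<le> M powr p / M powr p"
      using M ell_nrm_nonneg[of p H] p_ge
      by (intro divide_right_mono order_trans[OF ell_sum_le[OF p_ge H A]] powr_mono2) auto
    finally show "(\<Sum>c\<in>A. real (dim_at c) * (\<Sum>j<dim_at c. \<sigma> c j powr p)) \<le> 1" using M0 by simp
  qed (use UV s M0 p_ge in \<open>auto simp: \<sigma>_def\<close>)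
  define a b where "a = p / p0" and "b = p / p1 - p / p0"
  have ab: "a + b * \<theta> = 1"
  proof -
    have "a + b * \<theta> = p * ((1 - \<theta>) / p0 + \<theta> / p1)" by (simp add: a_def b_def algebra_simps diff_divide_distrib)
    also have "\<dots> = 1" using p_ge by (simp flip: p)
    finally show ?thesis .
  qed
  have pf: "power_family a b M \<delta> \<theta> (complex_of_real \<theta>) x = complex_of_real (M * x)" if "0 \<le> x" for x
  proof (cases "x = 0")
    case False
    hence x: "0 < x" using that by simp
    have "(complex_of_real a + complex_of_real b * complex_of_real \<theta>) = 1"
      using ab by (metis of_real_1 of_real_add of_real_mult)
    thus ?thesis using x by (simp add: power_family_def exp_of_real)
  qed (simp add: power_family_def)
  have "S.calc (power_family a b M \<delta> \<theta> (complex_of_real \<theta>)) = H"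
  proof (rule extensionalityI[where A = dual])
    fix c assume c: "c \<in> dual"
    show "S.calc (power_family a b M \<delta> \<theta> (complex_of_real \<theta>)) c = H c"
      using c M0 by (simp add: S.calc_def pf S.\<sigma> svd[OF c]) (simp add: \<sigma>_def)
  qed (use Hc S.calc_carrier in \<open>auto simp: fields_carrier_iff\<close>)
  thus ?thesis
    using S.calc_power_family_interp[OF p0 p1 a_def b_def less_imp_le[OF M0] \<delta>, of \<theta>] K_eq
    by (intro bexI[of _ "\<lambda>z. S.calc (power_family a b M \<delta> \<theta> z)"]) auto
qed

theorem proposition3p4:
  fixes G :: "('g, 'm) monoid_scheme" and T :: "'g topology"
    and r :: "'g unirep set \<Rightarrow> 'g unirep"
    and p\<^sub>0 p\<^sub>1 p \<theta> :: real
  assumes "compact_group G T"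
    and "representatives G T r"
    and "1 \<le> p\<^sub>0" and "1 \<le> p\<^sub>1"
    and "0 < \<theta>" and "\<theta> < 1"
    and "1 / p = (1 - \<theta>) / p\<^sub>0 + \<theta> / p\<^sub>1"
  shows "points (complex_interp (matrix_fields G T r) (l_sch G T r p\<^sub>0) (l_sch G T r p\<^sub>1) \<theta>) =
      points (l_sch G T r p) \<and>
    (\<forall>H\<in>points (l_sch G T r p).
      nrm (complex_interp (matrix_fields G T r) (l_sch G T r p\<^sub>0) (l_sch G T r p\<^sub>1) \<theta>) H =
      nrm (l_sch G T r p) H)"
proof -
  interpret dual_fields G T r by unfold_locales (rule assms(2))
  define \<F> where "\<F> = interp_functions fields (ell p\<^sub>0) (ell p\<^sub>1)"
  define N where "N = interp_functions_norm (ell p\<^sub>0) (ell p\<^sub>1)"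
  have lower: "f (complex_of_real \<theta>) \<in> points (ell p)" "nrm (ell p) (f (complex_of_real \<theta>)) \<le> N f"
    if "f \<in> \<F>" for f
    using interp_norm_dominates[OF assms(3-7)] that by (auto simp: \<F>_def N_def)
  have upper: "\<exists>f\<in>\<F>. f (complex_of_real \<theta>) = H \<and> N f \<le> K"
    if "H \<in> points (ell p)" "nrm (ell p) H < K" for H K
    using interp_function_through[OF assms(3-7) that] by (simp add: \<F>_def N_def)
  have in_sum: "f (complex_of_real \<theta>) \<in> points (ell_sum p\<^sub>0 p\<^sub>1)" if "f \<in> \<F>" for f
    using that assms(5,6) by (auto simp: \<F>_def interp_functions_def norm_continuous_on_def)
  have pts: "points (complex_interp fields (ell p\<^sub>0) (ell p\<^sub>1) \<theta>) =
      {x \<in> points (ell_sum p\<^sub>0 p\<^sub>1). \<exists>f\<in>\<F>. f (complex_of_real \<theta>) = x}"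
    by (simp add: complex_interp_def \<F>_def)
  have "points (complex_interp fields (ell p\<^sub>0) (ell p\<^sub>1) \<theta>) = points (ell p)"
  proof (intro subset_antisym subsetI)
    fix H assume "H \<in> points (complex_interp fields (ell p\<^sub>0) (ell p\<^sub>1) \<theta>)"
    thus "H \<in> points (ell p)" unfolding pts using lower(1) by blast
  next
    fix H assume "H \<in> points (ell p)"
    then obtain f where "f \<in> \<F>" "f (complex_of_real \<theta>) = H"
      using upper[of H "nrm (ell p) H + 1"] by auto
    thus "H \<in> points (complex_interp fields (ell p\<^sub>0) (ell p\<^sub>1) \<theta>)" unfolding pts using in_sum by blast
  qed
  moreover have "nrm (complex_interp fields (ell p\<^sub>0) (ell p\<^sub>1) \<theta>) H = nrm (ell p) H"
    if H: "H \<in> points (ell p)" for H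
  proof -
    define X where "X = {N f | f. f \<in> \<F> \<and> f (complex_of_real \<theta>) = H}"
    have X: "nrm (complex_interp fields (ell p\<^sub>0) (ell p\<^sub>1) \<theta>) H = Inf X"
      by (simp add: complex_interp_def X_def \<F>_def N_def)
    have ge: "nrm (ell p) H \<le> x" if "x \<in> X" for x
      using that lower(2) by (auto simp: X_def)
    have "X \<noteq> {}" using upper[OF H, of "nrm (ell p) H + 1"] by (auto simp: X_def)
    hence "nrm (ell p) H \<le> Inf X" using ge by (rule cInf_greatest)
    moreover have "Inf X \<le> K" if K: "nrm (ell p) H < K" for K
    proof -
      obtain f where f: "f \<in> \<F>" "f (complex_of_real \<theta>) = H" "N f \<le> K" using upper[OF H K] by blast
      have "Inf X \<le> N f" using f ge by (intro cInf_lower bdd_belowI) (auto simp: X_def)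
      thus ?thesis using f(3) by simp
    qed
    hence "Inf X \<le> nrm (ell p) H" by (rule dense_ge)
    ultimately show ?thesis using X by simp
  qed
  ultimately show ?thesis by blast
qed

end
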